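(* Let $V$ be a closed isometric operator in a Hilbert space $H$, and let $z_0\in\mathbb{D}\setminus\{0\}$ be a fixed point. Let $\mathbf{R}_z=\mathbf{R}_z(V)$ be an arbitrary generalized resolvent of $V$, and let $C(\lambda;z_0)\in\mathcal{S}(N_{z_0};N_{1/\overline{z_0}})$ correspond to $\mathbf{R}_z(V)$ by Inin's formula. Let $\Delta$ be an open arc of $\mathbb{T}$. Then $\mathbf{R}_z(V)$ has an analytic continuation to the set $\mathbb{D}\cup\mathbb{D}_e\cup\Delta$ if and only if the following conditions are satisfied: 1) $C(\lambda;z_0)$ has an extension to the set $\mathbb{D}\cup\Delta$ which is continuous in the uniform operator (norm) topology; 2) the extended $C(\lambda;z_0)$ maps $N_{z_0}$ isometrically onto the whole of $N_{1/\overline{z_0}}$, for all $\lambda\in\Delta$; 3) the operator $(E_H-\lambda V_{C(\lambda;z_0);z_0})^{-1}$ exists and is defined on the whole of $H$, for all $\lambda\in\Delta$.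
   Context: All Hilbert spaces are complex and separable. $\mathbb{D}=\{|z|<1\}$, $\mathbb{D}_e=\{|z|>1\}$, $\mathbb{T}=\{|z|=1\}$, $\mathbb{T}_e=\mathbb{D}\cup\mathbb{D}_e$. A closed isometric operator $V$ in $H$ is a linear isometry defined on a closed subspace $D(V)\subseteq H$ with range $R(V)\subseteq H$. $E_H$ is the identity on $H$. Generalized resolvent: if $U\supseteq V$ is a unitary operator in a Hilbert space $\widetilde H\supseteq H$, the function $\mathbf{R}_\zeta h=P^{\widetilde H}_H(E_{\widetilde H}-\zeta U)^{-1}h$, $h\in H$, $\zeta\in\mathbb{T}_e$, is a generalized resolvent of $V$ ($P^{\widetilde H}_H$ is the orthogonal projection onto $H$). An analytic continuation to $\mathbb{D}\cup\mathbb{D}_e\cup\Delta$ means an analytic operator-valued function on this set that coincides with $\mathbf{R}_z$ on $\mathbb{D}\cup\mathbb{D}_e$. Set $M_\zeta=(E_H-\zeta V)D(V)$, $N_\zeta=H\ominus M_\zeta$ for $\zeta\in\mathbb{C}$ ($\ominus$ denotes the orthogonal complement). For $z\in\mathbb{D}$ put $V_z=(V-\overline z E_H)(E_H-zV)^{-1}$, an isometric operator with domain $M_z$ and range $M_{1/\overline z}$. For $z_0\in\mathbb{D}\setminus\{0\}$ and a linear contraction $C$ with $D(C)=N_{z_0}$, $R(C)\subseteq N_{1/\overline{z_0}}$, set $V^+_{z_0;C}=V_{z_0}\oplus C$ (a bounded operator on $H=M_{z_0}\oplus N_{z_0}$) and $$V_{C;z_0}=(V^+_{z_0;C}+\overline{z_0}E_H)(E_H+z_0V^+_{z_0;C})^{-1}.$$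 $\mathcal{S}(H_1;H_2)$ is the set of all analytic operator-valued functions $F$ on $\mathbb{D}$ whose values $F(\zeta)$ are linear contractions with domain $H_1$ and range contained in $H_2$. Inin's formula (known): for fixed $z_0\in\mathbb{D}$, $$\mathbf{R}_\zeta=\left[E_H-\zeta V_{C(\zeta;z_0);z_0}\right]^{-1},\quad \zeta\in\mathbb{D},$$ establishes a one-to-one correspondence between all generalized resolvents of $V$ and all functions $C(\zeta)=C(\zeta;z_0)\in\mathcal{S}(N_{z_0};N_{1/\overline{z_0}})$. *)

theory Defs
  imports "HOL-Analysis.Analysis"
begin

section \<open>Complex Hilbert spaces\<close>

class complex_vector = real_vector +
  fixes scaleC :: "complex \<Rightarrow> 'a \<Rightarrow> 'a"  (infixr "*\<^sub>C" 75)
  assumes scaleC_add_right: "c *\<^sub>C (x + y) = c *\<^sub>C x + c *\<^sub>C y"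
    and scaleC_add_left: "(b + c) *\<^sub>C x = b *\<^sub>C x + c *\<^sub>C x"
    and scaleC_scaleC: "b *\<^sub>C (c *\<^sub>C x) = (b * c) *\<^sub>C x"
    and scaleR_scaleC: "r *\<^sub>R x = complex_of_real r *\<^sub>C x"

text \<open>Norm and topology come from \<^class>\<open>real_inner\<close>: the real part of the complex inner
  product is the inner product of the underlying real space, so
  \<open>norm x = sqrt (Re (cinner x x))\<close>. The inner product is linear in the first argument.\<close>

class complex_inner = complex_vector + real_inner +
  fixes cinner :: "'a \<Rightarrow> 'a \<Rightarrow> complex"
  assumes cinner_commute: "cinner x y = cnj (cinner y x)"
    and cinner_add_left: "cinner (x + y) z = cinner x z + cinner y z"
    and cinner_scaleC_left: "cinner (c *\<^sub>C x) y = c * cinner x y"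
    and inner_eq_Re_cinner: "inner x y = Re (cinner x y)"

class separable_chilbert = complex_inner + complete_space +
  assumes countable_dense: "\<exists>S. countable S \<and> (\<forall>x. \<forall>e>0. \<exists>y\<in>S. dist y x < e)"

instantiation complex :: separable_chilbert
begin

definition scaleC_complex :: "complex \<Rightarrow> complex \<Rightarrow> complex"
  where "scaleC_complex c x = c * x"

definition cinner_complex :: "complex \<Rightarrow> complex \<Rightarrow> complex"
  where "cinner_complex x y = x * cnj y"

instance
proof
  fix b c x y z :: complex and r :: real
  show "c *\<^sub>C (x + y) = c *\<^sub>C x + c *\<^sub>C y" "(b + c) *\<^sub>C x = b *\<^sub>C x + c *\<^sub>C x"
    "b *\<^sub>C (c *\<^sub>C x) = (b * c) *\<^sub>C x"
    by (simp_all add: scaleC_complex_def distrib_left distrib_right mult.assoc)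
  show "r *\<^sub>R x = complex_of_real r *\<^sub>C x"
    by (simp only: scaleC_complex_def scaleR_conv_of_real)
  show "cinner x y = cnj (cinner y x)" "cinner (x + y) z = cinner x z + cinner y z"
    "cinner (c *\<^sub>C x) y = c * cinner x y"
    by (simp_all add: scaleC_complex_def cinner_complex_def distrib_right)
  show "inner x y = Re (cinner x y)"
    by (simp add: cinner_complex_def inner_complex_def)
next
  obtain S :: "complex set" where S: "countable S"
      and dense: "\<And>X. open X \<Longrightarrow> X \<noteq> {} \<Longrightarrow> \<exists>d\<in>S. d \<in> X"
    by (rule countable_dense_setE) blast
  have "\<exists>y\<in>S. dist y x < e" if "e > 0" for x e
    using dense[of "ball x e"] that by (auto simp: dist_commute)
  with S show "\<exists>S::complex set. countable S \<and> (\<forall>x. \<forall>e>0. \<exists>y\<in>S. dist y x < e)"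
    by (intro exI[of _ S]) simp
qed

end

definition csubspace :: "'a::complex_vector set \<Rightarrow> bool"
  where "csubspace S \<longleftrightarrow>
    0 \<in> S \<and> (\<forall>x\<in>S. \<forall>y\<in>S. x + y \<in> S) \<and> (\<forall>c. \<forall>x\<in>S. c *\<^sub>C x \<in> S)"

definition orth_compl :: "'a::complex_inner set \<Rightarrow> 'a set"
  where "orth_compl M = {x. \<forall>m\<in>M. cinner x m = 0}"

text \<open>Meaningful for closed subspaces \<open>M\<close>.\<close>

definition orth_proj :: "'a::complex_inner set \<Rightarrow> 'a \<Rightarrow> 'a"
  where "orth_proj M x = (THE p. p \<in> M \<and> x - p \<in> orth_compl M)"


section \<open>Operators with a prescribed domain\<close>

text \<open>An operator with domain \<open>S\<close> is a total function of which only the values on the subspace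
  \<open>S\<close> matter.\<close>

definition clinear_on :: "'a::complex_vector set \<Rightarrow> ('a \<Rightarrow> 'b::complex_vector) \<Rightarrow> bool"
  where "clinear_on S f \<longleftrightarrow>
    (\<forall>x\<in>S. \<forall>y\<in>S. f (x + y) = f x + f y) \<and> (\<forall>c. \<forall>x\<in>S. f (c *\<^sub>C x) = c *\<^sub>C f x)"

definition bounded_clinear_on :: "'a::complex_inner set \<Rightarrow> ('a \<Rightarrow> 'b::complex_inner) \<Rightarrow> bool"
  where "bounded_clinear_on S f \<longleftrightarrow>
    clinear_on S f \<and> (\<exists>K. \<forall>x\<in>S. norm (f x) \<le> K * norm x)"

definition contraction_on :: "'a::complex_inner set \<Rightarrow> ('a \<Rightarrow> 'b::complex_inner) \<Rightarrow> bool"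
  where "contraction_on S f \<longleftrightarrow> clinear_on S f \<and> (\<forall>x\<in>S. norm (f x) \<le> norm x)"

definition isometric_on :: "'a::complex_inner set \<Rightarrow> ('a \<Rightarrow> 'b::complex_inner) \<Rightarrow> bool"
  where "isometric_on S f \<longleftrightarrow> clinear_on S f \<and> (\<forall>x\<in>S. norm (f x) = norm x)"

definition unitary :: "('a::complex_inner \<Rightarrow> 'a) \<Rightarrow> bool"
  where "unitary U \<longleftrightarrow> isometric_on UNIV U \<and> range U = UNIV"

definition closed_isometric :: "'a::complex_inner set \<Rightarrow> ('a \<Rightarrow> 'a) \<Rightarrow> bool"
  where "closed_isometric D V \<longleftrightarrow> csubspace D \<and> closed D \<and> isometric_on D V"

text \<open>Operator norm of the restriction to \<open>S\<close> (cf. \<^const>\<open>onorm\<close>); the quotient at \<open>x = 0\<close>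
  is \<open>0\<close>. Only applied to bounded operators.\<close>

definition onorm_on :: "'a::complex_inner set \<Rightarrow> ('a \<Rightarrow> 'b::complex_inner) \<Rightarrow> real"
  where "onorm_on S f = (SUP x\<in>S. norm (f x) / norm x)"

definition op_continuous_on ::
  "'a::complex_inner set \<Rightarrow> complex set \<Rightarrow> (complex \<Rightarrow> 'a \<Rightarrow> 'b::complex_inner) \<Rightarrow> bool"
  where "op_continuous_on S A F \<longleftrightarrow>
    (\<forall>z\<in>A. bounded_clinear_on S (F z)) \<and>
    (\<forall>z\<in>A. ((\<lambda>w. onorm_on S (\<lambda>x. F w x - F z x)) \<longlongrightarrow> 0) (at z within A))"

text \<open>Complex differentiability in operator norm, for open \<open>A\<close>, of a function whose values are
  bounded operators with domain \<open>S\<close>.\<close>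

definition op_analytic_on ::
  "'a::complex_inner set \<Rightarrow> complex set \<Rightarrow> (complex \<Rightarrow> 'a \<Rightarrow> 'b::complex_inner) \<Rightarrow> bool"
  where "op_analytic_on S A F \<longleftrightarrow>
    (\<forall>z\<in>A. bounded_clinear_on S (F z)) \<and>
    (\<forall>z\<in>A. \<exists>F'. bounded_clinear_on S F' \<and>
      ((\<lambda>w. onorm_on S (\<lambda>x. inverse (w - z) *\<^sub>C (F w x - F z x) - F' x)) \<longlongrightarrow> 0)
        (at z within A))"


section \<open>Generalized resolvents and Inin's formula\<close>

abbreviation disc :: "complex set"
  where "disc \<equiv> ball 0 1"

abbreviation ext_disc :: "complex set"
  where "ext_disc \<equiv> {z. 1 < norm z}"

definition open_arc :: "complex set \<Rightarrow> bool"
  where "open_arc \<Delta> \<longleftrightarrow> (\<exists>a b::real. a < b \<and> b \<le> a + 2 * pi \<and> \<Delta> = cis ` {a<..<b})"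

text \<open>The inclusion of \<open>H\<close> in the larger Hilbert space is an isometric embedding \<open>J\<close> of the type
  \<open>'a\<close> in the type \<open>'b\<close>, and the projection onto \<open>H\<close> is the one onto \<open>range J\<close> followed by the
  inverse of \<open>J\<close>. As HOL cannot quantify existentially over the type \<open>'b\<close>, the data \<open>J\<close>, \<open>U\<close>
  are arguments.\<close>

definition is_generalized_resolvent ::
  "'a::separable_chilbert set \<Rightarrow> ('a \<Rightarrow> 'a) \<Rightarrow> ('a \<Rightarrow> 'b::separable_chilbert) \<Rightarrow> ('b \<Rightarrow> 'b) \<Rightarrow>
    (complex \<Rightarrow> 'a \<Rightarrow> 'a) \<Rightarrow> bool"
  where "is_generalized_resolvent D V J U R \<longleftrightarrow>
    isometric_on UNIV J \<and> unitary U \<and> (\<forall>x\<in>D. U (J x) = J (V x)) \<and>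
    (\<forall>\<zeta>\<in>disc \<union> ext_disc. \<forall>h.
      R \<zeta> h = inv J (orth_proj (range J) (inv (\<lambda>x. x - \<zeta> *\<^sub>C U x) (J h))))"

definition M_space :: "'a::complex_inner set \<Rightarrow> ('a \<Rightarrow> 'a) \<Rightarrow> complex \<Rightarrow> 'a set"
  where "M_space D V \<zeta> = (\<lambda>f. f - \<zeta> *\<^sub>C V f) ` D"

definition N_space :: "'a::complex_inner set \<Rightarrow> ('a \<Rightarrow> 'a) \<Rightarrow> complex \<Rightarrow> 'a set"
  where "N_space D V \<zeta> = orth_compl (M_space D V \<zeta>)"

text \<open>\<open>(V - cnj z E) (E - z V)\<^sup>-\<^sup>1\<close> on \<open>M_space D V z\<close>\<close>

definition V_frac :: "'a::complex_inner set \<Rightarrow> ('a \<Rightarrow> 'a) \<Rightarrow> complex \<Rightarrow> 'a \<Rightarrow> 'a"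
  where "V_frac D V z y =
    (let f = the_inv_into D (\<lambda>f. f - z *\<^sub>C V f) y in V f - cnj z *\<^sub>C f)"

definition V_plus ::
  "'a::complex_inner set \<Rightarrow> ('a \<Rightarrow> 'a) \<Rightarrow> complex \<Rightarrow> ('a \<Rightarrow> 'a) \<Rightarrow> 'a \<Rightarrow> 'a"
  where "V_plus D V z0 C x =
    V_frac D V z0 (orth_proj (M_space D V z0) x) + C (orth_proj (N_space D V z0) x)"

text \<open>\<open>(V_plus + cnj z0 E) (E + z0 V_plus)\<^sup>-\<^sup>1\<close>\<close>

definition V_ext ::
  "'a::complex_inner set \<Rightarrow> ('a \<Rightarrow> 'a) \<Rightarrow> complex \<Rightarrow> ('a \<Rightarrow> 'a) \<Rightarrow> 'a \<Rightarrow> 'a"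
  where "V_ext D V z0 C x =
    (let f = inv (\<lambda>f. f + z0 *\<^sub>C V_plus D V z0 C f) x
     in V_plus D V z0 C f + cnj z0 *\<^sub>C f)"

definition schur_class ::
  "'a::complex_inner set \<Rightarrow> 'b::complex_inner set \<Rightarrow> (complex \<Rightarrow> 'a \<Rightarrow> 'b) \<Rightarrow> bool"
  where "schur_class H1 H2 F \<longleftrightarrow>
    op_analytic_on H1 disc F \<and> (\<forall>\<zeta>\<in>disc. contraction_on H1 (F \<zeta>) \<and> F \<zeta> ` H1 \<subseteq> H2)"

definition inin_corresponds ::
  "'a::complex_inner set \<Rightarrow> ('a \<Rightarrow> 'a) \<Rightarrow> complex \<Rightarrow> (complex \<Rightarrow> 'a \<Rightarrow> 'a) \<Rightarrow>
    (complex \<Rightarrow> 'a \<Rightarrow> 'a) \<Rightarrow> bool"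
  where "inin_corresponds D V z0 R C \<longleftrightarrow>
    schur_class (N_space D V z0) (N_space D V (1 / cnj z0)) C \<and>
    (\<forall>\<zeta>\<in>disc. R \<zeta> = inv (\<lambda>x. x - \<zeta> *\<^sub>C V_ext D V z0 (C \<zeta>) x))"

end

theory Submission
  imports Defs "HOL-Complex_Analysis.Complex_Analysis"
begin

text \<open>Put \<open>W\<^sub>\<zeta> = V_plus D V z0 (C \<zeta>)\<close>, the contraction \<open>V\<^bsub>z0\<^esub> \<oplus> C(\<zeta>)\<close>, and
\<open>B\<^sub>\<zeta> = (1 - \<zeta> cnj z0) - (\<zeta> - z0) W\<^sub>\<zeta>\<close> (\<open>pencil\<close>). Multiplying out the fractional linear
transformation in Inin's formula turns it into \<open>R\<^sub>\<zeta> B\<^sub>\<zeta> = 1 + z0 W\<^sub>\<zeta>\<close>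
(\<open>mobius_resolvent\<close>), and everything rests on this relation. It implies
\<open>L\<^sub>\<zeta> B\<^sub>\<zeta> = \<zeta> (1 - |z0|\<^sup>2)\<close> with \<open>L\<^sub>\<zeta> = (\<zeta> - z0) R\<^sub>\<zeta> + z0\<close>
(\<open>scaled_pencil_inverse\<close>). The second ingredient is the reflection law of the compressed resolvent
of a unitary operator, \<open>R\<^sub>\<zeta>\<^sup>* + R\<^bsub>1/cnj \<zeta>\<^esub> = 1\<close> (\<open>generalized_resolvent_symmetry\<close>).

Suppose that \<open>R\<close> continues analytically to \<open>\<Delta>\<close>. As \<open>B\<^sub>\<zeta>\<close> has norm at most \<open>4\<close>, the operators
\<open>L\<^sub>\<zeta>\<close> are bounded below uniformly near a point \<open>w\<close> of the arc. Hence norm convergence of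
\<open>R\<^sub>\<zeta>\<close> forces norm convergence of \<open>W\<^sub>\<zeta>\<close> (\<open>mobius_resolvent_parameter_diff\<close>), that is, of
\<open>C(\<zeta>)\<close>, and the lower bound survives in the limit and makes \<open>B\<^sub>w\<close> bijective
(\<open>mobius_resolvent_limit\<close>). Letting \<open>\<zeta>\<close> tend to \<open>w\<close> in the reflection law gives
\<open>R\<^sub>w\<^sup>* + R\<^sub>w = 1\<close>, which says exactly that \<open>W\<^sub>w\<close> is isometric
(\<open>mobius_resolvent_isometric_iff\<close>). An isometry \<open>T\<close> for which \<open>1 - u T\<close> is onto for some
\<open>|u| = 1\<close> is itself onto (\<open>isometry_surjective\<close>), so \<open>W\<^sub>w\<close> is unitary, and \<open>C(w)\<close> maps the
complement \<open>N\<^bsub>z0\<^esub>\<close> of the domain of \<open>V\<^bsub>z0\<^esub>\<close> onto the complement of its range.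

Conversely, let \<open>C\<close> extend as described and define \<open>R\<^sub>w\<close> for \<open>w\<close> in \<open>\<Delta>\<close> by Inin's formula. Since
\<open>W\<^sub>w\<close> is isometric, \<open>R\<^sub>w\<close> has the everywhere defined adjoint \<open>1 - R\<^sub>w\<close>, hence it is bounded by
the Hellinger--Toeplitz argument (\<open>bounded_of_adjoint\<close>), and \<open>B\<^sub>w\<close> is bounded below. This is
stable under small perturbations of \<open>W\<close>, so \<open>R\<close> is norm continuous at \<open>w\<close> from inside the disc
(\<open>mobius_resolvent_continuous\<close>), and from outside by the reflection law. The scalar functions
\<open>cinner (R\<^sub>\<zeta> x) y\<close> are then continuous on the whole domain and holomorphic off the circle, hence
holomorphic (\<open>holomorphic_on_across_circle\<close>), and Cauchy's estimates, uniform in \<open>x\<close> and \<open>y\<close>,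
upgrade this to analyticity in the operator norm (\<open>op_analytic_of_weakly_holomorphic\<close>).\<close>

section \<open>Complex inner product spaces\<close>

interpretation scaleC: module "scaleC :: complex \<Rightarrow> 'a::complex_vector \<Rightarrow> 'a"
  by standard (simp_all add: scaleC_add_right scaleC_add_left scaleC_scaleC
      scaleR_scaleC[of 1, simplified, symmetric])

lemma cinner_self: "cinner x x = complex_of_real ((norm x)\<^sup>2)"
proof -
  have "Im (cinner x x) = 0"
    using cinner_commute[of x x] by (simp add: complex_eq_iff)
  moreover have "Re (cinner x x) = (norm x)\<^sup>2"
    by (simp add: inner_eq_Re_cinner[symmetric] power2_norm_eq_inner)
  ultimately show ?thesis by (simp add: complex_eq_iff)
qed

lemma cinner_add_right: "cinner x (y + z) = cinner x y + cinner x z"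
  by (metis cinner_add_left cinner_commute complex_cnj_add)

lemma cinner_scaleC_right: "cinner x (c *\<^sub>C y) = cnj c * cinner x y"
  by (metis cinner_commute cinner_scaleC_left complex_cnj_mult)

lemma norm_scaleC [simp]: "norm (c *\<^sub>C x) = cmod c * norm (x::'a::complex_inner)"
proof -
  have "complex_of_real ((norm (c *\<^sub>C x))\<^sup>2) = c * cnj c * cinner x x"
    by (simp only: cinner_self[symmetric] cinner_scaleC_left cinner_scaleC_right mult_ac)
  also have "\<dots> = complex_of_real ((cmod c * norm x)\<^sup>2)"
    by (simp only: cinner_self complex_norm_square[symmetric] of_real_mult power_mult_distrib)
  finally have "(norm (c *\<^sub>C x))\<^sup>2 = (cmod c * norm x)\<^sup>2"
    using of_real_eq_iff by blast
  then show ?thesis by (simp add: power2_eq_iff_nonneg)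
qed

lemma cinner_cauchy_schwarz: "cmod (cinner x y) \<le> norm x * norm y"
proof (cases "cinner x y = 0")
  case False
  define c where "c = cnj (cinner x y) / cmod (cinner x y)"
  have c: "cmod c = 1" using False by (simp add: c_def norm_divide)
  have "c * cinner x y = (cinner x y * cnj (cinner x y)) / cmod (cinner x y)"
    by (simp add: c_def)
  also have "\<dots> = complex_of_real (cmod (cinner x y))"
    unfolding complex_norm_square[symmetric] using False by (simp add: power2_eq_square)
  finally have "cmod (cinner x y) = Re (cinner (c *\<^sub>C x) y)"
    by (simp add: cinner_scaleC_left)
  also have "\<dots> \<le> norm (c *\<^sub>C x) * norm y"
    by (simp add: inner_eq_Re_cinner[symmetric] norm_cauchy_schwarz del: norm_scaleC)
  finally show ?thesis using c by simp
qed simp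

interpretation scaleC: bounded_bilinear "scaleC :: complex \<Rightarrow> 'a::complex_inner \<Rightarrow> 'a"
proof
  show "(r *\<^sub>R a) *\<^sub>C b = r *\<^sub>R a *\<^sub>C b" "a *\<^sub>C (r *\<^sub>R b) = r *\<^sub>R a *\<^sub>C b"
    for r a and b :: 'a
    by (simp_all add: scaleR_scaleC scaleC_scaleC scaleC_complex_def mult.commute)
  show "\<exists>K. \<forall>a b::'a. norm (a *\<^sub>C b) \<le> norm a * norm b * K"
    by (intro exI[of _ 1]) simp
qed (simp_all add: scaleC_add_right scaleC_add_left)

interpretation cinner: bounded_bilinear "cinner :: 'a::complex_inner \<Rightarrow> 'a \<Rightarrow> complex"
proof
  show "\<exists>K. \<forall>a b::'a. norm (cinner a b) \<le> norm a * norm b * K"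
    by (intro exI[of _ 1]) (simp add: cinner_cauchy_schwarz)
qed (simp_all add: cinner_add_left cinner_add_right scaleR_scaleC cinner_scaleC_left
    cinner_scaleC_right scaleC_complex_def)

lemmas cinner_simps = cinner_add_left cinner_add_right cinner.diff_left cinner.diff_right
  cinner_scaleC_left cinner_scaleC_right

lemma norm_diff_sq: "(norm (x - y))\<^sup>2 = (norm x)\<^sup>2 + (norm y)\<^sup>2 - 2 * Re (cinner x (y::'a::complex_inner))"
  by (simp add: power2_norm_eq_inner inner_diff_left inner_diff_right inner_commute
      inner_eq_Re_cinner[symmetric])

lemma norm_add_sq: "(norm (x + y))\<^sup>2 = (norm x)\<^sup>2 + (norm y)\<^sup>2 + 2 * Re (cinner x (y::'a::complex_inner))"
  by (simp add: power2_norm_eq_inner inner_add_left inner_add_right inner_commute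
      inner_eq_Re_cinner[symmetric])

lemma norm_le_of_cinner_bound:
  assumes "\<And>y. cmod (cinner x y) \<le> K * norm y" and "0 \<le> K" shows "norm x \<le> K"
proof (cases "x = 0")
  case False
  have "norm x * norm x \<le> K * norm x"
    using assms(1)[of x] by (simp add: cinner_self power2_eq_square norm_mult)
  with False show ?thesis by simp
qed (use assms in simp)

lemma cinner_eqI: "(\<And>z. cinner x z = cinner y z) \<Longrightarrow> x = y"
proof -
  assume "\<And>z. cinner x z = cinner y z"
  then have "cinner (x - y) (x - y) = 0" by (simp add: cinner.diff_left)
  then show ?thesis by (simp add: cinner_self)
qed

lemma csubspaceD:
  assumes "csubspace S"
  shows "0 \<in> S" "x \<in> S \<Longrightarrow> y \<in> S \<Longrightarrow> x + y \<in> S" "x \<in> S \<Longrightarrow> c *\<^sub>C x \<in> S"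
    "x \<in> S \<Longrightarrow> y \<in> S \<Longrightarrow> x - y \<in> S"
proof -
  show *: "0 \<in> S" "x \<in> S \<Longrightarrow> y \<in> S \<Longrightarrow> x + y \<in> S" "x \<in> S \<Longrightarrow> c *\<^sub>C x \<in> S" for x y c
    using assms by (auto simp: csubspace_def)
  show "x \<in> S \<Longrightarrow> y \<in> S \<Longrightarrow> x - y \<in> S"
    using *(2)[of x "(-1) *\<^sub>C y"] *(3)[of y "-1"] by simp
qed

lemma csubspace_UNIV [simp]: "csubspace UNIV" by (simp add: csubspace_def)

lemma clinear_onD:
  assumes "clinear_on S f" "csubspace S" "x \<in> S"
  shows "y \<in> S \<Longrightarrow> f (x + y) = f x + f y" "f (c *\<^sub>C x) = c *\<^sub>C f x"
    "y \<in> S \<Longrightarrow> f (x - y) = f x - f y"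
proof -
  have *: "y \<in> S \<Longrightarrow> f (x + y) = f x + f y" "f (c *\<^sub>C x) = c *\<^sub>C f x" if "x \<in> S" for x y c
    using assms(1) that by (auto simp: clinear_on_def)
  show "y \<in> S \<Longrightarrow> f (x + y) = f x + f y" "f (c *\<^sub>C x) = c *\<^sub>C f x"
    using * assms(3) by auto
  show "f (x - y) = f x - f y" if "y \<in> S"
    using *(1)[OF assms(3), of "(-1) *\<^sub>C y"] *(2)[OF that, of "-1"] csubspaceD(3)[OF assms(2) that, of "-1"]
    by simp
qed

lemmas clinear_UNIV = clinear_onD[OF _ csubspace_UNIV UNIV_I, simplified]

lemma clinear_on_zero: "clinear_on S f \<Longrightarrow> csubspace S \<Longrightarrow> f 0 = 0"
  using clinear_onD(3)[of S f 0 0] csubspaceD(1)[of S] by simp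

text \<open>Polarization. The imaginary parts follow from the real parts because
  \<open>Im (cinner u v) = Re (cinner (-\<i> u) v)\<close>.\<close>

lemma isometric_on_cinner:
  assumes iso: "isometric_on S f" and S: "csubspace S" and x: "x \<in> S" and y: "y \<in> S"
  shows "cinner (f x) (f y) = cinner x y"
proof -
  have lin: "clinear_on S f" and nrm: "\<And>x. x \<in> S \<Longrightarrow> norm (f x) = norm x"
    using iso by (auto simp: isometric_on_def)
  have Re: "Re (cinner (f x) (f y)) = Re (cinner x y)" if "x \<in> S" for x
    using norm_add_sq[of x y] norm_add_sq[of "f x" "f y"] nrm[of "x + y"] nrm[of x] nrm[of y]
      that y clinear_onD(1)[OF lin S that y] csubspaceD(2)[OF S that y] by simp
  have Im: "Im (cinner u v) = Re (cinner ((-\<i>) *\<^sub>C u) v)" for u v :: "'c::complex_inner"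
    by (simp only: cinner_scaleC_left) simp
  have "Im (cinner (f x) (f y)) = Im (cinner x y)"
    unfolding Im
    using Re[OF csubspaceD(3)[OF S x, of "-\<i>"]] clinear_onD(2)[OF lin S x, of "-\<i>"]
    by simp
  with Re[OF x] show ?thesis by (simp add: complex_eq_iff)
qed

text \<open>A Cauchy sequence in the image has a Cauchy sequence of preimages, because \<open>f\<close> is bounded below.\<close>

lemma closed_image_bounded_below:
  fixes f :: "'a::{complex_inner,complete_space} \<Rightarrow> 'b::complex_inner"
  assumes S: "csubspace S" "closed S" and lin: "clinear_on S f"
    and upper: "\<And>x. x \<in> S \<Longrightarrow> norm (f x) \<le> K * norm x"
    and lower: "\<And>x. x \<in> S \<Longrightarrow> c * norm x \<le> norm (f x)" and c: "c > 0"
  shows "closed (f ` S)"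
proof (subst closed_sequential_limits, intro allI impI, elim conjE)
  fix u l assume "\<forall>n. u n \<in> f ` S" and ul: "u \<longlonglongrightarrow> l"
  then obtain v where v: "\<And>n. v n \<in> S" "\<And>n. u n = f (v n)"
    using choice[of "\<lambda>n x. x \<in> S \<and> u n = f x"] by (auto simp: image_iff)
  have "Cauchy v"
  proof (rule metric_CauchyI)
    fix e :: real assume e: "e > 0"
    obtain N where N: "\<And>m n. m \<ge> N \<Longrightarrow> n \<ge> N \<Longrightarrow> dist (u m) (u n) < c * e"
      using metric_CauchyD[OF LIMSEQ_imp_Cauchy[OF ul], of "c * e"] c e by auto
    have "dist (v m) (v n) < e" if "m \<ge> N" "n \<ge> N" for m n
    proof -
      have "c * norm (v m - v n) \<le> norm (u m - u n)"
        using lower[OF csubspaceD(4)[OF S(1) v(1) v(1)]] by (simp add: v clinear_onD(3)[OF lin S(1)])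
      also have "\<dots> < c * e" using N[OF that] by (simp add: dist_norm)
      finally show ?thesis using c by (simp add: dist_norm)
    qed
    then show "\<exists>N. \<forall>m\<ge>N. \<forall>n\<ge>N. dist (v m) (v n) < e" by blast
  qed
  then obtain x where x: "v \<longlonglongrightarrow> x" using Cauchy_convergent convergent_def by blast
  have xS: "x \<in> S" using closed_sequentially[OF S(2) v(1) x] .
  have "(\<lambda>n. f (v n) - f x) \<longlonglongrightarrow> 0"
  proof (rule Lim_null_comparison)
    show "\<forall>\<^sub>F n in sequentially. norm (f (v n) - f x) \<le> K * norm (v n - x)"
      using upper[OF csubspaceD(4)[OF S(1) v(1) xS]] clinear_onD(3)[OF lin S(1) v(1) xS] by simp
    have "(\<lambda>n. norm (v n - x)) \<longlonglongrightarrow> 0"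
      using x by (simp add: LIM_zero_iff tendsto_norm_zero_iff)
    then show "(\<lambda>n. K * norm (v n - x)) \<longlonglongrightarrow> 0" by (rule tendsto_mult_right_zero)
  qed
  then have "u \<longlonglongrightarrow> f x" by (simp add: LIM_zero_iff v(2)[abs_def, symmetric] flip: v(2))
  then show "l \<in> f ` S" using LIMSEQ_unique[OF ul] xS by blast
qed

lemma csubspace_image:
  assumes "csubspace S" "clinear_on S f" shows "csubspace (f ` S)"
  unfolding csubspace_def
proof (intro conjI ballI allI)
  show "0 \<in> f ` S" using clinear_on_zero[OF assms(2,1)] csubspaceD(1)[OF assms(1)] by force
  fix u c assume "u \<in> f ` S"
  then obtain x where x: "x \<in> S" "u = f x" by blast
  show "c *\<^sub>C u \<in> f ` S"
    using clinear_onD(2)[OF assms(2,1) x(1), of c] csubspaceD(3)[OF assms(1) x(1), of c] x(2)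
    by (auto simp: image_iff intro!: bexI[of _ "c *\<^sub>C x"])
  fix v assume "v \<in> f ` S"
  then obtain y where y: "y \<in> S" "v = f y" by blast
  show "u + v \<in> f ` S"
    using clinear_onD(1)[OF assms(2,1) x(1) y(1)] csubspaceD(2)[OF assms(1) x(1) y(1)] x(2) y(2)
    by (auto simp: image_iff intro!: bexI[of _ "x + y"])
qed

section \<open>Orthogonal projections\<close>

lemma parallelogram:
  "(norm (x - y))\<^sup>2 + (norm (x + y))\<^sup>2 = 2 * (norm x)\<^sup>2 + 2 * (norm (y::'a::complex_inner))\<^sup>2"
  by (simp add: norm_diff_sq norm_add_sq)

lemma csubspace_orth_compl: "csubspace (orth_compl M)"
  by (simp add: csubspace_def orth_compl_def cinner_add_left cinner_scaleC_left cinner.zero_left)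

lemma closed_orth_compl: "closed (orth_compl M)"
proof -
  have "orth_compl M = (\<Inter>m\<in>M. {x. cinner x m = 0})" by (auto simp: orth_compl_def)
  moreover have "closed {x. cinner x m = 0}" for m :: 'a
    by (intro closed_Collect_eq continuous_intros cinner.continuous_on)
  ultimately show ?thesis by auto
qed

lemma orth_complD: "x \<in> orth_compl M \<Longrightarrow> m \<in> M \<Longrightarrow> cinner x m = 0"
  "x \<in> orth_compl M \<Longrightarrow> m \<in> M \<Longrightarrow> cinner m x = 0"
  using cinner_commute[of m x] by (auto simp: orth_compl_def)

text \<open>The point of \<open>M\<close> closest to \<open>x\<close>. By the parallelogram law every minimizing sequence is Cauchy, and
  its limit \<open>p\<close> has \<open>x - p\<close> orthogonal to \<open>M\<close>, since otherwise a small step inside \<open>M\<close> would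
  decrease the distance.\<close>

lemma orth_decomposition_exists:
  fixes M :: "'a::{complex_inner,complete_space} set"
  assumes M: "csubspace M" "closed M"
  shows "\<exists>p\<in>M. x - p \<in> orth_compl M"
proof -
  define d where "d = infdist x M"
  have M0: "M \<noteq> {}" using csubspaceD(1)[OF M(1)] by auto
  have d0: "0 \<le> d" by (simp add: d_def infdist_nonneg)
  have dle: "d \<le> norm (x - m)" if "m \<in> M" for m
    using infdist_le[OF that, of x] by (simp add: d_def dist_norm)
  have near: "\<exists>m\<in>M. norm (x - m) < d + e" if "e > 0" for e
    using cInf_lessD[of "(\<lambda>m. dist x m) ` M" "d + e"] M0 that
    by (auto simp: d_def dist_norm infdist_notempty)
  have "\<exists>u. u \<in> M \<and> norm (x - u) < d + inverse (real (Suc n))" for n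
    using near[of "inverse (real (Suc n))"] by auto
  then obtain m where m: "\<And>n. m n \<in> M" "\<And>n. norm (x - m n) < d + inverse (real (Suc n))"
    using choice[of "\<lambda>n u. u \<in> M \<and> norm (x - u) < d + inverse (real (Suc n))"] by blast
  have close: "(norm (m k - m l))\<^sup>2 \<le> 2 * ((norm (x - m k))\<^sup>2 + (norm (x - m l))\<^sup>2 - 2 * d\<^sup>2)" for k l
  proof -
    \<comment> \<open>The midpoint has distance at least \<open>d\<close> from \<open>x\<close>.\<close>
    have mid: "(1/2) *\<^sub>R (m k + m l) \<in> M"
      using csubspaceD(3)[OF M(1) csubspaceD(2)[OF M(1) m(1) m(1)], of "1/2" k l]
      by (simp add: scaleR_scaleC)
    have "(x - m k) + (x - m l) = 2 *\<^sub>R (x - (1/2) *\<^sub>R (m k + m l))"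
      by (simp add: scaleR_right_diff_distrib scaleR_2)
    then have "norm ((x - m k) + (x - m l)) = 2 * norm (x - (1/2) *\<^sub>R (m k + m l))"
      by simp
    then have "4 * d\<^sup>2 \<le> (norm ((x - m k) + (x - m l)))\<^sup>2"
      using power_mono[OF dle[OF mid] d0, of 2] by simp
    then show ?thesis
      using parallelogram[of "x - m k" "x - m l"] by (simp add: norm_minus_commute)
  qed
  have lim: "(\<lambda>n. norm (x - m n)) \<longlonglongrightarrow> d"
  proof (rule tendsto_sandwich)
    show "\<forall>\<^sub>F n in sequentially. d \<le> norm (x - m n)" using dle m(1) by simp
    show "\<forall>\<^sub>F n in sequentially. norm (x - m n) \<le> d + inverse (real (Suc n))"
      using m(2) less_imp_le by (auto intro!: always_eventually)
    show "(\<lambda>n. d + inverse (real (Suc n))) \<longlonglongrightarrow> d"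
      using tendsto_add[OF tendsto_const[of d] LIMSEQ_inverse_real_of_nat] by simp
  qed simp
  have "Cauchy m"
  proof (rule metric_CauchyI)
    fix e :: real assume e: "e > 0"
    have "(\<lambda>n. (norm (x - m n))\<^sup>2) \<longlonglongrightarrow> d\<^sup>2" by (intro tendsto_power lim)
    then have "\<forall>\<^sub>F n in sequentially. (norm (x - m n))\<^sup>2 < d\<^sup>2 + e\<^sup>2 / 4"
      by (rule order_tendstoD(2)) (use e in simp)
    then obtain N where N: "\<And>n. n \<ge> N \<Longrightarrow> (norm (x - m n))\<^sup>2 < d\<^sup>2 + e\<^sup>2 / 4"
      by (auto simp: eventually_sequentially)
    have "dist (m k) (m l) < e" if "k \<ge> N" "l \<ge> N" for k l
    proof -
      have "(norm (m k - m l))\<^sup>2 < e\<^sup>2"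
        using close[of k l] N[OF that(1)] N[OF that(2)] by (simp add: algebra_simps)
      then show ?thesis using e by (simp add: dist_norm power2_less_imp_less)
    qed
    then show "\<exists>N. \<forall>k\<ge>N. \<forall>l\<ge>N. dist (m k) (m l) < e" by blast
  qed
  then obtain p where p: "m \<longlonglongrightarrow> p" using Cauchy_convergent convergent_def by blast
  have pM: "p \<in> M" using closed_sequentially[OF M(2) m(1) p] .
  have "(\<lambda>n. norm (x - m n)) \<longlonglongrightarrow> norm (x - p)" by (intro tendsto_intros p)
  then have dp: "d = norm (x - p)" using LIMSEQ_unique[OF lim] by simp
  have "cinner (x - p) u = 0" if u: "u \<in> M" for u
  proof (cases "u = 0")
    case False
    \<comment> \<open>The coefficient for which \<open>p + c u\<close> is the best approximation on the line through \<open>p\<close>.\<close>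
    define c where "c = cinner (x - p) u / (norm u)\<^sup>2"
    have "d\<^sup>2 \<le> (norm ((x - p) - c *\<^sub>C u))\<^sup>2"
      using dle[OF csubspaceD(2)[OF M(1) pM csubspaceD(3)[OF M(1) u, of c]]] d0
      by (intro power_mono) (simp_all add: diff_diff_eq)
    also have "\<dots> = d\<^sup>2 + (cmod c)\<^sup>2 * (norm u)\<^sup>2 - 2 * Re (cnj c * cinner (x - p) u)"
      by (simp add: norm_diff_sq cinner_scaleC_right dp power_mult_distrib)
    also have "cinner (x - p) u = c * (norm u)\<^sup>2" using False by (simp add: c_def)
    also have "cnj c * (c * complex_of_real ((norm u)\<^sup>2)) = complex_of_real ((cmod c)\<^sup>2 * (norm u)\<^sup>2)"
      using complex_norm_square[of c] by (simp add: mult_ac)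
    finally have "(cmod c)\<^sup>2 * (norm u)\<^sup>2 \<le> 0" by (simp add: mult.commute)
    then have "c = 0" using False by (simp add: mult_le_0_iff)
    then show ?thesis using False by (simp add: c_def)
  qed (simp add: cinner.zero_right)
  then show ?thesis using pM by (auto simp: orth_compl_def)
qed

lemma orth_decomposition_unique:
  assumes "csubspace M" "p \<in> M" "x - p \<in> orth_compl M" "q \<in> M" "x - q \<in> orth_compl M"
  shows "p = q"
proof -
  have "p - q \<in> M" using assms csubspaceD(4) by blast
  moreover have "p - q \<in> orth_compl M"
    using csubspaceD(4)[OF csubspace_orth_compl assms(5,3)] by simp
  ultimately have "cinner (p - q) (p - q) = 0" using orth_complD(1) by blast
  then show ?thesis by (simp add: cinner_self)
qed

lemma orth_proj_eqI:
  assumes "csubspace M" "p \<in> M" "x - p \<in> orth_compl M"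
  shows "orth_proj M x = p"
  unfolding orth_proj_def
proof (rule the_equality)
  show "p \<in> M \<and> x - p \<in> orth_compl M" using assms by simp
  show "q = p" if "q \<in> M \<and> x - q \<in> orth_compl M" for q
    using orth_decomposition_unique[OF assms(1), of q x p] assms(2,3) that by blast
qed

lemma orth_proj:
  fixes M :: "'a::{complex_inner,complete_space} set"
  assumes "csubspace M" "closed M"
  shows "orth_proj M x \<in> M" "x - orth_proj M x \<in> orth_compl M"
proof -
  obtain p where p: "p \<in> M" "x - p \<in> orth_compl M"
    using orth_decomposition_exists[OF assms] by blast
  show "orth_proj M x \<in> M" "x - orth_proj M x \<in> orth_compl M"
    unfolding orth_proj_eqI[OF assms(1) p] by (fact p)+
qed

lemma orth_proj_orth_compl:
  fixes M :: "'a::{complex_inner,complete_space} set"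
  assumes "csubspace M" "closed M"
  shows "orth_proj (orth_compl M) x = x - orth_proj M x"
proof (rule orth_proj_eqI[OF csubspace_orth_compl orth_proj(2)[OF assms]])
  have "cinner (orth_proj M x) m = 0" if "m \<in> orth_compl M" for m
    using that orth_proj(1)[OF assms] by (rule orth_complD(2))
  then show "x - (x - orth_proj M x) \<in> orth_compl (orth_compl M)"
    by (simp add: orth_compl_def[of "orth_compl M"])
qed

lemma cinner_orth_proj:
  fixes M :: "'a::{complex_inner,complete_space} set"
  assumes "csubspace M" "closed M" "m \<in> M"
  shows "cinner (orth_proj M x) m = cinner x m" "cinner m (orth_proj M x) = cinner m x"
  using orth_complD[OF orth_proj(2)[OF assms(1,2), of x] assms(3)] by (simp_all add: cinner_simps)

lemma clinear_orth_proj: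
  fixes M :: "'a::{complex_inner,complete_space} set"
  assumes M: "csubspace M" "closed M"
  shows "clinear_on UNIV (orth_proj M)"
proof -
  have "orth_proj M (x + y) = orth_proj M x + orth_proj M y" for x y
  proof (rule orth_proj_eqI[OF M(1)])
    show "orth_proj M x + orth_proj M y \<in> M"
      using csubspaceD(2)[OF M(1) orth_proj(1)[OF M] orth_proj(1)[OF M]] .
    show "x + y - (orth_proj M x + orth_proj M y) \<in> orth_compl M"
      using csubspaceD(2)[OF csubspace_orth_compl orth_proj(2)[OF M, of x] orth_proj(2)[OF M, of y]]
      by (simp add: algebra_simps)
  qed
  moreover have "orth_proj M (c *\<^sub>C x) = c *\<^sub>C orth_proj M x" for c x
  proof (rule orth_proj_eqI[OF M(1)])
    show "c *\<^sub>C orth_proj M x \<in> M" using csubspaceD(3)[OF M(1) orth_proj(1)[OF M]] .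
    show "c *\<^sub>C x - c *\<^sub>C orth_proj M x \<in> orth_compl M"
      using csubspaceD(3)[OF csubspace_orth_compl orth_proj(2)[OF M, of x], of c]
      by (simp add: scaleC.diff_right)
  qed
  ultimately show ?thesis by (simp add: clinear_on_def)
qed

lemma norm_orth_decomposition:
  fixes M :: "'a::{complex_inner,complete_space} set"
  assumes M: "csubspace M" "closed M"
  shows "(norm x)\<^sup>2 = (norm (orth_proj M x))\<^sup>2 + (norm (x - orth_proj M x))\<^sup>2"
  using norm_add_sq[of "orth_proj M x" "x - orth_proj M x"]
    orth_complD(2)[OF orth_proj(2)[OF M, of x] orth_proj(1)[OF M, of x]] by simp

lemma norm_orth_proj_le:
  fixes M :: "'a::{complex_inner,complete_space} set"
  assumes M: "csubspace M" "closed M"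
  shows "norm (orth_proj M x) \<le> norm x"
  using norm_orth_decomposition[OF M, of x] by (simp add: power2_le_imp_le)

section \<open>Invertibility and boundedness of operators\<close>

text \<open>Banach's fixed point theorem for \<open>x \<mapsto> y - c W x\<close>.\<close>

lemma bij_perturbed_identity:
  fixes W :: "'a::{complex_inner,complete_space} \<Rightarrow> 'a"
  assumes W: "contraction_on UNIV W" and c: "cmod c < 1"
  shows "bij (\<lambda>x. x + c *\<^sub>C W x)"
proof -
  have lin: "clinear_on UNIV W" and le: "norm (W x) \<le> norm x" for x
    using W by (auto simp: contraction_on_def)
  have "\<exists>!x. x + c *\<^sub>C W x = y" for y
  proof -
    have "dist (y - c *\<^sub>C W x) (y - c *\<^sub>C W x') \<le> cmod c * dist x x'" for x x'
    proof -
      have "(y - c *\<^sub>C W x) - (y - c *\<^sub>C W x') = c *\<^sub>C W (x' - x)"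
        by (simp add: clinear_UNIV(3)[OF lin] scaleC.diff_right)
      then show ?thesis
        using mult_left_mono[OF le[of "x' - x"], of "cmod c"] by (simp add: dist_norm norm_minus_commute)
    qed
    then have "\<exists>!x. y - c *\<^sub>C W x = x" using c by (intro banach_fix_type) auto
    moreover have "y - c *\<^sub>C W x = x \<longleftrightarrow> x + c *\<^sub>C W x = y" for x by (auto simp: algebra_simps)
    ultimately show ?thesis by simp
  qed
  then show ?thesis by (simp add: bij_iff)
qed

text \<open>The range of \<open>T\<close> is closed. A vector \<open>q = x - w T x\<close> orthogonal to it satisfies in particular
  \<open>cinner q (T x) = 0\<close>, which is the case of equality in the Cauchy--Schwarz inequality for \<open>x\<close> and
  \<open>w T x\<close>; so these two vectors coincide and \<open>q = 0\<close>.\<close>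

lemma isometry_surjective:
  fixes T :: "'a::{complex_inner,complete_space} \<Rightarrow> 'a"
  assumes T: "isometric_on UNIV T" and w: "cmod w = 1"
    and surj: "surj (\<lambda>x. x - w *\<^sub>C T x)"
  shows "surj T"
proof -
  have lin: "clinear_on UNIV T" and nrm: "norm (T x) = norm x" for x
    using T by (auto simp: isometric_on_def)
  note ip = isometric_on_cinner[OF T csubspace_UNIV UNIV_I UNIV_I]
  note sub = csubspace_image[OF csubspace_UNIV lin]
  have clo: "closed (range T)"
    by (rule closed_image_bounded_below[OF csubspace_UNIV closed_UNIV lin, of 1 1]) (simp_all add: nrm)
  have "y \<in> range T" for y
  proof -
    define q where "q = y - orth_proj (range T) y"
    have q: "q \<in> orth_compl (range T)" using orth_proj(2)[OF sub clo] by (simp add: q_def)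
    obtain x where x: "q = x - w *\<^sub>C T x" using surjD[OF surj, of q] by auto
    have "cinner q (T x) = 0" using orth_complD(1)[OF q] by simp
    then have "cinner x (T x) = w * (norm x)\<^sup>2"
      by (simp add: x cinner_simps ip cinner_self nrm)
    then have "cinner x (w *\<^sub>C T x) = (w * cnj w) * (norm x)\<^sup>2"
      by (simp add: cinner_scaleC_right)
    then have "cinner x (w *\<^sub>C T x) = (norm x)\<^sup>2"
      unfolding complex_norm_square[symmetric] using w by simp
    then have "(norm q)\<^sup>2 = 0" using w by (simp add: x norm_diff_sq nrm)
    then show ?thesis using orth_proj(1)[OF sub clo, of y] by (simp add: q_def)
  qed
  then show ?thesis by auto
qed

text \<open>Hellinger--Toeplitz. The set where \<open>norm (X x) \<le> n\<close> is closed, because \<open>norm (X x)\<close> is a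
  supremum of the continuous functions \<open>x \<mapsto> |cinner x (Y y)|\<close> with \<open>norm y \<le> 1\<close>. By Baire's theorem one of these sets
  contains a ball, and \<open>X\<close> is bounded on it.\<close>

lemma bounded_of_adjoint:
  fixes X :: "'a::{complex_inner,complete_space} \<Rightarrow> 'b::complex_inner" and Y :: "'b \<Rightarrow> 'a"
  assumes lin: "clinear_on UNIV X" and adj: "\<And>x y. cinner (X x) y = cinner x (Y y)"
  shows "\<exists>K. \<forall>x. norm (X x) \<le> K * norm x"
proof -
  define A where "A n = {x. norm (X x) \<le> real n}" for n
  have A: "A n = (\<Inter>y. {x. cmod (cinner x (Y y)) \<le> real n * norm y})" for n
  proof -
    have "norm (X x) \<le> real n" if "\<forall>y. cmod (cinner (X x) y) \<le> real n * norm y" for x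
      by (rule norm_le_of_cinner_bound) (use that in auto)
    moreover have "cmod (cinner (X x) y) \<le> real n * norm y" if "norm (X x) \<le> real n" for x y
      using cinner_cauchy_schwarz[of "X x" y] mult_right_mono[OF that, of "norm y"] by simp
    ultimately show ?thesis unfolding A_def adj[symmetric] by auto
  qed
  have cl: "closed (A n)" for n
    unfolding A by (intro closed_INT ballI closed_Collect_le continuous_on_norm cinner.continuous_on
        continuous_on_id continuous_on_const)
  have un: "(\<Union>n. A n) = UNIV"
    using real_arch_simple by (auto simp: A_def)
  have "\<exists>n. interior (A n) \<noteq> {}"
  proof (rule ccontr)
    assume "\<not> ?thesis"
    then have "Met_TC.mtopology interior_of (\<Union>(range A)) = {}"
      using cl by (intro Met_TC.metric_Baire_category_alt)
        (auto simp: mcomplete_iff_complete complete_UNIV)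
    then show False using un by simp
  qed
  then obtain n a r where r: "r > 0" "cball a r \<subseteq> A n"
    by (metis ex_in_conv mem_interior_cball)
  have bd: "norm (X x) \<le> 2 * real n / r * norm x" for x
  proof (cases "x = 0")
    case True then show ?thesis using clinear_on_zero[OF lin] by simp
  next
    case False
    define t where "t = r / norm x"
    have t: "t > 0" "norm (complex_of_real t *\<^sub>C x) = r" using False r by (auto simp: t_def norm_divide)
    have "a \<in> A n" "a + complex_of_real t *\<^sub>C x \<in> A n" using r t by (auto simp: subset_iff dist_norm)
    then have "norm (X a) \<le> n" "norm (X a + complex_of_real t *\<^sub>C X x) \<le> n"
      by (auto simp: A_def clinear_UNIV[OF lin])
    then have "norm (complex_of_real t *\<^sub>C X x) \<le> 2 * n"
      using norm_triangle_ineq4[of "X a + complex_of_real t *\<^sub>C X x" "X a"] by simp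
    then have "t * norm (X x) \<le> 2 * n" using t(1) by simp
    then show ?thesis using False r(1) by (simp add: t_def field_simps)
  qed
  then show ?thesis by blast
qed


section \<open>Convergence in operator norm\<close>

text \<open>Convergence in the operator norm of the restrictions to \<open>S\<close>, written without suprema. It agrees with
  convergence to \<open>0\<close> of \<open>onorm_on S (F w - G)\<close> as soon as these differences are bounded
  (\<open>onorm_on_tendsto_iff\<close>).\<close>

definition op_tendsto ::
  "'a::complex_inner set \<Rightarrow> ('c \<Rightarrow> 'a \<Rightarrow> 'b::complex_inner) \<Rightarrow> ('a \<Rightarrow> 'b) \<Rightarrow> 'c filter \<Rightarrow> bool"
  where "op_tendsto S F G L \<longleftrightarrow>
    (\<forall>e>0. \<forall>\<^sub>F w in L. \<forall>x\<in>S. norm (F w x - G x) \<le> e * norm x)"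

lemma op_tendstoD:
  "op_tendsto S F G L \<Longrightarrow> e > 0 \<Longrightarrow> \<forall>\<^sub>F w in L. \<forall>x\<in>S. norm (F w x - G x) \<le> e * norm x"
  by (simp add: op_tendsto_def)

lemma op_tendsto_mono: "op_tendsto S F G L \<Longrightarrow> L' \<le> L \<Longrightarrow> op_tendsto S F G L'"
  unfolding op_tendsto_def using filter_leD by blast

lemma exists_small_multiple: "e > 0 \<Longrightarrow> \<exists>d>0. d * norm x < (e::real)"
  by (intro exI[of _ "e / (norm x + 1)"]) (auto simp: divide_less_eq add_nonneg_pos)

lemma op_tendsto_pointwise:
  assumes "op_tendsto S F G L" "x \<in> S"
  shows "((\<lambda>w. F w x) \<longlongrightarrow> G x) L"
proof (rule tendstoI)
  fix e :: real assume e: "e > 0"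
  obtain d where d: "d > 0" and "d * norm x < e" using exists_small_multiple[OF e] by blast
  with op_tendstoD[OF assms(1) d] assms(2) show "\<forall>\<^sub>F w in L. dist (F w x) (G x) < e"
    by (auto simp: dist_norm elim!: eventually_mono)
qed

lemma op_tendsto_cong:
  assumes "op_tendsto S F G L" "\<forall>\<^sub>F w in L. \<forall>x\<in>S. F w x = F' w x" "\<And>x. x \<in> S \<Longrightarrow> G x = G' x"
  shows "op_tendsto S F' G' L"
  unfolding op_tendsto_def
proof (intro allI impI)
  fix e :: real assume "e > 0"
  from op_tendstoD[OF assms(1) this] assms(2)
  show "\<forall>\<^sub>F w in L. \<forall>x\<in>S. norm (F' w x - G' x) \<le> e * norm x"
    by eventually_elim (use assms(3) in auto)
qed

lemma onorm_on_bound: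
  assumes "\<And>x. x \<in> S \<Longrightarrow> norm (f x) \<le> K * norm x" "x \<in> S"
  shows "norm (f x) \<le> onorm_on S f * norm x"
proof (cases "x = 0")
  case True then show ?thesis using assms(1)[OF assms(2)] by simp
next
  case False
  have "norm (f y) / norm y \<le> \<bar>K\<bar>" if "y \<in> S" for y
    using order_trans[OF assms(1)[OF that] mult_right_mono[OF abs_ge_self[of K], of "norm y"]]
    by (cases "y = 0") (simp_all add: divide_le_eq)
  then have "norm (f x) / norm x \<le> onorm_on S f"
    unfolding onorm_on_def using assms(2) by (intro cSUP_upper bdd_aboveI2[where M = "\<bar>K\<bar>"]) auto
  with False show ?thesis by (simp add: divide_le_eq)
qed

lemma onorm_on_le:
  assumes "\<And>x. x \<in> S \<Longrightarrow> norm (f x) \<le> K * norm x" "S \<noteq> {}" "K \<ge> 0"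
  shows "onorm_on S f \<le> K"
  unfolding onorm_on_def
proof (rule cSUP_least[OF assms(2)])
  show "norm (f x) / norm x \<le> K" if "x \<in> S" for x
    using assms(1)[OF that] assms(3) by (cases "x = 0") (simp_all add: divide_le_eq)
qed

lemma onorm_on_nonneg:
  fixes f :: "'a::complex_inner \<Rightarrow> 'b::complex_inner"
  assumes "\<And>x. x \<in> S \<Longrightarrow> norm (f x) \<le> K * norm x" "0 \<in> S"
  shows "0 \<le> onorm_on S f"
proof -
  have "norm (f y) / norm y \<le> \<bar>K\<bar>" if "y \<in> S" for y
    using order_trans[OF assms(1)[OF that] mult_right_mono[OF abs_ge_self[of K], of "norm y"]]
    by (cases "y = 0") (simp_all add: divide_le_eq)
  then have "norm (f 0) / norm (0::'a) \<le> onorm_on S f"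
    unfolding onorm_on_def using assms(2) by (intro cSUP_upper bdd_aboveI2[where M = "\<bar>K\<bar>"]) auto
  then show ?thesis by simp
qed

lemma onorm_on_tendsto_iff:
  assumes S: "0 \<in> S" and bd: "\<forall>\<^sub>F w in L. \<exists>K. \<forall>x\<in>S. norm (F w x - G x) \<le> K * norm x"
  shows "((\<lambda>w. onorm_on S (\<lambda>x. F w x - G x)) \<longlongrightarrow> 0) L \<longleftrightarrow> op_tendsto S F G L"
proof
  assume lim: "((\<lambda>w. onorm_on S (\<lambda>x. F w x - G x)) \<longlongrightarrow> 0) L"
  show "op_tendsto S F G L"
    unfolding op_tendsto_def
  proof (intro allI impI)
    fix e :: real assume "e > 0"
    then have "\<forall>\<^sub>F w in L. onorm_on S (\<lambda>x. F w x - G x) < e"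
      using order_tendstoD(2)[OF lim] by blast
    with bd show "\<forall>\<^sub>F w in L. \<forall>x\<in>S. norm (F w x - G x) \<le> e * norm x"
    proof eventually_elim
      case (elim w)
      then obtain K where "\<And>x. x \<in> S \<Longrightarrow> norm (F w x - G x) \<le> K * norm x" by blast
      from onorm_on_bound[of S "\<lambda>x. F w x - G x", OF this] elim(2) show ?case
        by (meson less_imp_le mult_right_mono norm_ge_zero order_trans)
    qed
  qed
next
  assume lim: "op_tendsto S F G L"
  show "((\<lambda>w. onorm_on S (\<lambda>x. F w x - G x)) \<longlongrightarrow> 0) L"
  proof (rule tendstoI)
    fix e :: real assume e: "e > 0"
    then have "\<forall>\<^sub>F w in L. \<forall>x\<in>S. norm (F w x - G x) \<le> e / 2 * norm x"
      using op_tendstoD[OF lim, of "e / 2"] by simp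
    then show "\<forall>\<^sub>F w in L. dist (onorm_on S (\<lambda>x. F w x - G x)) 0 < e"
    proof eventually_elim
      case (elim w)
      then have "onorm_on S (\<lambda>x. F w x - G x) \<le> e / 2"
        using S e by (intro onorm_on_le) auto
      moreover have "0 \<le> onorm_on S (\<lambda>x. F w x - G x)"
        using S elim by (intro onorm_on_nonneg[where K = "e / 2"]) auto
      ultimately show ?case using e by simp
    qed
  qed
qed

lemma bounded_clinear_on_bound:
  "bounded_clinear_on S f \<Longrightarrow> \<exists>K. \<forall>x\<in>S. norm (f x) \<le> K * norm x"
  by (simp add: bounded_clinear_on_def)

lemma bounded_on_diff:
  assumes "\<exists>K. \<forall>x\<in>S. norm (f x) \<le> K * norm x" "\<exists>K. \<forall>x\<in>S. norm (g x) \<le> K * norm x"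
  shows "\<exists>K. \<forall>x\<in>S. norm (f x - g x) \<le> K * norm x"
proof -
  obtain K M where K: "\<And>x. x \<in> S \<Longrightarrow> norm (f x) \<le> K * norm x"
      and M: "\<And>x. x \<in> S \<Longrightarrow> norm (g x) \<le> M * norm x"
    using assms by blast
  have "norm (f x - g x) \<le> (K + M) * norm x" if "x \<in> S" for x
    using norm_triangle_ineq4[of "f x" "g x"] K[OF that] M[OF that] by (simp add: distrib_right)
  then show ?thesis by blast
qed

lemma bounded_on_scaleC:
  fixes f :: "'a::real_normed_vector \<Rightarrow> 'b::complex_inner"
  assumes "\<exists>K. \<forall>x\<in>S. norm (f x) \<le> K * norm x"
  shows "\<exists>K. \<forall>x\<in>S. norm (c *\<^sub>C f x) \<le> K * norm x"
proof -
  obtain K where K: "\<And>x. x \<in> S \<Longrightarrow> norm (f x) \<le> K * norm x" using assms by blast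
  have "norm (c *\<^sub>C f x) \<le> (cmod c * K) * norm x" if "x \<in> S" for x
    using mult_left_mono[OF K[OF that], of "cmod c"] by (simp add: mult.assoc)
  then show ?thesis by blast
qed

lemma eventually_mem_at_within: "\<forall>\<^sub>F w in at z within A. w \<in> A"
  by (simp add: eventually_at_filter)

lemma op_continuous_on_iff:
  assumes "0 \<in> S"
  shows "op_continuous_on S A F \<longleftrightarrow>
    (\<forall>z\<in>A. bounded_clinear_on S (F z)) \<and> (\<forall>z\<in>A. op_tendsto S F (F z) (at z within A))"
proof -
  have "((\<lambda>w. onorm_on S (\<lambda>x. F w x - F z x)) \<longlongrightarrow> 0) (at z within A) \<longleftrightarrow>
      op_tendsto S F (F z) (at z within A)"
    if "\<forall>z\<in>A. bounded_clinear_on S (F z)" "z \<in> A" for z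
    by (intro onorm_on_tendsto_iff[OF assms] eventually_mono[OF eventually_mem_at_within]
        bounded_on_diff bounded_clinear_on_bound) (use that in auto)
  then show ?thesis unfolding op_continuous_on_def by blast
qed

lemma op_analytic_on_iff:
  assumes "0 \<in> S"
  shows "op_analytic_on S A F \<longleftrightarrow>
    (\<forall>z\<in>A. bounded_clinear_on S (F z)) \<and>
    (\<forall>z\<in>A. \<exists>F'. bounded_clinear_on S F' \<and>
      op_tendsto S (\<lambda>w x. inverse (w - z) *\<^sub>C (F w x - F z x)) F' (at z within A))"
proof -
  have "((\<lambda>w. onorm_on S (\<lambda>x. inverse (w - z) *\<^sub>C (F w x - F z x) - F' x)) \<longlongrightarrow> 0) (at z within A) \<longleftrightarrow>
      op_tendsto S (\<lambda>w x. inverse (w - z) *\<^sub>C (F w x - F z x)) F' (at z within A)"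
    if "\<forall>z\<in>A. bounded_clinear_on S (F z)" "z \<in> A" "bounded_clinear_on S F'" for z F'
    by (intro onorm_on_tendsto_iff[OF assms] eventually_mono[OF eventually_mem_at_within]
        bounded_on_diff bounded_on_scaleC bounded_clinear_on_bound) (use that in auto)
  then have "(\<exists>F'. bounded_clinear_on S F' \<and>
        ((\<lambda>w. onorm_on S (\<lambda>x. inverse (w - z) *\<^sub>C (F w x - F z x) - F' x)) \<longlongrightarrow> 0) (at z within A)) \<longleftrightarrow>
      (\<exists>F'. bounded_clinear_on S F' \<and>
        op_tendsto S (\<lambda>w x. inverse (w - z) *\<^sub>C (F w x - F z x)) F' (at z within A))"
    if "\<forall>z\<in>A. bounded_clinear_on S (F z)" "z \<in> A" for z
    using that by (intro ex_cong1 conj_cong refl) blast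
  then show ?thesis
    unfolding op_analytic_on_def by (intro conj_cong ball_cong refl) blast
qed

lemma op_analytic_tendsto:
  assumes S: "0 \<in> S" and F: "op_analytic_on S A F" and z: "z \<in> A"
  shows "op_tendsto S F (F z) (at z within A)"
  unfolding op_tendsto_def
proof (intro allI impI)
  fix e :: real assume e: "e > 0"
  obtain F' where F': "bounded_clinear_on S F'"
      and lim: "op_tendsto S (\<lambda>w x. inverse (w - z) *\<^sub>C (F w x - F z x)) F' (at z within A)"
    using F z unfolding op_analytic_on_iff[OF S] by blast
  obtain K where K: "\<And>x. x \<in> S \<Longrightarrow> norm (F' x) \<le> K * norm x"
    using bounded_clinear_on_bound[OF F'] by blast
  have "((\<lambda>w. norm (w - z) * (\<bar>K\<bar> + 1)) \<longlongrightarrow> norm (z - z) * (\<bar>K\<bar> + 1)) (at z within A)"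
    by (intro tendsto_intros)
  then have "\<forall>\<^sub>F w in at z within A. norm (w - z) * (\<bar>K\<bar> + 1) < e"
    using e by (intro order_tendstoD(2)) auto
  moreover have "\<forall>\<^sub>F w in at z within A. w \<noteq> z" by (simp add: eventually_at_filter)
  ultimately show "\<forall>\<^sub>F w in at z within A. \<forall>x\<in>S. norm (F w x - F z x) \<le> e * norm x"
    using op_tendstoD[OF lim zero_less_one]
  proof eventually_elim
    case (elim w)
    show ?case
    proof
      fix x assume x: "x \<in> S"
      have "norm (inverse (w - z) *\<^sub>C (F w x - F z x)) \<le> norm (F' x) + 1 * norm x"
        using bspec[OF elim(3) x] norm_triangle_sub[of "inverse (w - z) *\<^sub>C (F w x - F z x)" "F' x"]
        by linarith
      also have "\<dots> \<le> (\<bar>K\<bar> + 1) * norm x"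
        using K[OF x] mult_right_mono[OF abs_ge_self[of K], of "norm x"] by (simp add: distrib_right)
      finally have "norm (F w x - F z x) \<le> norm (w - z) * ((\<bar>K\<bar> + 1) * norm x)"
        using elim(2) mult_left_mono[of _ _ "norm (w - z)"] by (simp add: norm_inverse pos_divide_le_eq
            divide_inverse_commute[symmetric] mult.commute del: scaleC.diff_right)
      also have "\<dots> \<le> e * norm x"
        using mult_right_mono[OF less_imp_le[OF elim(1)], of "norm x"] by (simp add: mult.assoc)
      finally show "norm (F w x - F z x) \<le> e * norm x" .
    qed
  qed
qed

text \<open>Completeness of the space of operators: pointwise limits exist, and the uniform Cauchy estimate passes
  to them.\<close>

lemma op_tendsto_of_cauchy:
  fixes F :: "'c \<Rightarrow> 'a::complex_inner \<Rightarrow> 'b::{complex_inner,complete_space}"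
  assumes S: "csubspace S" and L: "L \<noteq> bot"
    and lin: "\<forall>\<^sub>F w in L. clinear_on S (F w)"
    and cauchy: "\<And>e. e > 0 \<Longrightarrow> \<exists>P. eventually P L \<and>
      (\<forall>v w. P v \<and> P w \<longrightarrow> (\<forall>x\<in>S. norm (F v x - F w x) \<le> e * norm x))"
  shows "\<exists>G. clinear_on S G \<and> op_tendsto S F G L"
proof -
  have "\<exists>l. ((\<lambda>w. F w x) \<longlongrightarrow> l) L" if x: "x \<in> S" for x
  proof -
    have "cauchy_filter (filtermap (\<lambda>w. F w x) L)"
      unfolding cauchy_filter_metric_filtermap
    proof (intro allI impI)
      fix e :: real assume e: "e > 0"
      obtain d where d: "d > 0" and de: "d * norm x < e" using exists_small_multiple[OF e] by blast
      from cauchy[OF d] obtain P where "eventually P L"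
          "\<And>v w. P v \<Longrightarrow> P w \<Longrightarrow> norm (F v x - F w x) \<le> d * norm x"
        using x by blast
      then show "\<exists>P. eventually P L \<and> (\<forall>v w. P v \<and> P w \<longrightarrow> dist (F v x) (F w x) < e)"
        using de by (intro exI[of _ P]) (auto simp: dist_norm intro: le_less_trans)
    qed
    then show ?thesis
      using complete_uniform[of "UNIV :: 'b set"] complete_UNIV L
      by (force simp: filterlim_def filtermap_bot_iff)
  qed
  then obtain G where G: "\<And>x. x \<in> S \<Longrightarrow> ((\<lambda>w. F w x) \<longlongrightarrow> G x) L" by metis
  have "G (x + y) = G x + G y" if "x \<in> S" "y \<in> S" for x y
  proof (rule tendsto_unique[OF L])
    show "((\<lambda>w. F w (x + y)) \<longlongrightarrow> G (x + y)) L" using G csubspaceD(2)[OF S that] by simp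
    show "((\<lambda>w. F w (x + y)) \<longlongrightarrow> G x + G y) L"
      by (rule Lim_transform_eventually[OF tendsto_add[OF G[OF that(1)] G[OF that(2)]]])
        (use lin in eventually_elim, simp add: clinear_onD(1)[OF _ S that])
  qed
  moreover have "G (c *\<^sub>C x) = c *\<^sub>C G x" if "x \<in> S" for c x
  proof (rule tendsto_unique[OF L])
    show "((\<lambda>w. F w (c *\<^sub>C x)) \<longlongrightarrow> G (c *\<^sub>C x)) L" using G csubspaceD(3)[OF S that] by simp
    show "((\<lambda>w. F w (c *\<^sub>C x)) \<longlongrightarrow> c *\<^sub>C G x) L"
      by (rule Lim_transform_eventually[OF scaleC.tendsto[OF tendsto_const G[OF that]]])
        (use lin in eventually_elim, simp add: clinear_onD(2)[OF _ S that])
  qed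
  moreover have "op_tendsto S F G L"
    unfolding op_tendsto_def
  proof (intro allI impI)
    fix e :: real assume "e > 0"
    from cauchy[OF this] obtain P where P: "eventually P L"
        "\<And>v w x. P v \<Longrightarrow> P w \<Longrightarrow> x \<in> S \<Longrightarrow> norm (F v x - F w x) \<le> e * norm x" by blast
    from P(1) show "\<forall>\<^sub>F w in L. \<forall>x\<in>S. norm (F w x - G x) \<le> e * norm x"
    proof eventually_elim
      case (elim v)
      show ?case
      proof
        fix x assume x: "x \<in> S"
        show "norm (F v x - G x) \<le> e * norm x"
        proof (rule tendsto_upperbound[OF _ _ L])
          show "((\<lambda>w. norm (F v x - F w x)) \<longlongrightarrow> norm (F v x - G x)) L"
            by (intro tendsto_intros G x)
          show "\<forall>\<^sub>F w in L. norm (F v x - F w x) \<le> e * norm x"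
            using P(1) by eventually_elim (use P(2)[OF elim] x in auto)
        qed
      qed
    qed
  qed
  ultimately show ?thesis unfolding clinear_on_def by blast
qed

text \<open>Joint continuity of evaluation, at a bounded limit operator.\<close>

lemma op_tendsto_apply:
  assumes F: "op_tendsto UNIV F G L" and G: "clinear_on UNIV G" "\<And>x. norm (G x) \<le> K * norm x"
    and y: "(y \<longlongrightarrow> y0) L"
  shows "((\<lambda>w. F w (y w)) \<longlongrightarrow> G y0) L"
proof -
  have "((\<lambda>w. F w (y w) - G (y w)) \<longlongrightarrow> 0) L"
  proof (rule tendstoI)
    fix e :: real assume e: "e > 0"
    define d where "d = e / (norm y0 + 2)"
    have pos: "norm y0 + 2 > 0" using norm_ge_zero[of y0] by linarith
    then have d: "d > 0" using e by (simp add: d_def)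
    have "\<forall>\<^sub>F w in L. norm (y w) < norm y0 + 1"
      using order_tendstoD(2)[OF tendsto_norm[OF y], of "norm y0 + 1"] by simp
    with op_tendstoD[OF F d] show "\<forall>\<^sub>F w in L. dist (F w (y w) - G (y w)) 0 < e"
    proof eventually_elim
      case (elim w)
      have "norm (F w (y w) - G (y w)) \<le> d * norm (y w)" using elim(1) by blast
      also have "\<dots> < d * (norm y0 + 2)" using elim(2) d by (intro mult_strict_left_mono) auto
      also have "\<dots> = e" using pos by (simp add: d_def)
      finally show ?case by simp
    qed
  qed
  moreover have "((\<lambda>w. G (y w) - G y0) \<longlongrightarrow> 0) L"
  proof (rule Lim_null_comparison)
    show "\<forall>\<^sub>F w in L. norm (G (y w) - G y0) \<le> K * norm (y w - y0)"
      using G(2) by (simp add: clinear_UNIV(3)[OF G(1), symmetric])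
    have "((\<lambda>w. norm (y w - y0)) \<longlongrightarrow> 0) L" using y by (simp add: LIM_zero_iff tendsto_norm_zero_iff)
    then show "((\<lambda>w. K * norm (y w - y0)) \<longlongrightarrow> 0) L" by (rule tendsto_mult_right_zero)
  qed
  ultimately have "((\<lambda>w. (F w (y w) - G (y w)) + (G (y w) - G y0)) \<longlongrightarrow> 0 + 0) L" by (rule tendsto_add)
  then show ?thesis by (simp add: LIM_zero_iff)
qed

lemma op_tendsto_at_union:
  "op_tendsto S F G (at z within A) \<Longrightarrow> op_tendsto S F G (at z within B) \<Longrightarrow>
    op_tendsto S F G (at z within (A \<union> B))"
  by (simp add: op_tendsto_def at_within_union eventually_sup)

section \<open>From weak to norm analyticity\<close>

text \<open>Taylor's formula, with the second derivative bounded by Cauchy's inequality on discs of radius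
  \<open>r / 4\<close>: \<open>2 B / (r / 4)\<^sup>2 = 32 B / r\<^sup>2\<close>. The point of the explicit constant is that it is linear
  in \<open>B\<close>.\<close>

lemma second_order_remainder_bound:
  assumes hol: "f holomorphic_on ball w r" and r: "r > 0"
    and B: "\<And>z. z \<in> ball w r \<Longrightarrow> cmod (f z) \<le> B" and z: "z \<in> ball w (r / 2)"
  shows "cmod (f z - f w - deriv f w * (z - w)) \<le> 32 * B / r\<^sup>2 * (cmod (z - w))\<^sup>2"
proof -
  have der: "((deriv ^^ i) f has_field_derivative (deriv ^^ Suc i) f x) (at x within ball w (r / 2))"
    if "x \<in> ball w (r / 2)" for i x
    using holomorphic_derivI[OF holomorphic_higher_deriv[OF hol open_ball] open_ball, of x i] that r
    by (auto intro: has_field_derivative_at_within)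
  have bound: "cmod ((deriv ^^ Suc 1) f x) \<le> 32 * B / r\<^sup>2" if x: "x \<in> ball w (r / 2)" for x
  proof -
    have sub: "cball x (r / 4) \<subseteq> ball w r"
    proof
      fix y assume "y \<in> cball x (r / 4)"
      then show "y \<in> ball w r"
        using dist_triangle[of w y x] x r by (simp add: dist_commute)
    qed
    have "cmod ((deriv ^^ 2) f x) \<le> fact 2 * B / (r / 4) ^ 2"
    proof (rule Cauchy_inequality)
      show "f holomorphic_on ball x (r / 4)"
        using hol by (rule holomorphic_on_subset) (use sub ball_subset_cball in blast)
      show "continuous_on (cball x (r / 4)) f"
        using holomorphic_on_imp_continuous_on[OF hol] sub by (rule continuous_on_subset)
      show "cmod (f y) \<le> B" if "cmod (x - y) = r / 4" for y
        using B sub that by (auto simp: dist_norm subset_iff)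
    qed (use r in simp)
    then show ?thesis by (simp add: numeral_2_eq_2 power_divide)
  qed
  have "cmod ((deriv ^^ 0) f z - (\<Sum>i\<le>1. (deriv ^^ i) f w * (z - w) ^ i / fact i))
      \<le> 32 * B / r\<^sup>2 * cmod (z - w) ^ Suc 1 / fact 1"
    using r z by (intro complex_Taylor[where S = "ball w (r / 2)"] der bound) auto
  then show ?thesis by (simp add: diff_diff_eq power2_eq_square)
qed

text \<open>Near \<open>z\<close> the function \<open>cinner (F w x) y\<close> is bounded by \<open>K (norm x) (norm y)\<close>, so its difference
  quotient differs from its derivative by at most a multiple of \<open>|w - z| (norm x) (norm y)\<close>, where
  the factor does not depend on \<open>x\<close> and \<open>y\<close>. Therefore the difference quotients of \<open>F\<close> itself are
  Cauchy in operator norm. Their limit is the derivative.\<close>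

lemma op_analytic_of_weakly_holomorphic:
  fixes F :: "complex \<Rightarrow> 'a::{complex_inner,complete_space} \<Rightarrow> 'a"
  assumes A: "open A"
    and lin: "\<And>z. z \<in> A \<Longrightarrow> clinear_on UNIV (F z)"
    and hol: "\<And>x y. (\<lambda>z. cinner (F z x) y) holomorphic_on A"
    and bdd: "\<And>z. z \<in> A \<Longrightarrow> \<exists>K. \<forall>\<^sub>F w in at z. \<forall>x. norm (F w x) \<le> K * norm x"
    and bdd0: "\<And>z. z \<in> A \<Longrightarrow> \<exists>K. \<forall>x. norm (F z x) \<le> K * norm x"
  shows "op_analytic_on UNIV A F"
  unfolding op_analytic_on_iff[OF UNIV_I]
proof (intro conjI ballI)
  show bcl: "bounded_clinear_on UNIV (F z)" if "z \<in> A" for z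
    using lin[OF that] bdd0[OF that] by (simp add: bounded_clinear_on_def)
  fix z assume z: "z \<in> A"
  define Q where "Q w x = inverse (w - z) *\<^sub>C (F w x - F z x)" for w x
  obtain K1 where "\<forall>\<^sub>F w in at z. \<forall>x. norm (F w x) \<le> K1 * norm x" using bdd[OF z] by blast
  moreover have "\<forall>\<^sub>F w in at z. w \<in> A" using A z by (simp add: eventually_at_in_open')
  ultimately have "\<forall>\<^sub>F w in at z. w \<in> A \<and> (\<forall>x. norm (F w x) \<le> K1 * norm x)"
    by eventually_elim simp
  then obtain r where r: "r > 0"
      and rb: "\<And>w. w \<noteq> z \<Longrightarrow> dist w z < r \<Longrightarrow> w \<in> A \<and> (\<forall>x. norm (F w x) \<le> K1 * norm x)"
    by (auto simp: eventually_at)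
  obtain K2 where K2: "\<And>x. norm (F z x) \<le> K2 * norm x" using bdd0[OF z] by blast
  define K where "K = max 0 (max K1 K2)"
  have ball: "w \<in> A" "norm (F w x) \<le> K * norm x" if "w \<in> ball z r" for w x
  proof -
    show "w \<in> A" using rb[of w] z that by (cases "w = z") (auto simp: dist_commute)
    have "norm (F w x) \<le> max K1 K2 * norm x"
      using rb[of w] K2[of x] that mult_right_mono[of K1 "max K1 K2" "norm x"]
        mult_right_mono[of K2 "max K1 K2" "norm x"]
      by (cases "w = z") (auto simp: dist_commute intro: order_trans)
    also have "\<dots> \<le> K * norm x" by (intro mult_right_mono) (auto simp: K_def)
    finally show "norm (F w x) \<le> K * norm x" .
  qed
  define M where "M = 32 * K / r\<^sup>2"
  have M: "M \<ge> 0" by (simp add: M_def K_def)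
  have rem: "cmod (cinner (Q w x) y - deriv (\<lambda>w. cinner (F w x) y) z) \<le> M * cmod (w - z) * norm x * norm y"
    if w: "w \<in> ball z (r / 2)" "w \<noteq> z" for w x y
  proof -
    let ?f = "\<lambda>w. cinner (F w x) y"
    have "cmod (?f w) \<le> K * norm x * norm y" if "w \<in> ball z r" for w
      using cinner_cauchy_schwarz[of "F w x" y] mult_right_mono[OF ball(2)[OF that, of x], of "norm y"]
      by simp
    then have "cmod (?f w - ?f z - deriv ?f z * (w - z)) \<le> 32 * (K * norm x * norm y) / r\<^sup>2 * (cmod (w - z))\<^sup>2"
      using hol[of x y] ball(1) w(1) r
      by (intro second_order_remainder_bound holomorphic_on_subset[of ?f A "ball z r"]) auto
    also have "\<dots> = cmod (w - z) * (M * cmod (w - z) * norm x * norm y)"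
      by (simp add: M_def power2_eq_square)
    also have "?f w - ?f z - deriv ?f z * (w - z) = (w - z) * (cinner (Q w x) y - deriv ?f z)"
    proof -
      have "(w - z) * cinner (Q w x) y = ?f w - ?f z"
        using w(2) by (simp only: Q_def cinner_scaleC_left cinner.diff_left) (simp add: mult.assoc[symmetric])
      then show ?thesis by (simp add: right_diff_distrib mult.commute)
    qed
    finally show ?thesis using w(2) by (simp add: norm_mult)
  qed
  have diff: "norm (Q v x - Q w x) \<le> M * (cmod (v - z) + cmod (w - z)) * norm x"
    if "v \<in> ball z (r / 2)" "v \<noteq> z" "w \<in> ball z (r / 2)" "w \<noteq> z" for v w x
  proof (rule norm_le_of_cinner_bound)
    fix y
    have "cmod (cinner (Q v x - Q w x) y) \<le> M * cmod (v - z) * norm x * norm y + M * cmod (w - z) * norm x * norm y"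
      using norm_triangle_ineq4[of "cinner (Q v x) y - deriv (\<lambda>w. cinner (F w x) y) z"
          "cinner (Q w x) y - deriv (\<lambda>w. cinner (F w x) y) z"] rem[OF that(1,2), of x y] rem[OF that(3,4), of x y]
      by (simp add: cinner.diff_left)
    then show "cmod (cinner (Q v x - Q w x) y) \<le> M * (cmod (v - z) + cmod (w - z)) * norm x * norm y"
      by (simp add: algebra_simps)
  qed (use M in simp)
  let ?L = "at z within A"
  have L: "?L \<noteq> bot" "?L = at z" using at_within_open[OF z A] by simp_all
  have linQ: "\<forall>\<^sub>F w in ?L. clinear_on UNIV (Q w)"
    using eventually_mem_at_within
  proof eventually_elim
    case (elim w)
    show ?case
      by (simp add: clinear_on_def Q_def clinear_UNIV[OF lin[OF elim]] clinear_UNIV[OF lin[OF z]]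
          scaleC.diff_right scaleC.add_right scaleC_scaleC mult.commute)
  qed
  have "\<exists>F'. clinear_on UNIV F' \<and> op_tendsto UNIV Q F' ?L"
  proof (rule op_tendsto_of_cauchy[OF csubspace_UNIV L(1) linQ])
    fix e :: real assume e: "e > 0"
    define d where "d = min (r / 2) (e / (2 * (M + 1)))"
    have d: "d > 0" using e r M by (simp add: d_def)
    have "norm (Q v x - Q w x) \<le> e * norm x"
      if "v \<noteq> z" "dist v z < d" "w \<noteq> z" "dist w z < d" for v w x
    proof -
      have vw: "v \<in> ball z (r / 2)" "w \<in> ball z (r / 2)" using that by (auto simp: d_def dist_commute)
      have "cmod (v - z) + cmod (w - z) \<le> 2 * (e / (2 * (M + 1)))"
        using that by (auto simp: d_def dist_norm)
      then have "M * (cmod (v - z) + cmod (w - z)) \<le> M * (2 * (e / (2 * (M + 1))))"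
        using M by (intro mult_left_mono)
      also have "\<dots> \<le> e" using M e by (simp add: field_simps)
      finally show ?thesis
        using diff[OF vw(1) that(1) vw(2) that(3), of x] mult_right_mono[of _ e "norm x"]
        by (meson norm_ge_zero order_trans)
    qed
    then show "\<exists>P. eventually P ?L \<and> (\<forall>v w. P v \<and> P w \<longrightarrow> (\<forall>x\<in>UNIV. norm (Q v x - Q w x) \<le> e * norm x))"
      using d by (intro exI[of _ "\<lambda>w. w \<noteq> z \<and> dist w z < d"]) (auto simp: L(2) eventually_at)
  qed
  then obtain F' where F': "clinear_on UNIV F'" "op_tendsto UNIV Q F' ?L" by blast
  have "\<exists>K. \<forall>x. norm (F' x) \<le> K * norm x"
  proof -
    obtain w where w: "w \<in> A" "\<And>x. norm (Q w x - F' x) \<le> 1 * norm x"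
      using eventually_happens'[OF L(1) eventually_conj[OF eventually_mem_at_within op_tendstoD[OF F'(2) zero_less_one]]]
      by auto
    have "\<exists>K. \<forall>x\<in>UNIV. norm (Q w x) \<le> K * norm x"
      unfolding Q_def by (intro bounded_on_scaleC bounded_on_diff bounded_clinear_on_bound bcl w(1) z)
    moreover have "\<exists>K. \<forall>x\<in>UNIV. norm (Q w x - F' x) \<le> K * norm x" using w(2) by blast
    ultimately have "\<exists>K. \<forall>x\<in>UNIV. norm (Q w x - (Q w x - F' x)) \<le> K * norm x"
      by (rule bounded_on_diff)
    then show ?thesis by simp
  qed
  with F'(1) have "bounded_clinear_on UNIV F'" by (simp add: bounded_clinear_on_def)
  with F'(2) show "\<exists>F'. bounded_clinear_on UNIV F' \<and>
      op_tendsto UNIV (\<lambda>w x. inverse (w - z) *\<^sub>C (F w x - F z x)) F' (at z within A)"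
    unfolding Q_def[abs_def] by blast
qed

section \<open>Holomorphic continuation across an arc\<close>

text \<open>The map \<open>z \<mapsto> exp (\<i> z)\<close> carries the real line to the unit circle and is locally invertible, so the
  claim reduces to the corresponding statement for the real line.\<close>

lemma holomorphic_on_across_circle:
  assumes A: "open A" and cont: "continuous_on A f" and hol: "f holomorphic_on (A - sphere 0 1)"
  shows "f holomorphic_on A"
proof -
  define S where "S = (\<lambda>z. exp (\<i> * z)) -` A"
  define g where "g = f \<circ> (\<lambda>z. exp (\<i> * z))"
  have S: "open S" unfolding S_def by (intro open_vimage A continuous_intros)
  have nrm: "cmod (exp (\<i> * z)) = 1 \<longleftrightarrow> Im z = 0" for z by simp
  have g: "g holomorphic_on (S \<inter> {z. Im z \<noteq> 0})"
    unfolding g_def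
    by (rule holomorphic_on_compose_gen[OF _ hol]) (auto intro!: holomorphic_intros simp: S_def)
  have "g holomorphic_on S"
  proof (rule holomorphic_on_paste_across_line[of S \<i> g 0])
    show "g holomorphic_on (S \<inter> {z. \<i> \<bullet> z < 0})" "g holomorphic_on (S \<inter> {z. 0 < \<i> \<bullet> z})"
      by (auto intro: holomorphic_on_subset[OF g] simp: inner_complex_def)
    show "continuous_on S g"
      unfolding g_def
      by (intro continuous_on_compose continuous_intros continuous_on_subset[OF cont]) (auto simp: S_def)
  qed (use S in auto)
  have "f field_differentiable (at w)" if w: "w \<in> A" for w
  proof (cases "w \<in> sphere 0 1")
    case False
    have "open (A - sphere 0 1)" using A by (intro open_Diff closed_sphere)
    with hol False w show ?thesis by (auto intro: holomorphic_on_imp_differentiable_at)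
  next
    case True
    then have w1: "cmod w = 1" and w0: "w \<noteq> 0" by auto
    \<comment> \<open>A local inverse of \<open>z \<mapsto> exp (\<i> z)\<close> near \<open>w\<close>; dividing by \<open>w\<close> avoids the branch cut of \<open>Ln\<close>.\<close>
    define h where "h z = - \<i> * Ln w - \<i> * Ln (z / w)" for z
    define N where "N = ball w 1 \<inter> A"
    have N: "z / w \<notin> \<real>\<^sub>\<le>\<^sub>0" if "z \<in> N" for z
    proof
      assume "z / w \<in> \<real>\<^sub>\<le>\<^sub>0"
      then obtain t where t: "t \<le> 0" "z / w = of_real t" by (auto elim!: nonpos_Reals_cases)
      then have "z = of_real t * w" using w0 by (simp add: field_simps)
      then have "w - z = of_real (1 - t) * w" by (simp add: algebra_simps)
      then have "cmod (w - z) = 1 - t" using w1 t(1) by (simp add: norm_mult del: of_real_diff)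
      then show False using that t(1) by (simp add: N_def dist_norm)
    qed
    have z0: "z \<noteq> 0" if "z \<in> N" for z using N[OF that] by auto
    have eh: "exp (\<i> * h z) = z" if "z \<in> N" for z
    proof -
      have "\<i> * h z = Ln w + Ln (z / w)" by (simp add: h_def algebra_simps)
      then show ?thesis using w0 z0[OF that] by (simp add: exp_add)
    qed
    have "(g \<circ> h) holomorphic_on N"
    proof (rule holomorphic_on_compose_gen[OF _ \<open>g holomorphic_on S\<close>])
      show "h holomorphic_on N" unfolding h_def by (intro holomorphic_intros) (use N w0 in auto)
      show "h ` N \<subseteq> S" using eh by (auto simp: S_def N_def)
    qed
    then have "f holomorphic_on N"
      by (rule holomorphic_transform) (simp add: g_def eh)
    moreover have "open N" "w \<in> N" using A w by (auto simp: N_def)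
    ultimately show ?thesis by (auto intro: holomorphic_on_imp_differentiable_at)
  qed
  then show ?thesis by (simp add: holomorphic_on_def field_differentiable_at_within)
qed

lemma open_arc_subset_circle: "open_arc \<Delta> \<Longrightarrow> \<Delta> \<subseteq> sphere 0 1"
  by (auto simp: open_arc_def)

text \<open>The complement is the closed arc \<open>cis ` {b..a + 2\<pi>}\<close>, which is compact.\<close>

lemma open_arc_domain:
  assumes "open_arc \<Delta>"
  shows "open (disc \<union> ext_disc \<union> \<Delta>)"
proof -
  obtain a b where ab: "a < b" "b \<le> a + 2 * pi" and \<Delta>: "\<Delta> = cis ` {a<..<b}"
    using assms by (auto simp: open_arc_def)
  have "disc \<union> ext_disc \<union> \<Delta> = - (cis ` {b..a + 2 * pi})"
  proof (intro set_eqI iffI)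
    fix z assume z: "z \<in> disc \<union> ext_disc \<union> \<Delta>"
    show "z \<in> - (cis ` {b..a + 2 * pi})"
    proof
      assume "z \<in> cis ` {b..a + 2 * pi}"
      then obtain t where t: "b \<le> t" "t \<le> a + 2 * pi" "z = cis t" by auto
      then obtain s where s: "a < s" "s < b" "cis s = cis t" using z by (auto simp: \<Delta>)
      have "exp (\<i> * of_real (t - s)) = cis t / cis s" by (simp only: cis_conv_exp[symmetric] cis_divide)
      then have "exp (\<i> * of_real (t - s)) = 1" using s(3) by simp
      moreover have "0 < t - s" "t - s < 2 * pi" using s t ab by auto
      ultimately show False using exp_i_ne_1 by blast
    qed
  next
    fix z assume z: "z \<in> - (cis ` {b..a + 2 * pi})"
    show "z \<in> disc \<union> ext_disc \<union> \<Delta>"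
    proof (cases "cmod z = 1")
      case True
      define t where "t = Arg2pi (z * cis (- a))"
      have t: "0 \<le> t" "t < 2 * pi" using Arg2pi[of "z * cis (- a)"] by (auto simp: t_def)
      have "cis t = z * cis (- a)"
        using complex_norm_eq_1_exp[of "z * cis (- a)"] True by (simp add: t_def cis_conv_exp norm_mult)
      then have "cis t * cis a = z" by (simp add: mult.assoc cis_mult)
      then have zt: "z = cis (a + t)" by (simp add: cis_mult add.commute)
      \<comment> \<open>The endpoint \<open>cis a = cis (a + 2\<pi>)\<close> belongs to the complementary arc.\<close>
      have "t \<noteq> 0"
      proof
        assume "t = 0"
        then have "z = cis (a + 2 * pi)" using zt by (simp add: cis_mult[symmetric])
        then show False using z ab by auto
      qed
      moreover have "a + t < b"
      proof (rule ccontr)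
        assume "\<not> ?thesis"
        then have "a + t \<in> {b..a + 2 * pi}" using t by simp
        then show False using z zt by blast
      qed
      ultimately show ?thesis using t zt by (auto simp: \<Delta>)
    qed (auto simp: not_less_iff_gr_or_eq)
  qed
  moreover have "compact (cis ` {b..a + 2 * pi})"
    by (intro compact_continuous_image continuous_intros compact_Icc)
  ultimately show ?thesis by (simp add: compact_imp_closed open_Compl)
qed

section \<open>Resolvents of unitary operators and their compressions\<close>

text \<open>The variable \<open>\<zeta>\<close> is the inverse of the usual spectral parameter.\<close>

definition resolvent :: "('b::complex_vector \<Rightarrow> 'b) \<Rightarrow> complex \<Rightarrow> 'b \<Rightarrow> 'b"
  where "resolvent U \<zeta> = inv (\<lambda>x. x - \<zeta> *\<^sub>C U x)"

context
  fixes U :: "'b::{complex_inner,complete_space} \<Rightarrow> 'b"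
  assumes U: "unitary U"
begin

lemma unitary_linear: "clinear_on UNIV U" and unitary_norm: "norm (U x) = norm x"
  and unitary_surj: "surj U"
  using U by (auto simp: unitary_def isometric_on_def)

lemma unitary_cinner: "cinner (U x) (U y) = cinner x y"
  using U isometric_on_cinner[OF _ csubspace_UNIV UNIV_I UNIV_I] by (auto simp: unitary_def)

lemma unitary_pencil_lower_bound: "\<bar>1 - cmod \<zeta>\<bar> * norm x \<le> norm (x - \<zeta> *\<^sub>C U x)"
proof -
  have "\<bar>norm x - norm (\<zeta> *\<^sub>C U x)\<bar> \<le> norm (x - \<zeta> *\<^sub>C U x)" by (rule norm_triangle_ineq3)
  moreover have "\<bar>norm x - norm (\<zeta> *\<^sub>C U x)\<bar> = \<bar>(1 - cmod \<zeta>) * norm x\<bar>"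
    by (simp add: unitary_norm left_diff_distrib)
  ultimately show ?thesis by (simp add: abs_mult)
qed

text \<open>For \<open>|\<zeta>| > 1\<close> the equation \<open>x - \<zeta> U x = y\<close> is rewritten with \<open>U\<^sup>-\<^sup>1\<close>, as
  \<open>x - \<zeta>\<^sup>-\<^sup>1 U\<^sup>-\<^sup>1 x = - \<zeta>\<^sup>-\<^sup>1 U\<^sup>-\<^sup>1 y\<close>, and \<open>\<zeta>\<^sup>-\<^sup>1 U\<^sup>-\<^sup>1\<close> is a strict contraction.\<close>

lemma unitary_pencil_bij:
  assumes "cmod \<zeta> \<noteq> 1" shows "bij (\<lambda>x. x - \<zeta> *\<^sub>C U x)"
proof (rule bijI)
  show "inj (\<lambda>x. x - \<zeta> *\<^sub>C U x)"
  proof (rule injI)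
    fix x y assume "x - \<zeta> *\<^sub>C U x = y - \<zeta> *\<^sub>C U y"
    then have "(x - y) - \<zeta> *\<^sub>C U (x - y) = 0"
      by (simp add: clinear_UNIV(3)[OF unitary_linear] algebra_simps)
    then have "\<bar>1 - cmod \<zeta>\<bar> * norm (x - y) \<le> 0"
      using unitary_pencil_lower_bound[of \<zeta> "x - y"] by simp
    then show "x = y" using assms by (simp add: mult_le_0_iff)
  qed
  show "surj (\<lambda>x. x - \<zeta> *\<^sub>C U x)"
  proof (cases "cmod \<zeta> < 1")
    case True
    have "contraction_on UNIV U" using unitary_linear unitary_norm by (simp add: contraction_on_def)
    from bij_perturbed_identity[OF this, of "- \<zeta>"] True show ?thesis by (simp add: bij_is_surj)
  next
    case False
    then have \<zeta>: "cmod \<zeta> > 1" "\<zeta> \<noteq> 0" using assms by auto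
    define U' where "U' = inv U"
    have UU': "U (U' x) = x" for x by (simp add: U'_def surj_f_inv_f[OF unitary_surj])
    have "inj U"
    proof (rule injI)
      fix x y assume "U x = U y"
      then have "norm (U (x - y)) = 0" by (simp add: clinear_UNIV(3)[OF unitary_linear])
      then show "x = y" by (simp add: unitary_norm)
    qed
    then have inj: "U x = U y \<Longrightarrow> x = y" for x y by (simp add: injD)
    have "contraction_on UNIV U'"
      unfolding contraction_on_def clinear_on_def
    proof (intro conjI ballI allI)
      show "U' (x + y) = U' x + U' y" for x y
        by (rule inj) (simp add: UU' clinear_UNIV(1)[OF unitary_linear])
      show "U' (c *\<^sub>C x) = c *\<^sub>C U' x" for c x
        by (rule inj) (simp add: UU' clinear_UNIV(2)[OF unitary_linear])
      show "norm (U' x) \<le> norm x" for x using unitary_norm[of "U' x"] by (simp add: UU')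
    qed
    from bij_perturbed_identity[OF this, of "- inverse \<zeta>"] \<zeta>
    have surj': "surj (\<lambda>x. x - inverse \<zeta> *\<^sub>C U' x)"
      by (simp add: bij_is_surj norm_inverse inverse_less_1_iff)
    show ?thesis
      unfolding surj_def
    proof
      fix y
      obtain x where "- (inverse \<zeta> *\<^sub>C U' y) = x - inverse \<zeta> *\<^sub>C U' x"
        using surjD[OF surj', of "- (inverse \<zeta> *\<^sub>C U' y)"] by blast
      then have "x = inverse \<zeta> *\<^sub>C (U' x - U' y)" by (simp add: algebra_simps)
      then have "U x = inverse \<zeta> *\<^sub>C (x - y)"
        by (metis clinear_UNIV(2,3)[OF unitary_linear] UU')
      then have "\<zeta> *\<^sub>C U x = x - y" using \<zeta>(2) by (simp add: scaleC_scaleC)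
      then show "\<exists>x. y = x - \<zeta> *\<^sub>C U x" by (intro exI[of _ x]) simp
    qed
  qed
qed

lemma resolvent_right: "cmod \<zeta> \<noteq> 1 \<Longrightarrow> resolvent U \<zeta> u - \<zeta> *\<^sub>C U (resolvent U \<zeta> u) = u"
  using surj_f_inv_f[OF bij_is_surj[OF unitary_pencil_bij]] by (simp add: resolvent_def)

lemma resolvent_unique: "cmod \<zeta> \<noteq> 1 \<Longrightarrow> x - \<zeta> *\<^sub>C U x = u \<Longrightarrow> resolvent U \<zeta> u = x"
  using inv_f_f[OF bij_is_inj[OF unitary_pencil_bij], of \<zeta> x] by (simp add: resolvent_def)

lemma resolvent_bound:
  assumes "cmod \<zeta> \<noteq> 1" shows "norm (resolvent U \<zeta> u) \<le> norm u / \<bar>1 - cmod \<zeta>\<bar>"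
  using unitary_pencil_lower_bound[of \<zeta> "resolvent U \<zeta> u"] assms
  by (simp add: resolvent_right pos_le_divide_eq mult.commute)

lemma resolvent_linear:
  assumes "cmod \<zeta> \<noteq> 1" shows "clinear_on UNIV (resolvent U \<zeta>)"
  unfolding clinear_on_def
proof (intro conjI ballI allI)
  note r = resolvent_right[OF assms]
  show "resolvent U \<zeta> (x + y) = resolvent U \<zeta> x + resolvent U \<zeta> y" for x y
  proof (rule resolvent_unique[OF assms])
    let ?u = "resolvent U \<zeta> x" and ?v = "resolvent U \<zeta> y"
    have "?u + ?v - \<zeta> *\<^sub>C U (?u + ?v) = (?u - \<zeta> *\<^sub>C U ?u) + (?v - \<zeta> *\<^sub>C U ?v)"
      by (simp add: clinear_UNIV[OF unitary_linear] scaleC.add_right)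
    then show "?u + ?v - \<zeta> *\<^sub>C U (?u + ?v) = x + y" by (simp only: r)
  qed
  show "resolvent U \<zeta> (c *\<^sub>C x) = c *\<^sub>C resolvent U \<zeta> x" for c x
  proof (rule resolvent_unique[OF assms])
    let ?u = "resolvent U \<zeta> x"
    have "c *\<^sub>C ?u - \<zeta> *\<^sub>C U (c *\<^sub>C ?u) = c *\<^sub>C (?u - \<zeta> *\<^sub>C U ?u)"
      by (simp add: clinear_UNIV[OF unitary_linear] scaleC.diff_right scaleC_scaleC mult.commute)
    then show "c *\<^sub>C ?u - \<zeta> *\<^sub>C U (c *\<^sub>C ?u) = c *\<^sub>C x" by (simp only: r)
  qed
qed

lemma resolvent_identity:
  assumes "cmod \<zeta> \<noteq> 1" "cmod w \<noteq> 1"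
  shows "resolvent U \<zeta> u - resolvent U w u = (\<zeta> - w) *\<^sub>C resolvent U \<zeta> (U (resolvent U w u))"
proof -
  let ?r = "resolvent U w u"
  have "?r + (\<zeta> - w) *\<^sub>C resolvent U \<zeta> (U ?r) - \<zeta> *\<^sub>C U (?r + (\<zeta> - w) *\<^sub>C resolvent U \<zeta> (U ?r))
      = (?r - \<zeta> *\<^sub>C U ?r) + (\<zeta> - w) *\<^sub>C (resolvent U \<zeta> (U ?r) - \<zeta> *\<^sub>C U (resolvent U \<zeta> (U ?r)))"
    by (simp add: clinear_UNIV[OF unitary_linear] scaleC.add_right scaleC.diff_right scaleC_scaleC mult.commute)
  also have "\<dots> = ?r - w *\<^sub>C U ?r"
    by (simp only: resolvent_right[OF assms(1)]) (simp add: scaleC.diff_left)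
  also have "\<dots> = u" by (rule resolvent_right[OF assms(2)])
  finally have "resolvent U \<zeta> u = ?r + (\<zeta> - w) *\<^sub>C resolvent U \<zeta> (U ?r)"
    by (rule resolvent_unique[OF assms(1)])
  then show ?thesis by simp
qed

lemma resolvent_continuous:
  assumes w: "cmod w \<noteq> 1" shows "((\<lambda>\<zeta>. resolvent U \<zeta> u) \<longlongrightarrow> resolvent U w u) (at w)"
proof -
  have "((\<lambda>\<zeta>. resolvent U \<zeta> u - resolvent U w u) \<longlongrightarrow> 0) (at w)"
  proof (rule Lim_null_comparison)
    have "((\<lambda>\<zeta>. cmod \<zeta>) \<longlongrightarrow> cmod w) (at w)" by (intro tendsto_intros)
    then have "\<forall>\<^sub>F \<zeta> in at w. cmod \<zeta> \<noteq> 1" using w by (rule tendsto_imp_eventually_ne)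
    then show "\<forall>\<^sub>F \<zeta> in at w. norm (resolvent U \<zeta> u - resolvent U w u) \<le>
        cmod (\<zeta> - w) * (norm (U (resolvent U w u)) / \<bar>1 - cmod \<zeta>\<bar>)"
    proof eventually_elim
      case (elim \<zeta>)
      show ?case
        unfolding resolvent_identity[OF elim w] norm_scaleC
        by (intro mult_left_mono resolvent_bound elim norm_ge_zero)
    qed
    have "((\<lambda>\<zeta>. cmod (\<zeta> - w) * (norm (U (resolvent U w u)) / \<bar>1 - cmod \<zeta>\<bar>)) \<longlongrightarrow>
        cmod (w - w) * (norm (U (resolvent U w u)) / \<bar>1 - cmod w\<bar>)) (at w)"
      using w by (intro tendsto_intros) auto
    then show "((\<lambda>\<zeta>. cmod (\<zeta> - w) * (norm (U (resolvent U w u)) / \<bar>1 - cmod \<zeta>\<bar>)) \<longlongrightarrow> 0) (at w)" by simp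
  qed
  then show ?thesis by (simp add: LIM_zero_iff)
qed

lemma resolvent_weakly_holomorphic:
  "(\<lambda>\<zeta>. cinner (resolvent U \<zeta> u) v) holomorphic_on (disc \<union> ext_disc)"
proof -
  have der: "((\<lambda>\<zeta>. cinner (resolvent U \<zeta> u) v) has_field_derivative
      cinner (resolvent U w (U (resolvent U w u))) v) (at w)" if w: "cmod w \<noteq> 1" for w
    unfolding has_field_derivative_iff
  proof (rule Lim_transform_eventually)
    show "((\<lambda>\<zeta>. cinner (resolvent U \<zeta> (U (resolvent U w u))) v) \<longlongrightarrow>
        cinner (resolvent U w (U (resolvent U w u))) v) (at w)"
      by (intro cinner.tendsto tendsto_const resolvent_continuous w)
    have "((\<lambda>\<zeta>. cmod \<zeta>) \<longlongrightarrow> cmod w) (at w)" by (intro tendsto_intros)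
    then have "\<forall>\<^sub>F \<zeta> in at w. cmod \<zeta> \<noteq> 1" using w by (rule tendsto_imp_eventually_ne)
    moreover have "\<forall>\<^sub>F \<zeta> in at w. \<zeta> \<noteq> w" by (simp add: eventually_at_filter)
    ultimately show "\<forall>\<^sub>F \<zeta> in at w. cinner (resolvent U \<zeta> (U (resolvent U w u))) v =
        (cinner (resolvent U \<zeta> u) v - cinner (resolvent U w u) v) / (\<zeta> - w)"
    proof eventually_elim
      case (elim \<zeta>)
      then show ?case
        by (simp add: cinner.diff_left[symmetric] resolvent_identity[OF elim(1) w] cinner_scaleC_left)
    qed
  qed
  have "open (disc \<union> ext_disc)" by (intro open_Un open_ball open_Collect_less continuous_intros)
  then show ?thesis
    unfolding holomorphic_on_open[OF \<open>open (disc \<union> ext_disc)\<close>]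
  proof (intro ballI)
    fix w assume "w \<in> disc \<union> ext_disc"
    then have "cmod w \<noteq> 1" by auto
    from der[OF this] show "\<exists>f'. ((\<lambda>\<zeta>. cinner (resolvent U \<zeta> u) v) has_field_derivative f') (at w)"
      by blast
  qed
qed

end

text \<open>In the weak form the projection and the inverse of the embedding disappear: tested against vectors of
  \<open>H\<close>, a generalized resolvent is the resolvent of the unitary dilation.\<close>

lemma generalized_resolvent_weak:
  assumes gr: "is_generalized_resolvent D V J U R" and \<zeta>: "\<zeta> \<in> disc \<union> ext_disc"
  shows "cinner (R \<zeta> x) y = cinner (resolvent U \<zeta> (J x)) (J y)"
    and "norm (R \<zeta> x) \<le> norm x / \<bar>1 - cmod \<zeta>\<bar>"
proof -
  have J: "isometric_on UNIV J" and U: "unitary U"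
      and R: "R \<zeta> x = inv J (orth_proj (range J) (resolvent U \<zeta> (J x)))"
    using gr \<zeta> by (auto simp: is_generalized_resolvent_def resolvent_def)
  have lin: "clinear_on UNIV J" and nrm: "norm (J x) = norm x" for x
    using J by (auto simp: isometric_on_def)
  note sub = csubspace_image[OF csubspace_UNIV lin]
  have clo: "closed (range J)"
    by (rule closed_image_bounded_below[OF csubspace_UNIV closed_UNIV lin, of 1 1]) (simp_all add: nrm)
  have JR: "J (R \<zeta> x) = orth_proj (range J) (resolvent U \<zeta> (J x))"
    unfolding R using orth_proj(1)[OF sub clo] by (rule f_inv_into_f)
  show "cinner (R \<zeta> x) y = cinner (resolvent U \<zeta> (J x)) (J y)"
    using isometric_on_cinner[OF J csubspace_UNIV UNIV_I UNIV_I, of "R \<zeta> x" y]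
    by (simp add: JR cinner_orth_proj[OF sub clo])
  have "norm (R \<zeta> x) \<le> norm (resolvent U \<zeta> (J x))"
    using nrm[of "R \<zeta> x"] norm_orth_proj_le[OF sub clo, of "resolvent U \<zeta> (J x)"] by (simp add: JR)
  also have "\<dots> \<le> norm x / \<bar>1 - cmod \<zeta>\<bar>"
    using resolvent_bound[OF U, of \<zeta> "J x"] \<zeta> by (auto simp: nrm)
  finally show "norm (R \<zeta> x) \<le> norm x / \<bar>1 - cmod \<zeta>\<bar>" .
qed

lemma generalized_resolvent_linear:
  assumes gr: "is_generalized_resolvent D V J U R" and \<zeta>: "\<zeta> \<in> disc \<union> ext_disc"
  shows "clinear_on UNIV (R \<zeta>)"
proof -
  have U: "unitary U" and J: "clinear_on UNIV J"
    using gr by (auto simp: is_generalized_resolvent_def isometric_on_def)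
  have "cmod \<zeta> \<noteq> 1" using \<zeta> by auto
  note lin = clinear_UNIV[OF J] clinear_UNIV[OF resolvent_linear[OF U this]]
  show ?thesis
    unfolding clinear_on_def
  proof (intro conjI ballI allI)
    show "R \<zeta> (u + v) = R \<zeta> u + R \<zeta> v" for u v
      by (rule cinner_eqI) (simp add: generalized_resolvent_weak(1)[OF gr \<zeta>] cinner_add_left lin)
    show "R \<zeta> (c *\<^sub>C u) = c *\<^sub>C R \<zeta> u" for c u
      by (rule cinner_eqI) (simp add: generalized_resolvent_weak(1)[OF gr \<zeta>] cinner_scaleC_left lin)
  qed
qed

lemma generalized_resolvent_weakly_holomorphic:
  assumes gr: "is_generalized_resolvent D V J U R"
  shows "(\<lambda>\<zeta>. cinner (R \<zeta> x) y) holomorphic_on (disc \<union> ext_disc)"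
proof -
  have U: "unitary U" using gr by (simp add: is_generalized_resolvent_def)
  show ?thesis
    by (rule holomorphic_transform[OF resolvent_weakly_holomorphic[OF U, of "J x" "J y"]])
      (simp only: generalized_resolvent_weak(1)[OF gr])
qed

text \<open>The identity \<open>R\<^sub>\<zeta>\<^sup>* + R\<^bsub>1/cnj \<zeta>\<^esub> = 1\<close>. For the unitary operator \<open>U\<close> both resolvents are
  functions of \<open>U\<close>, and \<open>1/(1 - \<zeta> u) + cnj (1/(1 - u / cnj \<zeta>)) = 1\<close> for \<open>|u| = 1\<close>; compression
  preserves the identity because it is linear and maps \<open>1\<close> to \<open>1\<close>. In the proof \<open>u\<close> and \<open>v\<close> are the
  resolvent vectors of \<open>x\<close> and \<open>y\<close>, and everything is expanded in terms of them.\<close>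

lemma generalized_resolvent_symmetry:
  assumes gr: "is_generalized_resolvent D V J U R" and \<zeta>: "\<zeta> \<in> disc \<union> ext_disc" "\<zeta> \<noteq> 0"
  shows "cinner (R \<zeta> x) y + cinner x (R (inverse (cnj \<zeta>)) y) = cinner x y"
proof -
  have U: "unitary U" and J: "isometric_on UNIV J"
    using gr by (auto simp: is_generalized_resolvent_def)
  have \<zeta>': "inverse (cnj \<zeta>) \<in> disc \<union> ext_disc"
    using \<zeta> by (auto simp: norm_inverse inverse_less_1_iff one_less_inverse_iff)
  define u where "u = resolvent U \<zeta> (J x)"
  define v where "v = resolvent U (inverse (cnj \<zeta>)) (J y)"
  have Jx: "J x = u - \<zeta> *\<^sub>C U u" and Jy: "J y = v - inverse (cnj \<zeta>) *\<^sub>C U v"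
    unfolding u_def v_def using \<zeta> \<zeta>' by (intro resolvent_right[OF U, symmetric]; auto)+
  have "cinner x (R (inverse (cnj \<zeta>)) y) = cinner (J x) v"
    using generalized_resolvent_weak(1)[OF gr \<zeta>', of y x] cinner_commute[of x] cinner_commute[of "J x"]
    by (simp add: v_def)
  also have "\<dots> = cinner u v - \<zeta> * cinner (U u) v" by (simp add: Jx cinner_simps)
  finally have 1: "cinner x (R (inverse (cnj \<zeta>)) y) = cinner u v - \<zeta> * cinner (U u) v" .
  have "cinner (R \<zeta> x) y = cinner u (J y)"
    by (simp add: u_def generalized_resolvent_weak(1)[OF gr \<zeta>(1)])
  also have "\<dots> = cinner u v - inverse \<zeta> * cinner u (U v)" by (simp add: Jy cinner_simps)
  finally have 2: "cinner (R \<zeta> x) y = cinner u v - inverse \<zeta> * cinner u (U v)" .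
  have "cinner x y = cinner (J x) (J y)"
    by (simp add: isometric_on_cinner[OF J csubspace_UNIV UNIV_I UNIV_I])
  also have "\<dots> = 2 * cinner u v - \<zeta> * cinner (U u) v - inverse \<zeta> * cinner u (U v)"
    using \<zeta>(2) by (simp add: Jx Jy cinner_simps unitary_cinner[OF U] algebra_simps)
  finally show ?thesis using 1 2 by simp
qed

section \<open>The operator \<open>V_plus\<close>\<close>

text \<open>The map \<open>(f, g) \<mapsto> (f + c g, g + cnj c f)\<close> multiplies the indefinite form
  \<open>cinner f f - cinner g g\<close> by \<open>1 - |c|\<^sup>2\<close>. This is why \<open>V_frac\<close> is isometric, and why
  \<open>V_ext\<close> is isometric exactly when \<open>V_plus\<close> is.\<close>

lemma mobius_cinner:
  fixes f1 :: "'a::complex_inner"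
  shows "cinner (f1 + c *\<^sub>C g1) (f2 + c *\<^sub>C g2) - cinner (g1 + cnj c *\<^sub>C f1) (g2 + cnj c *\<^sub>C f2) =
    (1 - c * cnj c) * (cinner f1 f2 - cinner g1 g2)"
  by (simp add: cinner_simps algebra_simps)

lemma mobius_norm:
  fixes f :: "'a::complex_inner"
  shows "(norm (f + c *\<^sub>C g))\<^sup>2 - (norm (g + cnj c *\<^sub>C f))\<^sup>2 = (1 - (cmod c)\<^sup>2) * ((norm f)\<^sup>2 - (norm g)\<^sup>2)"
proof -
  have "complex_of_real ((norm (f + c *\<^sub>C g))\<^sup>2 - (norm (g + cnj c *\<^sub>C f))\<^sup>2) =
      complex_of_real ((1 - (cmod c)\<^sup>2) * ((norm f)\<^sup>2 - (norm g)\<^sup>2))"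
    using mobius_cinner[of f c g f g]
    by (simp only: cinner_self of_real_diff of_real_mult complex_norm_square[symmetric] of_real_1 of_real_power)
  then show ?thesis using of_real_eq_iff by blast
qed

context
  fixes D :: "'a::{complex_inner,complete_space} set" and V :: "'a \<Rightarrow> 'a" and z0 :: complex
  assumes iso: "closed_isometric D V" and z0: "z0 \<in> disc - {0}"
begin

private lemma D: "csubspace D" "closed D" "clinear_on D V" "f \<in> D \<Longrightarrow> norm (V f) = norm f"
  using iso by (auto simp: closed_isometric_def isometric_on_def)

private lemma z0_norm: "cmod z0 < 1" "z0 \<noteq> 0" using z0 by auto

private lemma defect_map_linear: "clinear_on D (\<lambda>f. f - z0 *\<^sub>C V f)"
  by (auto simp: clinear_on_def clinear_onD[OF D(3,1)] scaleC.add_right scaleC.diff_right scaleC_scaleC mult.commute)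

private lemma defect_map_lower: "f \<in> D \<Longrightarrow> (1 - cmod z0) * norm f \<le> norm (f - z0 *\<^sub>C V f)"
  using norm_triangle_ineq2[of f "z0 *\<^sub>C V f"] by (simp add: D(4) left_diff_distrib)

private lemma defect_map_inj: "inj_on (\<lambda>f. f - z0 *\<^sub>C V f) D"
proof (rule inj_onI)
  fix f g assume f: "f \<in> D" "g \<in> D" and eq: "f - z0 *\<^sub>C V f = g - z0 *\<^sub>C V g"
  have "(1 - cmod z0) * norm (f - g) \<le> norm ((f - g) - z0 *\<^sub>C V (f - g))"
    by (intro defect_map_lower csubspaceD(4) D(1) f)
  also have "(f - g) - z0 *\<^sub>C V (f - g) = (f - z0 *\<^sub>C V f) - (g - z0 *\<^sub>C V g)"
    by (simp add: clinear_onD[OF D(3,1)] f scaleC.diff_right)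
  finally have "(1 - cmod z0) * norm (f - g) \<le> 0" using eq by simp
  then show "f = g" using z0_norm by (simp add: mult_le_0_iff)
qed

lemma M_space_subspace: "csubspace (M_space D V z0)"
  unfolding M_space_def by (rule csubspace_image[OF D(1) defect_map_linear])

lemma M_space_closed: "closed (M_space D V z0)"
  unfolding M_space_def
proof (rule closed_image_bounded_below[OF D(1,2) defect_map_linear])
  show "norm (f - z0 *\<^sub>C V f) \<le> (1 + cmod z0) * norm f" if "f \<in> D" for f
    using norm_triangle_ineq4[of f "z0 *\<^sub>C V f"] that by (simp add: D(4) distrib_right)
  show "(1 - cmod z0) * norm f \<le> norm (f - z0 *\<^sub>C V f)" if "f \<in> D" for f
    using that by (rule defect_map_lower)
qed (use z0_norm in simp)

private lemmas M = M_space_subspace M_space_closed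

lemma N_space_subspace: "csubspace (N_space D V \<zeta>)"
  unfolding N_space_def by (rule csubspace_orth_compl)

lemma N_space_closed: "closed (N_space D V \<zeta>)"
  unfolding N_space_def by (rule closed_orth_compl)

lemma V_frac_apply:
  "f \<in> D \<Longrightarrow> V_frac D V z0 (f - z0 *\<^sub>C V f) = V f - cnj z0 *\<^sub>C f"
  by (simp add: V_frac_def the_inv_into_f_f[OF defect_map_inj, of f])

lemma V_frac_isometric: "isometric_on (M_space D V z0) (V_frac D V z0)"
  unfolding isometric_on_def clinear_on_def
proof (intro conjI ballI allI)
  fix m c assume "m \<in> M_space D V z0"
  then obtain f where f: "f \<in> D" and m: "m = f - z0 *\<^sub>C V f" by (auto simp: M_space_def)
  have "c *\<^sub>C m = c *\<^sub>C f - z0 *\<^sub>C V (c *\<^sub>C f)"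
    by (simp add: m clinear_onD[OF D(3,1) f] scaleC.diff_right scaleC_scaleC mult.commute)
  then have "V_frac D V z0 (c *\<^sub>C m) = V (c *\<^sub>C f) - cnj z0 *\<^sub>C c *\<^sub>C f"
    by (simp only: V_frac_apply[OF csubspaceD(3)[OF D(1) f]])
  also have "\<dots> = c *\<^sub>C V_frac D V z0 m"
    unfolding m V_frac_apply[OF f]
    by (simp add: clinear_onD[OF D(3,1) f] scaleC.diff_right scaleC_scaleC mult.commute)
  finally show "V_frac D V z0 (c *\<^sub>C m) = c *\<^sub>C V_frac D V z0 m" .
  have "(norm (f + (- z0) *\<^sub>C V f))\<^sup>2 - (norm (V f + cnj (- z0) *\<^sub>C f))\<^sup>2 = 0"
    unfolding mobius_norm by (simp add: D(4)[OF f])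
  then show "norm (V_frac D V z0 m) = norm m"
    using f by (simp add: m V_frac_apply power2_eq_iff_nonneg)
  fix n assume "n \<in> M_space D V z0"
  then obtain g where g: "g \<in> D" and n: "n = g - z0 *\<^sub>C V g" by (auto simp: M_space_def)
  have "m + n = (f + g) - z0 *\<^sub>C V (f + g)"
    by (simp add: m n clinear_onD[OF D(3,1) f] g scaleC.add_right)
  then show "V_frac D V z0 (m + n) = V_frac D V z0 m + V_frac D V z0 n"
    by (simp add: V_frac_apply csubspaceD(2)[OF D(1) f g])
      (simp add: m n V_frac_apply f g clinear_onD[OF D(3,1) f] scaleC.add_right)
qed

text \<open>\<open>V f - cnj z0 f = - cnj z0 (f - V f / cnj z0)\<close>; the division is possible as \<open>z0 \<noteq> 0\<close>.\<close>

lemma V_frac_range: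
  assumes "m \<in> M_space D V z0" shows "V_frac D V z0 m \<in> M_space D V (1 / cnj z0)"
proof -
  obtain f where f: "f \<in> D" and m: "m = f - z0 *\<^sub>C V f" using assms by (auto simp: M_space_def)
  have "V f - cnj z0 *\<^sub>C f = (- cnj z0) *\<^sub>C f - (1 / cnj z0) *\<^sub>C V ((- cnj z0) *\<^sub>C f)"
    unfolding clinear_onD(2)[OF D(3,1) f] scaleC_scaleC using z0_norm by simp
  then show ?thesis
    unfolding M_space_def m V_frac_apply[OF f] using csubspaceD(3)[OF D(1) f] by blast
qed

lemma N_proj: "orth_proj (N_space D V z0) x \<in> N_space D V z0"
    "orth_proj (N_space D V z0) x = x - orth_proj (M_space D V z0) x"
  unfolding N_space_def orth_proj_orth_compl[OF M] by (simp_all add: orth_proj[OF M])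

lemma N_proj_id: "x \<in> N_space D V z0 \<Longrightarrow> orth_proj (N_space D V z0) x = x"
    "x \<in> N_space D V z0 \<Longrightarrow> orth_proj (M_space D V z0) x = 0"
proof -
  assume "x \<in> N_space D V z0"
  then show *: "orth_proj (M_space D V z0) x = 0"
    using csubspaceD(1)[OF M(1)] by (intro orth_proj_eqI M) (simp_all add: N_space_def)
  show "orth_proj (N_space D V z0) x = x" by (simp add: N_proj(2) *)
qed

lemma V_plus_on_N: "x \<in> N_space D V z0 \<Longrightarrow> V_plus D V z0 C x = C x"
  using V_frac_isometric clinear_on_zero[OF _ M(1), of "V_frac D V z0"]
  by (simp add: V_plus_def N_proj_id isometric_on_def)

lemma V_plus_cong:
  "(\<And>x. x \<in> N_space D V z0 \<Longrightarrow> C x = C' x) \<Longrightarrow> V_plus D V z0 C = V_plus D V z0 C'"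
  by (rule ext) (simp add: V_plus_def N_proj(1))

lemma V_plus_diff:
  "V_plus D V z0 C x - V_plus D V z0 C' x =
    C (orth_proj (N_space D V z0) x) - C' (orth_proj (N_space D V z0) x)"
  by (simp add: V_plus_def)

lemma V_plus_linear:
  assumes "clinear_on (N_space D V z0) C" shows "clinear_on UNIV (V_plus D V z0 C)"
proof -
  have V: "clinear_on (M_space D V z0) (V_frac D V z0)" using V_frac_isometric by (simp add: isometric_on_def)
  have N: "csubspace (orth_compl (M_space D V z0))" by (rule csubspace_orth_compl)
  note P = clinear_UNIV[OF clinear_orth_proj[OF M]]
  have PN: "clinear_on UNIV (orth_proj (N_space D V z0))"
    by (simp add: clinear_on_def N_proj(2) P scaleC.diff_right)
  show ?thesis
    unfolding clinear_on_def V_plus_def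
    by (auto simp: P clinear_UNIV[OF PN] clinear_onD[OF V M(1)] clinear_onD[OF assms N_space_subspace]
        orth_proj(1)[OF M] N_proj(1) scaleC.add_right)
qed

text \<open>The two summands of \<open>V_plus\<close> lie in the orthogonal spaces \<open>M\<^bsub>1/cnj z0\<^esub>\<close> and \<open>N\<^bsub>1/cnj z0\<^esub>\<close>.\<close>

lemma V_plus_norm:
  assumes "C ` N_space D V z0 \<subseteq> N_space D V (1 / cnj z0)"
  shows "(norm (V_plus D V z0 C x))\<^sup>2 =
    (norm (orth_proj (M_space D V z0) x))\<^sup>2 + (norm (C (orth_proj (N_space D V z0) x)))\<^sup>2"
proof -
  let ?m = "orth_proj (M_space D V z0) x" and ?n = "orth_proj (N_space D V z0) x"
  have "C ?n \<in> orth_compl (M_space D V (1 / cnj z0))"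
    using assms N_proj(1) by (auto simp: N_space_def)
  then have "cinner (V_frac D V z0 ?m) (C ?n) = 0"
    using V_frac_range[OF orth_proj(1)[OF M]] by (rule orth_complD(2))
  moreover have "norm (V_frac D V z0 ?m) = norm ?m"
    using V_frac_isometric orth_proj(1)[OF M] by (simp add: isometric_on_def)
  ultimately show ?thesis by (simp add: V_plus_def norm_add_sq)
qed

lemma norm_M_N: "(norm x)\<^sup>2 =
    (norm (orth_proj (M_space D V z0) x))\<^sup>2 + (norm (orth_proj (N_space D V z0) x))\<^sup>2"
  unfolding N_proj(2) by (rule norm_orth_decomposition[OF M])

lemma V_plus_contraction:
  assumes C: "contraction_on (N_space D V z0) C" "C ` N_space D V z0 \<subseteq> N_space D V (1 / cnj z0)"
  shows "contraction_on UNIV (V_plus D V z0 C)"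
proof -
  have "norm (V_plus D V z0 C x) \<le> norm x" for x
  proof (rule power2_le_imp_le)
    have "norm (C (orth_proj (N_space D V z0) x)) \<le> norm (orth_proj (N_space D V z0) x)"
      using C(1) N_proj(1) by (auto simp: contraction_on_def)
    then show "(norm (V_plus D V z0 C x))\<^sup>2 \<le> (norm x)\<^sup>2"
      unfolding V_plus_norm[OF C(2)] norm_M_N[of x] by (intro add_left_mono power_mono) auto
  qed simp
  then show ?thesis using C(1) V_plus_linear by (simp add: contraction_on_def)
qed

lemma V_plus_isometric:
  assumes C: "isometric_on (N_space D V z0) C" "C ` N_space D V z0 \<subseteq> N_space D V (1 / cnj z0)"
  shows "isometric_on UNIV (V_plus D V z0 C)"
proof -
  have "norm (V_plus D V z0 C x) = norm x" for x
  proof -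
    have "norm (C (orth_proj (N_space D V z0) x)) = norm (orth_proj (N_space D V z0) x)"
      using C(1) N_proj(1) by (auto simp: isometric_on_def)
    then have "(norm (V_plus D V z0 C x))\<^sup>2 = (norm x)\<^sup>2"
      unfolding V_plus_norm[OF C(2)] norm_M_N[of x] by simp
    then show ?thesis by (simp add: power2_eq_iff_nonneg)
  qed
  then show ?thesis using C(1) V_plus_linear by (simp add: isometric_on_def)
qed

text \<open>If \<open>y\<close> in \<open>N\<^bsub>1/cnj z0\<^esub>\<close> is \<open>m + C n\<close> with \<open>m\<close> in \<open>M\<^bsub>1/cnj z0\<^esub>\<close>, then \<open>m = y - C n\<close> is
  orthogonal to itself.\<close>

lemma V_plus_surj_imp_onto:
  assumes C: "C ` N_space D V z0 \<subseteq> N_space D V (1 / cnj z0)"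
    and W: "surj (V_plus D V z0 C)"
  shows "C ` N_space D V z0 = N_space D V (1 / cnj z0)"
proof (rule antisym[OF C], rule subsetI)
  fix y assume y: "y \<in> N_space D V (1 / cnj z0)"
  obtain x where x: "y = V_plus D V z0 C x" using surjD[OF W] by blast
  let ?m = "V_frac D V z0 (orth_proj (M_space D V z0) x)" and ?n = "C (orth_proj (N_space D V z0) x)"
  have "y - ?n \<in> N_space D V (1 / cnj z0)"
    using C N_proj(1) y by (intro csubspaceD(4)[OF N_space_subspace]) auto
  moreover have m: "y - ?n = ?m" by (simp add: x V_plus_def)
  moreover have "?m \<in> M_space D V (1 / cnj z0)" by (intro V_frac_range orth_proj(1) M)
  ultimately have "cinner ?m ?m = 0" unfolding N_space_def by (metis orth_complD(1))
  then have "y = ?n" using m by (simp add: cinner_self)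
  then show "y \<in> C ` N_space D V z0" using N_proj(1) by blast
qed

end

section \<open>The linear pencil of a contraction\<close>

text \<open>The operator \<open>B\<^sub>\<zeta>\<close>: the numerator of \<open>1 - \<zeta> V_ext\<close> when \<open>V_ext\<close> is regarded as a quotient
  with denominator \<open>1 + z0 W\<close> (\<open>pencil_eq\<close>).\<close>

definition pencil :: "complex \<Rightarrow> ('a \<Rightarrow> 'a) \<Rightarrow> complex \<Rightarrow> 'a::complex_vector \<Rightarrow> 'a"
  where "pencil z0 W \<zeta> f = (1 - \<zeta> * cnj z0) *\<^sub>C f - (\<zeta> - z0) *\<^sub>C W f"

lemma pencil_eq:
  "pencil z0 W \<zeta> f = (f + z0 *\<^sub>C W f) - \<zeta> *\<^sub>C (W f + cnj z0 *\<^sub>C f)"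
  by (simp add: pencil_def scaleC_add_right scaleC_scaleC scaleC.scale_left_diff_distrib)

context
  fixes D :: "'a::{complex_inner,complete_space} set" and V :: "'a \<Rightarrow> 'a" and z0 :: complex
    and C :: "'a \<Rightarrow> 'a"
  assumes W: "contraction_on UNIV (V_plus D V z0 C)" and z0: "cmod z0 < 1"
begin

private abbreviation (input) "W \<equiv> V_plus D V z0 C"

private lemma bij0: "bij (\<lambda>f. f + z0 *\<^sub>C W f)"
  using bij_perturbed_identity[OF W z0] .

private lemma V_ext_compose:
  "(\<lambda>x. x - \<zeta> *\<^sub>C V_ext D V z0 C x) \<circ> (\<lambda>f. f + z0 *\<^sub>C W f) = pencil z0 W \<zeta>"
proof
  fix f
  have "inv (\<lambda>f. f + z0 *\<^sub>C W f) (f + z0 *\<^sub>C W f) = f"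
    using inv_f_f[OF bij_is_inj[OF bij0], of f] .
  then show "((\<lambda>x. x - \<zeta> *\<^sub>C V_ext D V z0 C x) \<circ> (\<lambda>f. f + z0 *\<^sub>C W f)) f = pencil z0 W \<zeta> f"
    by (simp add: V_ext_def pencil_eq)
qed

lemma V_ext_bij_iff: "bij (\<lambda>x. x - \<zeta> *\<^sub>C V_ext D V z0 C x) \<longleftrightarrow> bij (pencil z0 W \<zeta>)"
  unfolding V_ext_compose[symmetric]
  using bij_comp[OF bij0] bij_betw_comp_iff[OF bij0, of "\<lambda>x. x - \<zeta> *\<^sub>C V_ext D V z0 C x" UNIV] by auto

lemma V_ext_inverse:
  assumes "bij (pencil z0 W \<zeta>)"
  shows "inv (\<lambda>x. x - \<zeta> *\<^sub>C V_ext D V z0 C x) (pencil z0 W \<zeta> f) = f + z0 *\<^sub>C W f"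
  using inv_f_f[OF bij_is_inj[OF assms[folded V_ext_bij_iff]], of "f + z0 *\<^sub>C W f"]
  by (simp add: V_ext_compose[symmetric] del: )

end

lemma mobius_modulus:
  "(cmod (1 - \<zeta> * cnj z0))\<^sup>2 - (cmod (\<zeta> - z0))\<^sup>2 = (1 - (cmod \<zeta>)\<^sup>2) * (1 - (cmod z0)\<^sup>2)"
proof -
  have "complex_of_real ((cmod (1 - \<zeta> * cnj z0))\<^sup>2 - (cmod (\<zeta> - z0))\<^sup>2) =
      complex_of_real ((1 - (cmod \<zeta>)\<^sup>2) * (1 - (cmod z0)\<^sup>2))"
    by (simp add: complex_norm_square algebra_simps del: of_real_power)
  then show ?thesis using of_real_eq_iff by blast
qed

lemma pencil_factor:
  assumes "cmod z0 < 1" "cmod \<zeta> \<le> 1"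
  shows "1 - \<zeta> * cnj z0 \<noteq> 0"
    and "pencil z0 W \<zeta> f = (1 - \<zeta> * cnj z0) *\<^sub>C (f + (- ((\<zeta> - z0) / (1 - \<zeta> * cnj z0))) *\<^sub>C W f)"
proof -
  have "cmod (\<zeta> * cnj z0) < 1"
    using assms mult_left_le_one_le[of "cmod z0" "cmod \<zeta>"] by (simp add: norm_mult)
  then show *: "1 - \<zeta> * cnj z0 \<noteq> 0" by auto
  show "pencil z0 W \<zeta> f = (1 - \<zeta> * cnj z0) *\<^sub>C (f + (- ((\<zeta> - z0) / (1 - \<zeta> * cnj z0))) *\<^sub>C W f)"
    unfolding pencil_def using * by (simp add: scaleC.scale_right_diff_distrib scaleC_scaleC)
qed

lemma pencil_bij_disc:
  fixes W :: "'a::{complex_inner,complete_space} \<Rightarrow> 'a"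
  assumes W: "contraction_on UNIV W" and z0: "cmod z0 < 1" and \<zeta>: "cmod \<zeta> < 1"
  shows "bij (pencil z0 W \<zeta>)"
proof -
  define c where "c = - ((\<zeta> - z0) / (1 - \<zeta> * cnj z0))"
  define b where "b = 1 - \<zeta> * cnj z0"
  have b: "b \<noteq> 0" unfolding b_def using pencil_factor(1)[OF z0, of \<zeta>] \<zeta> by simp
  have "(cmod (\<zeta> - z0))\<^sup>2 < (cmod b)\<^sup>2"
  proof -
    have "(cmod \<zeta>)\<^sup>2 < 1" "(cmod z0)\<^sup>2 < 1" using z0 \<zeta> by (simp_all add: abs_square_less_1)
    then have "0 < (1 - (cmod \<zeta>)\<^sup>2) * (1 - (cmod z0)\<^sup>2)" by simp
    then show ?thesis unfolding b_def mobius_modulus[symmetric] by simp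
  qed
  then have "cmod (\<zeta> - z0) < cmod b" by (rule power2_less_imp_less) simp
  then have "cmod c < 1" using b by (simp add: c_def b_def norm_divide)
  from bij_perturbed_identity[OF W this] have 1: "bij (\<lambda>x. x + c *\<^sub>C W x)" .
  have 2: "bij (\<lambda>x::'a. b *\<^sub>C x)"
    by (rule o_bij[of "\<lambda>x. inverse b *\<^sub>C x"]) (use b in \<open>auto simp: scaleC_scaleC\<close>)
  have "pencil z0 W \<zeta> = (\<lambda>x. b *\<^sub>C x) \<circ> (\<lambda>x. x + c *\<^sub>C W x)"
    using pencil_factor(2)[OF z0, of \<zeta> W] \<zeta> by (auto simp: b_def c_def)
  then show ?thesis using bij_comp[OF 1 2] by simp
qed

text \<open>On the circle \<open>|w - z0| = |1 - w cnj z0|\<close>, so up to a scalar the pencil is \<open>1 - u W\<close> with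
  \<open>|u| = 1\<close>.\<close>

lemma pencil_isometry_surjective:
  fixes W :: "'a::{complex_inner,complete_space} \<Rightarrow> 'a"
  assumes W: "isometric_on UNIV W" and z0: "cmod z0 < 1" and w: "cmod w = 1"
    and surj: "surj (pencil z0 W w)"
  shows "surj W"
proof (rule isometry_surjective[OF W])
  define b where "b = 1 - w * cnj z0"
  have b: "b \<noteq> 0" unfolding b_def using pencil_factor(1)[OF z0, of w] w by simp
  have "(cmod (w - z0))\<^sup>2 = (cmod b)\<^sup>2" using mobius_modulus[of w z0] w by (simp add: b_def)
  then show "cmod ((w - z0) / b) = 1" using b by (simp add: norm_divide power2_eq_iff_nonneg)
  show "surj (\<lambda>x. x - ((w - z0) / b) *\<^sub>C W x)"
    unfolding surj_def
  proof
    fix y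
    obtain f where "b *\<^sub>C y = pencil z0 W w f" using surjD[OF surj] by blast
    then have "b *\<^sub>C y = b *\<^sub>C (f - ((w - z0) / b) *\<^sub>C W f)"
      using pencil_factor(2)[OF z0, of w W f] w by (simp add: b_def scaleC.minus_left)
    then have "inverse b *\<^sub>C b *\<^sub>C y = inverse b *\<^sub>C b *\<^sub>C (f - ((w - z0) / b) *\<^sub>C W f)"
      by (rule arg_cong)
    then have "y = f - ((w - z0) / b) *\<^sub>C W f"
      by (simp only: scaleC_scaleC left_inverse[OF b] scaleC.scale_one)
    then show "\<exists>x. y = x - ((w - z0) / b) *\<^sub>C W x" by blast
  qed
qed

lemma pencil_norm_le:
  assumes W: "contraction_on UNIV W" and z0: "cmod z0 \<le> 1" and \<zeta>: "cmod \<zeta> \<le> 1"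
  shows "norm (pencil z0 W \<zeta> f) \<le> 4 * norm f"
proof -
  have "norm (pencil z0 W \<zeta> f) \<le> cmod (1 - \<zeta> * cnj z0) * norm f + cmod (\<zeta> - z0) * norm (W f)"
    unfolding pencil_def using norm_triangle_ineq4[of "(1 - \<zeta> * cnj z0) *\<^sub>C f" "(\<zeta> - z0) *\<^sub>C W f"] by simp
  also have "cmod (1 - \<zeta> * cnj z0) \<le> 2"
    using norm_triangle_ineq4[of 1 "\<zeta> * cnj z0"] mult_mono[OF \<zeta> z0] by (simp add: norm_mult)
  also have "cmod (\<zeta> - z0) \<le> 2"
    using norm_triangle_ineq4[of \<zeta> z0] z0 \<zeta> by simp
  also have "norm (W f) \<le> norm f" using W by (simp add: contraction_on_def)
  finally show ?thesis by (simp add: mult_right_mono)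
qed

text \<open>\<open>X\<close> is the value at \<open>\<zeta>\<close> of the resolvent attached to the parameter \<open>W\<close> by Inin's formula. The
  formulation \<open>X B\<^sub>\<zeta> = 1 + z0 W\<close> contains no inverses and hence passes to limits.\<close>

definition mobius_resolvent ::
  "complex \<Rightarrow> complex \<Rightarrow> ('a::complex_inner \<Rightarrow> 'a) \<Rightarrow> ('a \<Rightarrow> 'a) \<Rightarrow> bool"
  where "mobius_resolvent z0 \<zeta> X W \<longleftrightarrow>
    contraction_on UNIV W \<and> bij (pencil z0 W \<zeta>) \<and> (\<forall>f. X (pencil z0 W \<zeta> f) = f + z0 *\<^sub>C W f)"

lemma mobius_resolventD:
  assumes "mobius_resolvent z0 \<zeta> X W"
  shows "clinear_on UNIV W" "norm (W x) \<le> norm x" "contraction_on UNIV W"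
    "bij (pencil z0 W \<zeta>)" "X (pencil z0 W \<zeta> f) = f + z0 *\<^sub>C W f"
    "\<exists>f. y = pencil z0 W \<zeta> f"
  using assms surjD[OF bij_is_surj, of "pencil z0 W \<zeta>" y]
  by (auto simp: mobius_resolvent_def contraction_on_def)

lemma pencil_linear:
  assumes "clinear_on UNIV W"
  shows "pencil z0 W \<zeta> (f + g) = pencil z0 W \<zeta> f + pencil z0 W \<zeta> g"
    "pencil z0 W \<zeta> (c *\<^sub>C f) = c *\<^sub>C pencil z0 W \<zeta> f"
  by (simp_all add: pencil_def clinear_UNIV[OF assms] scaleC_add_right scaleC_scaleC
      scaleC.scale_right_diff_distrib mult.commute)

lemma mobius_resolvent_linear:
  assumes X: "mobius_resolvent z0 \<zeta> X W" shows "clinear_on UNIV X"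
  unfolding clinear_on_def
proof (intro conjI ballI allI)
  note W = mobius_resolventD(1)[OF X]
  fix x c
  obtain f where f: "x = pencil z0 W \<zeta> f" using mobius_resolventD(6)[OF X] by blast
  show "X (c *\<^sub>C x) = c *\<^sub>C X x"
    unfolding f pencil_linear(2)[OF W, symmetric] mobius_resolventD(5)[OF X]
    by (simp add: clinear_UNIV[OF W] scaleC.add_right scaleC_scaleC mult.commute)
  fix y
  obtain g where g: "y = pencil z0 W \<zeta> g" using mobius_resolventD(6)[OF X] by blast
  show "X (x + y) = X x + X y"
    unfolding f g pencil_linear(1)[OF W, symmetric] mobius_resolventD(5)[OF X]
    by (simp add: clinear_UNIV[OF W] scaleC.add_right)
qed

lemma mobius_resolvent_V_ext:
  fixes D :: "'a::{complex_inner,complete_space} set"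
  assumes "contraction_on UNIV (V_plus D V z0 C)" "cmod z0 < 1" "bij (pencil z0 (V_plus D V z0 C) \<zeta>)"
  shows "mobius_resolvent z0 \<zeta> (inv (\<lambda>x. x - \<zeta> *\<^sub>C V_ext D V z0 C x)) (V_plus D V z0 C)"
  using assms V_ext_inverse[OF assms] by (simp add: mobius_resolvent_def)

text \<open>If \<open>X B\<^sub>\<zeta> = 1 + z0 W\<close>, this is \<open>\<zeta> (1 - |z0|\<^sup>2) B\<^sub>\<zeta>\<^sup>-\<^sup>1\<close>. Unlike the
  inverse itself it is expressed in terms of \<open>X\<close> alone.\<close>

definition scaled_pencil_inverse :: "complex \<Rightarrow> complex \<Rightarrow> ('a::complex_vector \<Rightarrow> 'a) \<Rightarrow> 'a \<Rightarrow> 'a"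
  where "scaled_pencil_inverse z0 \<zeta> X y = (\<zeta> - z0) *\<^sub>C X y + z0 *\<^sub>C y"

lemma scaled_pencil_inverse_pencil:
  assumes X: "X (pencil z0 W \<zeta> f) = f + z0 *\<^sub>C W f"
  shows "scaled_pencil_inverse z0 \<zeta> X (pencil z0 W \<zeta> f) = (\<zeta> * (1 - z0 * cnj z0)) *\<^sub>C f"
  unfolding scaled_pencil_inverse_def X
  by (simp add: pencil_def scaleC_scaleC algebra_simps)

lemma cmod_one_minus_mult_cnj: "cmod z0 < 1 \<Longrightarrow> cmod (1 - z0 * cnj z0) = 1 - (cmod z0)\<^sup>2"
proof -
  assume "cmod z0 < 1"
  then have "(cmod z0)\<^sup>2 \<le> 1" by (simp add: abs_square_le_1)
  moreover have "1 - z0 * cnj z0 = complex_of_real (1 - (cmod z0)\<^sup>2)" by (simp add: complex_norm_square del: of_real_power)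
  ultimately show ?thesis by (simp del: of_real_diff)
qed

text \<open>The inverse of an operator of norm at most \<open>4\<close> is bounded below. The bound does not depend on \<open>W\<close>.\<close>

lemma scaled_pencil_inverse_lower_bound:
  assumes X: "mobius_resolvent z0 \<zeta> X W" and z0: "cmod z0 < 1" and \<zeta>: "cmod \<zeta> \<le> 1"
  shows "cmod \<zeta> * (1 - (cmod z0)\<^sup>2) * norm y \<le> 4 * norm (scaled_pencil_inverse z0 \<zeta> X y)"
proof -
  obtain f where f: "y = pencil z0 W \<zeta> f" using mobius_resolventD(6)[OF X] by blast
  have "norm y \<le> 4 * norm f" unfolding f using mobius_resolventD(3)[OF X] z0 \<zeta> by (intro pencil_norm_le) auto
  moreover have "0 \<le> cmod \<zeta> * (1 - (cmod z0)\<^sup>2)" using z0 by (simp add: abs_square_le_1)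
  ultimately have "cmod \<zeta> * (1 - (cmod z0)\<^sup>2) * norm y \<le> cmod \<zeta> * (1 - (cmod z0)\<^sup>2) * (4 * norm f)"
    by (rule mult_left_mono)
  also have "\<dots> = 4 * norm (scaled_pencil_inverse z0 \<zeta> X y)"
    unfolding f scaled_pencil_inverse_pencil[where X = X, OF mobius_resolventD(5)[OF X]]
    by (simp add: norm_mult cmod_one_minus_mult_cnj[OF z0])
  finally show ?thesis .
qed

lemma pencil_diff:
  "pencil z0 W \<zeta> f - pencil z0 W' \<zeta>' f =
    - ((\<zeta> - \<zeta>') *\<^sub>C (cnj z0 *\<^sub>C f + W' f)) - (\<zeta> - z0) *\<^sub>C (W f - W' f)"
  by (simp add: pencil_def scaleC_scaleC algebra_simps)

text \<open>The parameter depends continuously on the resolvent. Subtracting the relations \<open>X B = 1 + z0 W\<close> and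
  \<open>X' B' = 1 + z0 W'\<close> gives
  \<open>L (W - W') = (X - X') B' - (\<zeta> - \<zeta>') X (cnj z0 + W')\<close>, where \<open>L\<close> is the scaled inverse of
  the pencil, which is bounded below.\<close>

lemma mobius_resolvent_parameter_diff:
  assumes X: "mobius_resolvent z0 \<zeta> X W" and X': "mobius_resolvent z0 \<zeta>' X' W'"
    and z0: "cmod z0 < 1" and \<zeta>: "cmod \<zeta> \<le> 1" "cmod \<zeta>' \<le> 1"
    and d: "\<And>y. norm (X y - X' y) \<le> d * norm y" and d0: "d \<ge> 0" and K: "\<And>y. norm (X y) \<le> K * norm y" "K \<ge> 0"
  shows "cmod \<zeta> * (1 - (cmod z0)\<^sup>2) * norm (W f - W' f) \<le> 4 * (4 * d + 2 * K * cmod (\<zeta> - \<zeta>')) * norm f"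
proof -
  note lin = clinear_UNIV[OF mobius_resolvent_linear[OF X]]
  let ?B = "pencil z0 W \<zeta> f" and ?B' = "pencil z0 W' \<zeta>' f" and ?g = "cnj z0 *\<^sub>C f + W' f"
  have "X ?B' = X ?B + (\<zeta> - \<zeta>') *\<^sub>C X ?g + (\<zeta> - z0) *\<^sub>C X (W f - W' f)"
  proof -
    have "?B' = ?B + (\<zeta> - \<zeta>') *\<^sub>C ?g + (\<zeta> - z0) *\<^sub>C (W f - W' f)"
      using pencil_diff[of z0 W \<zeta> f W' \<zeta>'] by (simp add: algebra_simps)
    then show ?thesis by (simp add: lin)
  qed
  moreover have "X ?B - X' ?B' = z0 *\<^sub>C (W f - W' f)"
    by (simp add: mobius_resolventD(5)[OF X] mobius_resolventD(5)[OF X'] scaleC.diff_right)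
  ultimately have "scaled_pencil_inverse z0 \<zeta> X (W f - W' f) = (X ?B' - X' ?B') - (\<zeta> - \<zeta>') *\<^sub>C X ?g"
    by (simp add: scaled_pencil_inverse_def algebra_simps)
  then have "norm (scaled_pencil_inverse z0 \<zeta> X (W f - W' f)) \<le> norm (X ?B' - X' ?B') + cmod (\<zeta> - \<zeta>') * norm (X ?g)"
    using norm_triangle_ineq4[of "X ?B' - X' ?B'" "(\<zeta> - \<zeta>') *\<^sub>C X ?g"] by simp
  also have "norm (X ?B' - X' ?B') \<le> d * (4 * norm f)"
    using pencil_norm_le[OF mobius_resolventD(3)[OF X'] _ \<zeta>(2), of z0 f] z0
    by (intro order_trans[OF d] mult_left_mono d0) simp
  also have "cmod (\<zeta> - \<zeta>') * norm (X ?g) \<le> cmod (\<zeta> - \<zeta>') * (K * (2 * norm f))"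
  proof (rule mult_left_mono)
    have "norm ?g \<le> cmod z0 * norm f + norm (W' f)" using norm_triangle_ineq[of "cnj z0 *\<^sub>C f" "W' f"] by simp
    also have "\<dots> \<le> 1 * norm f + norm f"
      using z0 by (intro add_mono mult_right_mono mobius_resolventD(2)[OF X']) auto
    finally show "norm (X ?g) \<le> K * (2 * norm f)" by (intro order_trans[OF K(1)] mult_left_mono K(2)) simp
  qed simp
  finally have "norm (scaled_pencil_inverse z0 \<zeta> X (W f - W' f)) \<le> (4 * d + 2 * K * cmod (\<zeta> - \<zeta>')) * norm f"
    by (simp add: algebra_simps)
  then show ?thesis
    using scaled_pencil_inverse_lower_bound[OF X z0 \<zeta>(1), of "W f - W' f"] by linarith
qed

text \<open>The relation \<open>X B = 1 + z0 W\<close> passes to the limit, and so does the lower bound for the scaled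
  inverse \<open>L\<close> of the pencil. In the limit \<open>L B\<close> is still a nonzero scalar; as \<open>L\<close> is injective,
  \<open>B L\<close> is the same scalar and \<open>B\<close> is bijective.\<close>

lemma mobius_resolvent_limit:
  assumes L: "L \<noteq> bot" and ev: "\<forall>\<^sub>F \<zeta> in L. mobius_resolvent z0 \<zeta> (F \<zeta>) (Wf \<zeta>) \<and> cmod \<zeta> \<le> 1"
    and w: "((\<lambda>\<zeta>. \<zeta>) \<longlongrightarrow> w) L" "cmod w = 1" and z0: "cmod z0 < 1"
    and F: "op_tendsto UNIV F X L" and X: "bounded_clinear_on UNIV X"
    and Wf: "\<And>f. ((\<lambda>\<zeta>. Wf \<zeta> f) \<longlongrightarrow> W f) L" and W: "contraction_on UNIV W"
  shows "mobius_resolvent z0 w X W"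
proof -
  have Xlin: "clinear_on UNIV X" using X by (simp add: bounded_clinear_on_def)
  obtain K where K: "\<And>x. norm (X x) \<le> K * norm x" using bounded_clinear_on_bound[OF X] by auto
  have B: "((\<lambda>\<zeta>. pencil z0 (Wf \<zeta>) \<zeta> f) \<longlongrightarrow> pencil z0 W w f) L" for f
    unfolding pencil_def by (intro tendsto_intros scaleC.tendsto w Wf)
  have rel: "X (pencil z0 W w f) = f + z0 *\<^sub>C W f" for f
  proof (rule tendsto_unique[OF L])
    show "((\<lambda>\<zeta>. F \<zeta> (pencil z0 (Wf \<zeta>) \<zeta> f)) \<longlongrightarrow> X (pencil z0 W w f)) L"
      by (rule op_tendsto_apply[OF F Xlin K B])
    have lim: "((\<lambda>\<zeta>. f + z0 *\<^sub>C Wf \<zeta> f) \<longlongrightarrow> f + z0 *\<^sub>C W f) L" by (intro tendsto_intros scaleC.tendsto Wf)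
    show "((\<lambda>\<zeta>. F \<zeta> (pencil z0 (Wf \<zeta>) \<zeta> f)) \<longlongrightarrow> f + z0 *\<^sub>C W f) L"
      by (rule Lim_transform_eventually[OF lim]) (use ev in eventually_elim, simp add: mobius_resolventD(5))
  qed
  have lower: "(1 - (cmod z0)\<^sup>2) * norm y \<le> 4 * norm (scaled_pencil_inverse z0 w X y)" for y
  proof (rule tendsto_le[OF L])
    show "((\<lambda>\<zeta>. 4 * norm (scaled_pencil_inverse z0 \<zeta> (F \<zeta>) y)) \<longlongrightarrow> 4 * norm (scaled_pencil_inverse z0 w X y)) L"
      unfolding scaled_pencil_inverse_def
      by (intro tendsto_intros scaleC.tendsto w op_tendsto_pointwise[OF F]) simp
    have "((\<lambda>\<zeta>. cmod \<zeta> * (1 - (cmod z0)\<^sup>2) * norm y) \<longlongrightarrow> cmod w * (1 - (cmod z0)\<^sup>2) * norm y) L"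
      by (intro tendsto_intros w)
    then show "((\<lambda>\<zeta>. cmod \<zeta> * (1 - (cmod z0)\<^sup>2) * norm y) \<longlongrightarrow> (1 - (cmod z0)\<^sup>2) * norm y) L"
      using w(2) by simp
    show "\<forall>\<^sub>F \<zeta> in L. cmod \<zeta> * (1 - (cmod z0)\<^sup>2) * norm y \<le> 4 * norm (scaled_pencil_inverse z0 \<zeta> (F \<zeta>) y)"
      using ev by eventually_elim (use scaled_pencil_inverse_lower_bound z0 in blast)
  qed
  define k where "k = w * (1 - z0 * cnj z0)"
  have sq: "(cmod z0)\<^sup>2 < 1" using z0 by (simp add: abs_square_less_1)
  then have k: "k \<noteq> 0" using cmod_one_minus_mult_cnj[OF z0] w(2) unfolding k_def by (auto simp del: right_minus_eq)
  have TB: "scaled_pencil_inverse z0 w X (pencil z0 W w f) = k *\<^sub>C f" for f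
    unfolding k_def by (rule scaled_pencil_inverse_pencil[where X = X and W = W and \<zeta> = w and f = f, OF rel])
  have T_diff: "scaled_pencil_inverse z0 w X (x - y) = scaled_pencil_inverse z0 w X x - scaled_pencil_inverse z0 w X y" for x y
    by (simp add: scaled_pencil_inverse_def clinear_UNIV[OF Xlin] scaleC.diff_right)
  have T_inj: "x = y" if "scaled_pencil_inverse z0 w X x = scaled_pencil_inverse z0 w X y" for x y
  proof -
    have "(1 - (cmod z0)\<^sup>2) * norm (x - y) \<le> 0" using lower[of "x - y"] that by (simp add: T_diff)
    then show ?thesis using sq by (simp add: mult_le_0_iff)
  qed
  have "bij (pencil z0 W w)"
  proof (rule bijI)
    show "inj (pencil z0 W w)"
    proof (rule injI)
      fix f g assume "pencil z0 W w f = pencil z0 W w g"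
      then have "inverse k *\<^sub>C k *\<^sub>C f = inverse k *\<^sub>C k *\<^sub>C g" by (simp only: TB[symmetric])
      then show "f = g" by (simp only: scaleC_scaleC left_inverse[OF k] scaleC.scale_one)
    qed
    have "y = pencil z0 W w (inverse k *\<^sub>C scaled_pencil_inverse z0 w X y)" for y
      by (rule T_inj) (simp add: TB scaleC_scaleC k)
    then show "surj (pencil z0 W w)" by (rule surjI[OF sym])
  qed
  then show ?thesis using W rel by (simp add: mobius_resolvent_def)
qed

text \<open>Polarized form of \<open>2 Re \<langle>a, a - w b\<rangle> - |a - w b|\<^sup>2 = |a|\<^sup>2 - |b|\<^sup>2\<close>.\<close>

lemma circle_polarization:
  fixes a1 :: "'a::complex_inner"
  assumes "cmod w = 1"
  shows "cinner a1 (a2 - w *\<^sub>C b2) + cinner (a1 - w *\<^sub>C b1) a2 - cinner (a1 - w *\<^sub>C b1) (a2 - w *\<^sub>C b2) =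
    cinner a1 a2 - cinner b1 b2"
proof -
  have "w * cnj w = 1" using complex_norm_square[of w] assms by simp
  then have "cnj w * (w * c) = c" for c by (metis mult.assoc mult.commute mult_1)
  then show ?thesis by (simp only: cinner_simps right_diff_distrib) simp
qed

text \<open>Write \<open>x = a - w b\<close> with \<open>a = f + z0 W f = X x\<close> and \<open>b = W f + cnj z0 f\<close>. By
  \<open>circle_polarization\<close> the defect of \<open>X + X\<^sup>* = 1\<close> at \<open>x\<close> is \<open>|a|\<^sup>2 - |b|\<^sup>2\<close>, which by
  \<open>mobius_cinner\<close> is a positive multiple of \<open>|f|\<^sup>2 - |W f|\<^sup>2\<close>.\<close>

lemma mobius_resolvent_isometric_iff:
  assumes X: "mobius_resolvent z0 w X W" and z0: "cmod z0 < 1" and w: "cmod w = 1"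
  shows "isometric_on UNIV W \<longleftrightarrow> (\<forall>x y. cinner (X x) y + cinner x (X y) = cinner x y)"
proof
  assume iso: "isometric_on UNIV W"
  show "\<forall>x y. cinner (X x) y + cinner x (X y) = cinner x y"
  proof (intro allI)
    fix x y
    obtain f g where fg: "x = pencil z0 W w f" "y = pencil z0 W w g" using mobius_resolventD(6)[OF X] by blast
    have "cinner (X x) y + cinner x (X y) - cinner x y =
        cinner (f + z0 *\<^sub>C W f) (g + z0 *\<^sub>C W g) - cinner (W f + cnj z0 *\<^sub>C f) (W g + cnj z0 *\<^sub>C g)"
      unfolding fg mobius_resolventD(5)[OF X] unfolding pencil_eq by (rule circle_polarization[OF w])
    also have "\<dots> = 0"
      unfolding mobius_cinner by (simp add: isometric_on_cinner[OF iso])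
    finally show "cinner (X x) y + cinner x (X y) = cinner x y" by simp
  qed
next
  assume sym: "\<forall>x y. cinner (X x) y + cinner x (X y) = cinner x y"
  have "norm (W f) = norm f" for f
  proof -
    let ?x = "pencil z0 W w f"
    have "cinner (X ?x) ?x + cinner ?x (X ?x) - cinner ?x ?x =
        cinner (f + z0 *\<^sub>C W f) (f + z0 *\<^sub>C W f) - cinner (W f + cnj z0 *\<^sub>C f) (W f + cnj z0 *\<^sub>C f)"
      unfolding mobius_resolventD(5)[OF X] unfolding pencil_eq by (rule circle_polarization[OF w])
    then have "(1 - z0 * cnj z0) * (cinner f f - cinner (W f) (W f)) = 0"
      unfolding mobius_cinner using sym by simp
    moreover have "1 - z0 * cnj z0 \<noteq> 0"
      using cmod_one_minus_mult_cnj[OF z0] z0 abs_square_less_1[of "cmod z0"] by auto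
    ultimately have "cinner f f = cinner (W f) (W f)" by simp
    then have "(norm f)\<^sup>2 = (norm (W f))\<^sup>2" by (simp only: cinner_self of_real_eq_iff)
    then show ?thesis by (simp add: power2_eq_iff_nonneg)
  qed
  then show "isometric_on UNIV W" using mobius_resolventD(1)[OF X] by (simp add: isometric_on_def)
qed

text \<open>The operator \<open>1 - X\<close> is an everywhere defined adjoint of \<open>X\<close>.\<close>

lemma mobius_resolvent_bounded:
  fixes X :: "'a::{complex_inner,complete_space} \<Rightarrow> 'a"
  assumes X: "mobius_resolvent z0 w X W" and z0: "cmod z0 < 1" and w: "cmod w = 1"
    and iso: "isometric_on UNIV W"
  shows "\<exists>K>0. \<forall>x. norm (X x) \<le> K * norm x"
proof -
  have sym: "cinner (X x) y + cinner x (X y) = cinner x y" for x y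
    using mobius_resolvent_isometric_iff[OF X z0 w] iso by blast
  have "cinner (X x) y = cinner x (y - X y)" for x y
    using sym[of x y] by (simp add: cinner.diff_right algebra_simps)
  from bounded_of_adjoint[OF mobius_resolvent_linear[OF X] this]
  obtain K where K: "\<And>x. norm (X x) \<le> K * norm x" by blast
  have "norm (X x) \<le> max K 1 * norm x" for x
    using K[of x] mult_right_mono[of K "max K 1" "norm x"] by simp
  then show ?thesis by (intro exI[of _ "max K 1"]) auto
qed

text \<open>As \<open>X\<close> is bounded, \<open>X B\<^sub>w = 1 + z0 W\<close> shows that \<open>B\<^sub>w\<close> is bounded below. The pencils \<open>B\<^sub>\<zeta>\<close>
  converge to \<open>B\<^sub>w\<close> in norm, so they are bounded below uniformly, and the operators \<open>F \<zeta>\<close> are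
  uniformly bounded. On \<open>x = B\<^sub>w f\<close> the difference \<open>F \<zeta> x - X x\<close> equals
  \<open>F \<zeta> (B\<^sub>w f - B\<^sub>\<zeta> f) + z0 (W\<^sub>\<zeta> f - W f)\<close>.\<close>

lemma mobius_resolvent_continuous:
  fixes X :: "'a::{complex_inner,complete_space} \<Rightarrow> 'a"
  assumes X: "mobius_resolvent z0 w X W" and z0: "cmod z0 < 1" and w: "cmod w = 1"
    and iso: "isometric_on UNIV W"
    and ev: "\<forall>\<^sub>F \<zeta> in L. mobius_resolvent z0 \<zeta> (F \<zeta>) (Wf \<zeta>) \<and> cmod \<zeta> \<le> 1"
    and wL: "((\<lambda>\<zeta>. \<zeta>) \<longlongrightarrow> w) L" and Wf: "op_tendsto UNIV Wf W L"
  shows "op_tendsto UNIV F X L"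
  unfolding op_tendsto_def
proof (intro allI impI)
  fix e :: real assume e: "e > 0"
  obtain K where K: "K > 0" "\<And>x. norm (X x) \<le> K * norm x"
    using mobius_resolvent_bounded[OF X z0 w iso] by blast
  \<comment> \<open>A lower bound for \<open>pencil z0 W w\<close>, since \<open>1 + z0 W\<close> is bounded below by \<open>1 - |z0|\<close>.\<close>
  define m where "m = (1 - cmod z0) / K"
  have m: "m > 0" using K z0 by (simp add: m_def)
  have lower: "m * norm f \<le> norm (pencil z0 W w f)" for f
  proof -
    have "(1 - cmod z0) * norm f \<le> norm f - norm (z0 *\<^sub>C W f)"
      using mult_left_mono[OF mobius_resolventD(2)[OF X, of f], of "cmod z0"] by (simp add: left_diff_distrib)
    also have "\<dots> \<le> norm (f + z0 *\<^sub>C W f)" using norm_diff_ineq by blast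
    also have "\<dots> \<le> K * norm (pencil z0 W w f)"
      using K(2)[of "pencil z0 W w f"] by (simp add: mobius_resolventD(5)[OF X])
    finally show ?thesis using K(1) by (simp add: m_def field_simps)
  qed
  \<comment> \<open>If \<open>W\<^sub>\<zeta>\<close> and \<open>\<zeta>\<close> are within \<open>d \<le> m / 8\<close> of their limits, the pencil changes by at most
    \<open>4 d \<le> m / 2\<close>, and the total error is at most \<open>c d\<close>.\<close>
  define c where "c = (16 / m + 1) / m"
  have c: "c > 0" using m by (simp add: c_def add_pos_pos)
  define d where "d = min (m / 8) (e / c)"
  have d: "d > 0" "d \<le> m / 8" "d \<le> e / c"
    using m e c by (simp_all only: d_def min.cobounded1 min.cobounded2) simp
  have "\<forall>\<^sub>F \<zeta> in L. dist \<zeta> w < d" using wL d(1) by (rule tendstoD)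
  with ev op_tendstoD[OF Wf d(1)]
  show "\<forall>\<^sub>F \<zeta> in L. \<forall>x\<in>UNIV. norm (F \<zeta> x - X x) \<le> e * norm x"
  proof eventually_elim
    case (elim \<zeta>)
    then have F: "mobius_resolvent z0 \<zeta> (F \<zeta>) (Wf \<zeta>)" and \<zeta>: "cmod \<zeta> \<le> 1"
      and Wd: "\<And>f. norm (Wf \<zeta> f - W f) \<le> d * norm f" and \<zeta>w: "cmod (\<zeta> - w) \<le> d"
      by (auto simp: dist_norm)
    note lin = clinear_UNIV[OF mobius_resolvent_linear[OF F]]
    have Bd: "norm (pencil z0 (Wf \<zeta>) \<zeta> f - pencil z0 W w f) \<le> 4 * d * norm f" for f
    proof -
      let ?g = "cnj z0 *\<^sub>C f + W f"
      have "norm ?g \<le> cmod z0 * norm f + norm (W f)" using norm_triangle_ineq[of "cnj z0 *\<^sub>C f" "W f"] by simp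
      also have "\<dots> \<le> 1 * norm f + norm f"
        using z0 by (intro add_mono mult_right_mono mobius_resolventD(2)[OF X]) auto
      finally have g: "norm ?g \<le> 2 * norm f" by simp
      have "cmod (\<zeta> - z0) \<le> 2" using norm_triangle_ineq4[of \<zeta> z0] z0 \<zeta> by simp
      have "norm (pencil z0 (Wf \<zeta>) \<zeta> f - pencil z0 W w f) \<le>
          cmod (\<zeta> - w) * norm ?g + cmod (\<zeta> - z0) * norm (Wf \<zeta> f - W f)"
        unfolding pencil_diff
        using norm_triangle_ineq4[of "- ((\<zeta> - w) *\<^sub>C ?g)" "(\<zeta> - z0) *\<^sub>C (Wf \<zeta> f - W f)"]
        by (simp del: scaleC.scale_right_diff_distrib)
      also have "\<dots> \<le> d * (2 * norm f) + 2 * (d * norm f)"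
        using d(1) by (intro add_mono mult_mono g Wd \<zeta>w \<open>cmod (\<zeta> - z0) \<le> 2\<close>) auto
      finally show ?thesis by simp
    qed
    have F_bound: "norm (F \<zeta> y) \<le> 4 / m * norm y" for y
    proof -
      obtain f where f: "y = pencil z0 (Wf \<zeta>) \<zeta> f" using mobius_resolventD(6)[OF F] by blast
      have "m * norm f - norm y \<le> 4 * d * norm f"
        using lower[of f] norm_triangle_ineq2[of "pencil z0 W w f" y] Bd[of f]
        by (simp add: f norm_minus_commute)
      also have "\<dots> \<le> m / 2 * norm f" using d(2) by (intro mult_right_mono) auto
      finally have "norm f \<le> 2 / m * norm y" using m by (simp add: field_simps)
      moreover have "norm (F \<zeta> y) \<le> 2 * norm f"
      proof -
        have "norm (F \<zeta> y) \<le> norm f + cmod z0 * norm (Wf \<zeta> f)"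
          using norm_triangle_ineq[of f "z0 *\<^sub>C Wf \<zeta> f"] by (simp add: f mobius_resolventD(5)[OF F])
        also have "cmod z0 * norm (Wf \<zeta> f) \<le> 1 * norm f"
          using z0 by (intro mult_mono mobius_resolventD(2)[OF F]) auto
        finally show ?thesis by simp
      qed
      ultimately show ?thesis by simp
    qed
    show ?case
    proof
      fix x
      obtain f where f: "x = pencil z0 W w f" using mobius_resolventD(6)[OF X] by blast
      let ?B = "pencil z0 (Wf \<zeta>) \<zeta> f"
      have "F \<zeta> x - X x = F \<zeta> (x - ?B) + z0 *\<^sub>C (Wf \<zeta> f - W f)"
        by (simp add: lin f mobius_resolventD(5)[OF X] mobius_resolventD(5)[OF F] scaleC.diff_right)
      then have "norm (F \<zeta> x - X x) \<le> norm (F \<zeta> (x - ?B)) + cmod z0 * norm (Wf \<zeta> f - W f)"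
        using norm_triangle_ineq[of "F \<zeta> (x - ?B)" "z0 *\<^sub>C (Wf \<zeta> f - W f)"]
        by (simp del: scaleC.scale_right_diff_distrib)
      also have "norm (F \<zeta> (x - ?B)) \<le> 4 / m * (4 * d * norm f)"
        using Bd[of f] m
        by (intro order_trans[OF F_bound] mult_left_mono) (auto simp: f norm_minus_commute)
      also have "cmod z0 * norm (Wf \<zeta> f - W f) \<le> 1 * (d * norm f)"
        using z0 by (intro mult_mono Wd) auto
      finally have "norm (F \<zeta> x - X x) \<le> (16 / m + 1) * d * norm f" by (simp add: algebra_simps)
      also have "\<dots> \<le> (16 / m + 1) * d * (norm x / m)"
        using lower[of f] m d(1) by (intro mult_left_mono) (auto simp: f field_simps)
      also have "\<dots> = (c * d) * norm x" by (simp add: c_def)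
      also have "\<dots> \<le> e * norm x"
        using d(3) c by (intro mult_right_mono) (auto simp: field_simps)
      finally show "norm (F \<zeta> x - X x) \<le> e * norm x" .
    qed
  qed
qed

section \<open>Boundary behaviour of the parameter and of the resolvent\<close>

lemma tendsto_circle_reflection:
  assumes w: "cmod w = 1" and ST: "\<And>z. z \<in> S \<Longrightarrow> z \<noteq> 0 \<Longrightarrow> inverse (cnj z) \<in> T"
  shows "filterlim (\<lambda>z. inverse (cnj z)) (at w within T) (at w within S)"
proof -
  have w0: "w \<noteq> 0" and ww: "inverse (cnj w) = w"
    using w complex_norm_square[of w] by (auto simp: inverse_eq_divide divide_eq_eq)
  have "((\<lambda>z. inverse (cnj z)) \<longlongrightarrow> inverse (cnj w)) (at w within S)"
    using w0 by (intro tendsto_intros) auto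
  moreover have "\<forall>\<^sub>F z in at w within S. inverse (cnj z) \<in> T \<and> inverse (cnj z) \<noteq> w"
  proof -
    have "\<forall>\<^sub>F z in at w within S. z \<noteq> 0"
      using w0 by (intro tendsto_imp_eventually_ne[OF tendsto_ident_at]) auto
    moreover have "\<forall>\<^sub>F z in at w within S. z \<noteq> w \<and> z \<in> S" by (simp add: eventually_at_filter)
    ultimately show ?thesis
    proof eventually_elim
      case (elim z)
      have "inverse (cnj z) \<noteq> w"
      proof
        assume "inverse (cnj z) = w"
        then have "cnj z = inverse w" by (metis inverse_inverse_eq)
        also have "\<dots> = cnj (inverse (cnj w))" by simp
        finally show False using elim(2) by (simp add: ww)
      qed
      with ST[of z] elim show ?case by simp
    qed
  qed
  ultimately show ?thesis by (simp add: filterlim_at ww)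
qed

lemma at_circle_within_disc: "cmod w = 1 \<Longrightarrow> at w within disc \<noteq> bot"
  by (simp add: trivial_limit_within islimpt_ball)

context
  fixes D :: "'a::separable_chilbert set" and V :: "'a \<Rightarrow> 'a"
    and J :: "'a \<Rightarrow> 'b::separable_chilbert" and U :: "'b \<Rightarrow> 'b"
    and R C :: "complex \<Rightarrow> 'a \<Rightarrow> 'a" and z0 :: complex
  assumes iso: "closed_isometric D V" and z0: "z0 \<in> disc - {0}"
    and gr: "is_generalized_resolvent D V J U R" and inin: "inin_corresponds D V z0 R C"
begin

private abbreviation (input) "N \<equiv> N_space D V z0"
private abbreviation (input) "N' \<equiv> N_space D V (1 / cnj z0)"

private lemma z0_less: "cmod z0 < 1" using z0 by simp

private lemma C:
  "op_analytic_on N disc C" "z \<in> disc \<Longrightarrow> contraction_on N (C z)" "z \<in> disc \<Longrightarrow> C z ` N \<subseteq> N'"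
  using inin by (auto simp: inin_corresponds_def schur_class_def)

private lemma N0: "0 \<in> N" using csubspaceD(1)[OF N_space_subspace[OF iso z0]] .

private lemma R_mobius:
  assumes "z \<in> disc" shows "mobius_resolvent z0 z (R z) (V_plus D V z0 (C z))"
proof -
  have W: "contraction_on UNIV (V_plus D V z0 (C z))"
    by (intro V_plus_contraction[OF iso z0] C assms)
  have "R z = inv (\<lambda>x. x - z *\<^sub>C V_ext D V z0 (C z) x)"
    using inin assms by (simp add: inin_corresponds_def)
  then show ?thesis
    using mobius_resolvent_V_ext[OF W z0_less pencil_bij_disc[OF W z0_less]] assms by simp
qed

text \<open>Norm convergence of the resolvent at a boundary point forces norm convergence of the parameter, by
  \<open>mobius_resolvent_parameter_diff\<close>.\<close>

lemma parameter_boundary_limit: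
  assumes w: "cmod w = 1" and X: "bounded_clinear_on UNIV X" and lim: "op_tendsto UNIV R X (at w within disc)"
  shows "\<exists>G. clinear_on N G \<and> op_tendsto N C G (at w within disc)"
proof (rule op_tendsto_of_cauchy[OF N_space_subspace[OF iso z0] at_circle_within_disc[OF w]])
  show "\<forall>\<^sub>F z in at w within disc. clinear_on N (C z)"
    using eventually_mem_at_within by eventually_elim (use C(2) in \<open>simp add: contraction_on_def\<close>)
  fix e :: real assume e: "e > 0"
  obtain K where K: "\<And>x. norm (X x) \<le> K * norm x" using bounded_clinear_on_bound[OF X] by auto
  define B where "B = \<bar>K\<bar> + 1"
  have B: "B > 0" by (simp add: B_def)
  define \<kappa> where "\<kappa> = 1 - (cmod z0)\<^sup>2"
  have \<kappa>: "\<kappa> > 0" using z0_less by (simp add: \<kappa>_def abs_square_less_1)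
  \<comment> \<open>The estimate below is \<open>|u| \<kappa> |C u x - C v x| \<le> (32 + 16 B) d |x|\<close>, where \<open>|u| > 1/2\<close>.\<close>
  define d where "d = min 1 (e * \<kappa> / (2 * (32 + 16 * B)))"
  have d: "d > 0" "d \<le> 1" "d \<le> e * \<kappa> / (2 * (32 + 16 * B))"
    using e \<kappa> B by (simp_all only: d_def min.cobounded1 min.cobounded2) simp
  \<comment> \<open>Where \<open>P\<close> holds, \<open>R\<close> has norm at most \<open>B\<close> and varies by at most \<open>2 d\<close>.\<close>
  define P where "P z \<longleftrightarrow> z \<in> disc \<and> cmod z > 1 / 2 \<and> dist z w < d \<and> (\<forall>x. norm (R z x - X x) \<le> d * norm x)" for z
  have "eventually P (at w within disc)"
  proof -
    have "((\<lambda>z. cmod z) \<longlongrightarrow> cmod w) (at w within disc)" by (intro tendsto_intros)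
    then have "\<forall>\<^sub>F z in at w within disc. cmod z > 1 / 2"
      by (rule order_tendstoD(1)) (simp add: w)
    moreover have "\<forall>\<^sub>F z in at w within disc. dist z w < d"
      using tendsto_ident_at d(1) by (rule tendstoD)
    ultimately show ?thesis
      using op_tendstoD[OF lim d(1)] eventually_mem_at_within
      by eventually_elim (auto simp: P_def)
  qed
  moreover have "norm (C u x - C v x) \<le> e * norm x" if P: "P u" "P v" and x: "x \<in> N" for u v x
  proof -
    have uv: "u \<in> disc" "v \<in> disc" and near: "dist u w < d" "dist v w < d" and half: "cmod u > 1 / 2"
      and Ru: "\<And>x. norm (R u x - X x) \<le> d * norm x" and Rv: "\<And>x. norm (R v x - X x) \<le> d * norm x"
      using P by (auto simp: P_def)
    have "norm (R u y - R v y) \<le> (2 * d) * norm y" for y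
      using norm_triangle_ineq4[of "R u y - X y" "R v y - X y"] Ru[of y] Rv[of y] by simp
    moreover have "norm (R u y) \<le> B * norm y" for y
    proof -
      have "norm (R u y) \<le> norm (X y) + norm (R u y - X y)" by (rule norm_triangle_sub)
      also have "\<dots> \<le> \<bar>K\<bar> * norm y + 1 * norm y"
        using order_trans[OF K mult_right_mono[OF abs_ge_self]] order_trans[OF Ru mult_right_mono[OF d(2)]]
        by (intro add_mono) auto
      finally show ?thesis by (simp add: B_def distrib_right)
    qed
    ultimately have "cmod u * \<kappa> * norm (V_plus D V z0 (C u) x - V_plus D V z0 (C v) x) \<le>
        4 * (4 * (2 * d) + 2 * B * cmod (u - v)) * norm x"
      unfolding \<kappa>_def using uv d(1) B z0_less
      by (intro mobius_resolvent_parameter_diff[OF R_mobius R_mobius]) auto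
    also have "\<dots> \<le> 4 * (4 * (2 * d) + 2 * B * (2 * d)) * norm x"
      using dist_triangle_less_add[OF near(1), of v d] near(2) B
      by (intro mult_right_mono mult_left_mono add_left_mono) (auto simp: dist_norm norm_minus_commute)
    also have "\<dots> = (32 + 16 * B) * d * norm x" by (simp add: algebra_simps)
    also have "\<dots> \<le> (e * \<kappa> / 2) * norm x"
      using d(3) B by (intro mult_right_mono) (auto simp: field_simps)
    finally have "cmod u * \<kappa> * norm (C u x - C v x) \<le> (e * \<kappa> / 2) * norm x"
      by (simp add: V_plus_on_N[OF iso z0 x])
    moreover have "1 / 2 * \<kappa> * norm (C u x - C v x) \<le> cmod u * \<kappa> * norm (C u x - C v x)"
      using half \<kappa> by (intro mult_right_mono) auto
    ultimately have "\<kappa> * norm (C u x - C v x) \<le> \<kappa> * (e * norm x)" by (simp add: mult_ac)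
    then show ?thesis using \<kappa> by simp
  qed
  ultimately show "\<exists>P. eventually P (at w within disc) \<and>
      (\<forall>v w. P v \<and> P w \<longrightarrow> (\<forall>x\<in>N. norm (C v x - C w x) \<le> e * norm x))"
    by blast
qed

text \<open>The two one-sided limits of the resolvent agree, so the reflection law
  \<open>R\<^sub>\<zeta>\<^sup>* + R\<^bsub>1/cnj \<zeta>\<^esub> = 1\<close> becomes \<open>X\<^sup>* + X = 1\<close> at the boundary point.\<close>

lemma parameter_boundary_value:
  assumes w: "cmod w = 1" and X: "bounded_clinear_on UNIV X" and lim: "op_tendsto UNIV R X (at w within disc)"
    and lim': "\<And>x. ((\<lambda>z. R z x) \<longlongrightarrow> X x) (at w within ext_disc)"
    and G: "clinear_on N G" "op_tendsto N C G (at w within disc)"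
  shows "isometric_on N G" "G ` N = N'" "bij (\<lambda>x. x - w *\<^sub>C V_ext D V z0 G x)"
proof -
  let ?L = "at w within disc" and ?W = "V_plus D V z0 G"
  note L = at_circle_within_disc[OF w]
  have Glim: "((\<lambda>z. C z x) \<longlongrightarrow> G x) ?L" if "x \<in> N" for x
    using op_tendsto_pointwise[OF G(2) that] .
  have contr: "contraction_on N G"
    unfolding contraction_on_def
  proof (intro conjI ballI G(1))
    fix x assume x: "x \<in> N"
    show "norm (G x) \<le> norm x"
    proof (rule tendsto_upperbound[OF tendsto_norm[OF Glim[OF x]] _ L])
      show "\<forall>\<^sub>F z in ?L. norm (C z x) \<le> norm x"
        using eventually_mem_at_within by eventually_elim (use C(2) x in \<open>auto simp: contraction_on_def\<close>)
    qed
  qed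
  have range: "G ` N \<subseteq> N'"
  proof
    fix y assume "y \<in> G ` N"
    then obtain x where x: "x \<in> N" "y = G x" by blast
    show "y \<in> N'"
      unfolding x(2)
    proof (rule Lim_in_closed_set[OF N_space_closed[OF iso z0] _ L Glim[OF x(1)]])
      show "\<forall>\<^sub>F z in ?L. C z x \<in> N'"
        using eventually_mem_at_within by eventually_elim (use C(3) x in blast)
    qed
  qed
  have W: "contraction_on UNIV ?W" by (rule V_plus_contraction[OF iso z0 contr range])
  have mr: "mobius_resolvent z0 w X ?W"
  proof (rule mobius_resolvent_limit[OF L _ tendsto_ident_at w z0_less lim X _ W])
    show "\<forall>\<^sub>F z in ?L. mobius_resolvent z0 z (R z) (V_plus D V z0 (C z)) \<and> cmod z \<le> 1"
      using eventually_mem_at_within by eventually_elim (use R_mobius in auto)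
    show "((\<lambda>z. V_plus D V z0 (C z) f) \<longlongrightarrow> ?W f) ?L" for f
      unfolding V_plus_def by (intro tendsto_intros Glim N_proj(1)[OF iso z0])
  qed
  then show "bij (\<lambda>x. x - w *\<^sub>C V_ext D V z0 G x)"
    using V_ext_bij_iff[OF W z0_less] mobius_resolventD(4) by blast
  have "cinner (X x) y + cinner x (X y) = cinner x y" for x y
  proof (rule tendsto_unique[OF L])
    have "((\<lambda>z. R (inverse (cnj z)) y) \<longlongrightarrow> X y) ?L"
      by (rule filterlim_compose[OF lim' tendsto_circle_reflection[OF w]])
        (auto simp: norm_inverse one_less_inverse_iff)
    then show "((\<lambda>z. cinner (R z x) y + cinner x (R (inverse (cnj z)) y)) \<longlongrightarrow>
        cinner (X x) y + cinner x (X y)) ?L"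
      by (intro tendsto_add cinner.tendsto tendsto_const op_tendsto_pointwise[OF lim]) auto
    have "\<forall>\<^sub>F z in ?L. z \<noteq> 0"
      using w by (intro tendsto_imp_eventually_ne[OF tendsto_ident_at]) auto
    with eventually_mem_at_within
    have "\<forall>\<^sub>F z in ?L. cinner x y = cinner (R z x) y + cinner x (R (inverse (cnj z)) y)"
      by eventually_elim (use generalized_resolvent_symmetry[OF gr] in auto)
    then show "((\<lambda>z. cinner (R z x) y + cinner x (R (inverse (cnj z)) y)) \<longlongrightarrow> cinner x y) ?L"
      by (rule Lim_transform_eventually[OF tendsto_const])
  qed
  then have Wiso: "isometric_on UNIV ?W" using mobius_resolvent_isometric_iff[OF mr z0_less w] by blast
  have "norm (G x) = norm x" if "x \<in> N" for x
    using Wiso V_plus_on_N[OF iso z0 that, of G] by (auto simp: isometric_on_def dest: spec[of _ x])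
  then show "isometric_on N G" using G(1) by (simp add: isometric_on_def)
  have "surj ?W"
    using mobius_resolventD(4)[OF mr] by (intro pencil_isometry_surjective[OF Wiso z0_less w] bij_is_surj)
  then show "G ` N = N'" by (rule V_plus_surj_imp_onto[OF iso z0 range])
qed

text \<open>On the arc the extension is the boundary limit from inside the disc. Continuity along the arc is
  inherited: an estimate that holds at all points of the disc near \<open>z\<close> holds at their limits on the
  arc.\<close>

lemma parameter_extension:
  assumes \<Delta>: "open_arc \<Delta>" and F: "op_analytic_on UNIV (disc \<union> ext_disc \<union> \<Delta>) F"
    and FR: "\<And>z. z \<in> disc \<union> ext_disc \<Longrightarrow> F z = R z"
  shows "\<exists>G. (\<forall>z\<in>disc. \<forall>x\<in>N. G z x = C z x) \<and> op_continuous_on N (disc \<union> \<Delta>) G \<and>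
    (\<forall>w\<in>\<Delta>. isometric_on N (G w) \<and> G w ` N = N') \<and>
    (\<forall>w\<in>\<Delta>. bij (\<lambda>x. x - w *\<^sub>C V_ext D V z0 (G w) x))"
proof -
  let ?\<Omega> = "disc \<union> ext_disc \<union> \<Delta>"
  have circle: "cmod w = 1" if "w \<in> \<Delta>" for w using open_arc_subset_circle[OF \<Delta>] that by auto
  have Fw: "bounded_clinear_on UNIV (F w)" if "w \<in> \<Delta>" for w
    using F that by (auto simp: op_analytic_on_def)
  have lim: "op_tendsto UNIV R (F w) (at w within A)" if "w \<in> \<Delta>" "A \<subseteq> disc \<union> ext_disc" for w A
  proof (rule op_tendsto_cong)
    have "op_tendsto UNIV F (F w) (at w within ?\<Omega>)" using that by (intro op_analytic_tendsto[OF _ F]) auto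
    then show "op_tendsto UNIV F (F w) (at w within A)"
      by (rule op_tendsto_mono) (use that(2) in \<open>intro at_le, auto\<close>)
    show "\<forall>\<^sub>F z in at w within A. \<forall>x\<in>UNIV. F z x = R z x"
      using eventually_mem_at_within by eventually_elim (use FR that(2) in auto)
  qed simp
  have "\<exists>G. clinear_on N G \<and> op_tendsto N C G (at w within disc)" if "w \<in> \<Delta>" for w
    using that by (intro parameter_boundary_limit[OF circle Fw lim]) auto
  then obtain G0 where G0: "\<And>w. w \<in> \<Delta> \<Longrightarrow> clinear_on N (G0 w)"
      "\<And>w. w \<in> \<Delta> \<Longrightarrow> op_tendsto N C (G0 w) (at w within disc)"
    by metis
  have G0': "isometric_on N (G0 w)" "G0 w ` N = N'" "bij (\<lambda>x. x - w *\<^sub>C V_ext D V z0 (G0 w) x)"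
    if w: "w \<in> \<Delta>" for w
  proof -
    have l1: "op_tendsto UNIV R (F w) (at w within disc)" using w by (intro lim) auto
    have l2: "((\<lambda>z. R z x) \<longlongrightarrow> F w x) (at w within ext_disc)" for x
      using w by (intro op_tendsto_pointwise[OF lim]) auto
    note * = parameter_boundary_value[OF circle[OF w] Fw[OF w] l1 l2 G0[OF w]]
    show "isometric_on N (G0 w)" "G0 w ` N = N'" "bij (\<lambda>x. x - w *\<^sub>C V_ext D V z0 (G0 w) x)"
      by (fact *)+
  qed
  define G where "G z = (if z \<in> disc then C z else G0 z)" for z
  have G\<Delta>: "G w = G0 w" if "w \<in> \<Delta>" for w using circle[OF that] by (simp add: G_def)
  have "op_tendsto N G (G z) (at z within (disc \<union> \<Delta>))" if z: "z \<in> disc \<union> \<Delta>" for z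
  proof (cases "z \<in> disc")
    case True
    have "op_tendsto N C (C z) (at z within disc)" by (rule op_analytic_tendsto[OF N0 C(1) True])
    then have "op_tendsto N C (C z) (at z)" using True by (simp add: at_within_open[OF True open_ball])
    then have "op_tendsto N C (C z) (at z within (disc \<union> \<Delta>))"
      by (rule op_tendsto_mono) (simp add: at_le)
    moreover have "\<forall>\<^sub>F v in at z within (disc \<union> \<Delta>). v \<in> disc"
      by (rule filter_leD[OF at_le[OF subset_UNIV] eventually_at_in_open'[OF open_ball True]])
    then have "\<forall>\<^sub>F v in at z within (disc \<union> \<Delta>). \<forall>x\<in>N. C v x = G v x"
      by eventually_elim (simp add: G_def)
    ultimately show ?thesis by (rule op_tendsto_cong) (use True in \<open>simp add: G_def\<close>)
  next
    case False
    then have z\<Delta>: "z \<in> \<Delta>" using z by simp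
    show ?thesis
      unfolding op_tendsto_def
    proof (intro allI impI)
      fix e :: real assume "e > 0"
      from op_tendstoD[OF G0(2)[OF z\<Delta>] this] obtain d where d: "d > 0"
          and near: "\<And>v x. v \<in> disc \<Longrightarrow> v \<noteq> z \<Longrightarrow> dist v z < d \<Longrightarrow> x \<in> N \<Longrightarrow> norm (C v x - G0 z x) \<le> e * norm x"
        by (auto simp: eventually_at)
      have "norm (G v x - G z x) \<le> e * norm x"
        if v: "v \<in> disc \<union> \<Delta>" "v \<noteq> z" "dist v z < d" and x: "x \<in> N" for v x
      proof (cases "v \<in> disc")
        case True
        then show ?thesis using near[OF True v(2,3) x] by (simp add: G\<Delta>[OF z\<Delta>]) (simp add: G_def)
      next
        case False
        then have v\<Delta>: "v \<in> \<Delta>" using v(1) by simp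
        have "norm (G0 v x - G0 z x) \<le> e * norm x"
        proof (rule tendsto_upperbound[OF _ _ at_circle_within_disc[OF circle[OF v\<Delta>]]])
          show "((\<lambda>u. norm (C u x - G0 z x)) \<longlongrightarrow> norm (G0 v x - G0 z x)) (at v within disc)"
            by (intro tendsto_intros op_tendsto_pointwise[OF G0(2)[OF v\<Delta>]] x)
          have "((\<lambda>u. dist u z) \<longlongrightarrow> dist v z) (at v within disc)" by (intro tendsto_intros)
          then have "\<forall>\<^sub>F u in at v within disc. dist u z < d" using v(3) by (rule order_tendstoD(2))
          with eventually_mem_at_within show "\<forall>\<^sub>F u in at v within disc. norm (C u x - G0 z x) \<le> e * norm x"
          proof eventually_elim
            case (elim u)
            then have "u \<noteq> z" using circle[OF z\<Delta>] by auto
            with elim near x show ?case by blast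
          qed
        qed
        then show ?thesis by (simp add: G\<Delta> z\<Delta> v\<Delta>)
      qed
      then show "\<forall>\<^sub>F v in at z within (disc \<union> \<Delta>). \<forall>x\<in>N. norm (G v x - G z x) \<le> e * norm x"
        using d by (auto simp: eventually_at)
    qed
  qed
  moreover have "bounded_clinear_on N (G z)" if "z \<in> disc \<union> \<Delta>" for z
  proof (cases "z \<in> disc")
    case True then show ?thesis using C(1) by (simp add: G_def op_analytic_on_def)
  next
    case False
    then have "isometric_on N (G z)" using that G0'(1)[of z] by (simp add: G_def)
    then show ?thesis by (auto simp: isometric_on_def bounded_clinear_on_def intro!: exI[of _ 1])
  qed
  ultimately have "op_continuous_on N (disc \<union> \<Delta>) G" by (simp add: op_continuous_on_iff[OF N0])
  then show ?thesis
    by (intro exI[of _ G]) (simp add: G\<Delta> G0', simp add: G_def)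
qed

text \<open>On the arc the continuation is given by Inin's formula with the boundary value of the parameter. It is
  norm continuous from inside because the parameter is, and from outside because both sides of the
  circle are linked by the reflection law.\<close>

lemma resolvent_continuation:
  assumes \<Delta>: "open_arc \<Delta>" and GC: "\<And>z x. z \<in> disc \<Longrightarrow> x \<in> N \<Longrightarrow> G z x = C z x"
    and G: "op_continuous_on N (disc \<union> \<Delta>) G"
    and G_iso: "\<And>w. w \<in> \<Delta> \<Longrightarrow> isometric_on N (G w)" and G_onto: "\<And>w. w \<in> \<Delta> \<Longrightarrow> G w ` N = N'"
    and G_bij: "\<And>w. w \<in> \<Delta> \<Longrightarrow> bij (\<lambda>x. x - w *\<^sub>C V_ext D V z0 (G w) x)"
  shows "\<exists>F. op_analytic_on UNIV (disc \<union> ext_disc \<union> \<Delta>) F \<and> (\<forall>z\<in>disc \<union> ext_disc. F z = R z)"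
proof -
  let ?\<Omega> = "disc \<union> ext_disc \<union> \<Delta>" and ?W = "\<lambda>z. V_plus D V z0 (G z)"
  have circle: "cmod w = 1" if "w \<in> \<Delta>" for w using open_arc_subset_circle[OF \<Delta>] that by auto
  note open\<Omega> = open_arc_domain[OF \<Delta>]
  have open_de: "open (disc \<union> ext_disc)"
    by (intro open_Un open_ball open_Collect_less continuous_intros)
  define F where "F z = (if z \<in> \<Delta> then inv (\<lambda>x. x - z *\<^sub>C V_ext D V z0 (G z) x) else R z)" for z
  have FR: "F z = R z" if "z \<in> disc \<union> ext_disc" for z using that circle[of z] by (auto simp: F_def)
  have W_iso: "isometric_on UNIV (?W w)" if "w \<in> \<Delta>" for w
    using that by (intro V_plus_isometric[OF iso z0] G_iso) (simp_all add: G_onto)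
  have mr: "mobius_resolvent z0 z (F z) (?W z)" if "z \<in> disc \<union> \<Delta>" for z
  proof (cases "z \<in> \<Delta>")
    case True
    have W: "contraction_on UNIV (?W z)" using W_iso[OF True] by (simp add: contraction_on_def isometric_on_def)
    show ?thesis
      using mobius_resolvent_V_ext[OF W z0_less] G_bij[OF True] True
      by (simp add: F_def V_ext_bij_iff[OF W z0_less])
  next
    case False
    then have z: "z \<in> disc" using that by simp
    have "?W z = V_plus D V z0 (C z)" by (rule V_plus_cong[OF iso z0]) (rule GC[OF z])
    then show ?thesis using R_mobius[OF z] FR[of z] z by simp
  qed
  have W_lim: "op_tendsto UNIV ?W (?W w) (at w within (disc \<union> \<Delta>))" if w: "w \<in> \<Delta>" for w
    unfolding op_tendsto_def
  proof (intro allI impI)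
    fix e :: real assume e: "e > 0"
    have "op_tendsto N G (G w) (at w within (disc \<union> \<Delta>))"
      using G w by (auto simp: op_continuous_on_iff[OF N0])
    from op_tendstoD[OF this e]
    show "\<forall>\<^sub>F z in at w within (disc \<union> \<Delta>). \<forall>x\<in>UNIV. norm (?W z x - ?W w x) \<le> e * norm x"
    proof eventually_elim
      case (elim z)
      show ?case
      proof
        fix x
        let ?n = "orth_proj N x"
        have "norm (?W z x - ?W w x) \<le> e * norm ?n"
          unfolding V_plus_diff[OF iso z0] using elim N_proj(1)[OF iso z0] by blast
        also have "norm ?n \<le> norm x"
          by (intro norm_orth_proj_le N_space_subspace[OF iso z0] N_space_closed[OF iso z0])
        finally show "norm (?W z x - ?W w x) \<le> e * norm x" using e by (simp add: mult_left_mono)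
      qed
    qed
  qed
  have F_lim_inside: "op_tendsto UNIV F (F w) (at w within (disc \<union> \<Delta>))" if w: "w \<in> \<Delta>" for w
  proof (rule mobius_resolvent_continuous[OF mr z0_less circle[OF w] W_iso[OF w] _ tendsto_ident_at W_lim[OF w]])
    show "\<forall>\<^sub>F z in at w within (disc \<union> \<Delta>). mobius_resolvent z0 z (F z) (?W z) \<and> cmod z \<le> 1"
      using eventually_mem_at_within by eventually_elim (use mr circle in force)
  qed (use w in simp)
  have F_sym: "cinner (F w x) y + cinner x (F w y) = cinner x y" if w: "w \<in> \<Delta>" for w x y
    using mobius_resolvent_isometric_iff[OF mr z0_less circle[OF w]] W_iso[OF w] w by blast
  have F_lim_outside: "op_tendsto UNIV F (F w) (at w within ext_disc)" if w: "w \<in> \<Delta>" for w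
    unfolding op_tendsto_def
  proof (intro allI impI)
    fix e :: real assume e: "e > 0"
    have "filterlim (\<lambda>z. inverse (cnj z)) (at w within (disc \<union> \<Delta>)) (at w within ext_disc)"
      by (rule tendsto_circle_reflection[OF circle[OF w]]) (auto simp: norm_inverse inverse_less_1_iff)
    with op_tendstoD[OF F_lim_inside[OF w] e]
    have "\<forall>\<^sub>F z in at w within ext_disc. \<forall>x\<in>UNIV. norm (F (inverse (cnj z)) x - F w x) \<le> e * norm x"
      by (auto simp: filterlim_iff)
    with eventually_mem_at_within
    show "\<forall>\<^sub>F z in at w within ext_disc. \<forall>x\<in>UNIV. norm (F z x - F w x) \<le> e * norm x"
    proof eventually_elim
      case (elim z)
      have z: "z \<in> disc \<union> ext_disc" "z \<noteq> 0" using elim(1) by auto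
      have z': "inverse (cnj z) \<in> disc \<union> ext_disc"
        using elim(1) by (auto simp: norm_inverse inverse_less_1_iff)
      show ?case
      proof
        fix x
        show "norm (F z x - F w x) \<le> e * norm x"
        proof (rule norm_le_of_cinner_bound)
          fix y
          have "cinner (F z x - F w x) y = cinner x (F w y - F (inverse (cnj z)) y)"
            using generalized_resolvent_symmetry[OF gr z, of x y] F_sym[OF w, of x y]
            by (simp add: FR[OF z(1)] FR[OF z'] cinner_simps algebra_simps)
          then have "cmod (cinner (F z x - F w x) y) \<le> norm x * norm (F w y - F (inverse (cnj z)) y)"
            by (simp add: cinner_cauchy_schwarz)
          also have "\<dots> \<le> norm x * (e * norm y)"
            using elim(2) by (intro mult_left_mono) (auto simp: norm_minus_commute)
          finally show "cmod (cinner (F z x - F w x) y) \<le> e * norm x * norm y" by (simp add: mult_ac)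
        qed (use e in simp)
      qed
    qed
  qed
  have F_lim: "op_tendsto UNIV F (F w) (at w)" if w: "w \<in> \<Delta>" for w
  proof -
    have "op_tendsto UNIV F (F w) (at w within ((disc \<union> \<Delta>) \<union> ext_disc))"
      by (rule op_tendsto_at_union[OF F_lim_inside[OF w] F_lim_outside[OF w]])
    moreover have "(disc \<union> \<Delta>) \<union> ext_disc = ?\<Omega>" by blast
    ultimately show ?thesis using at_within_open[OF _ open\<Omega>, of w] w by simp
  qed
  have F_bound: "\<exists>K. \<forall>x. norm (F w x) \<le> K * norm x" if w: "w \<in> \<Delta>" for w
    using mobius_resolvent_bounded[OF mr z0_less circle[OF w] W_iso[OF w]] w by auto
  have R_bound: "norm (F z x) \<le> inverse \<bar>1 - cmod z\<bar> * norm x" if "z \<in> disc \<union> ext_disc" for z x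
    using generalized_resolvent_weak(2)[OF gr that, of x] by (simp add: FR[OF that] divide_inverse mult.commute)
  have hol: "(\<lambda>z. cinner (F z x) y) holomorphic_on (disc \<union> ext_disc)" for x y
    by (rule holomorphic_transform[OF generalized_resolvent_weakly_holomorphic[OF gr, of x y]]) (simp only: FR)
  have "op_analytic_on UNIV ?\<Omega> F"
  proof (rule op_analytic_of_weakly_holomorphic[OF open\<Omega>])
    show "clinear_on UNIV (F z)" if "z \<in> ?\<Omega>" for z
      using that mobius_resolvent_linear[OF mr[of z]] generalized_resolvent_linear[OF gr, of z] FR[of z] by auto
    show "\<exists>K. \<forall>x. norm (F z x) \<le> K * norm x" if "z \<in> ?\<Omega>" for z
      using that F_bound R_bound by blast
    show "\<exists>K. \<forall>\<^sub>F w in at z. \<forall>x. norm (F w x) \<le> K * norm x" if z: "z \<in> ?\<Omega>" for z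
    proof (cases "z \<in> \<Delta>")
      case True
      obtain K where K: "\<And>x. norm (F z x) \<le> K * norm x" using F_bound[OF True] by blast
      have "\<forall>\<^sub>F w in at z. \<forall>x. norm (F w x) \<le> (K + 1) * norm x"
        using op_tendstoD[OF F_lim[OF True] zero_less_one]
      proof eventually_elim
        case (elim w)
        have "norm (F w x) \<le> (K + 1) * norm x" for x
          using norm_triangle_sub[of "F w x" "F z x"] K[of x] elim by (simp add: distrib_right) (smt (verit) UNIV_I)
        then show ?case by blast
      qed
      then show ?thesis by blast
    next
      case False
      then have zde: "z \<in> disc \<union> ext_disc" using z by blast
      have "((\<lambda>w. inverse \<bar>1 - cmod w\<bar>) \<longlongrightarrow> inverse \<bar>1 - cmod z\<bar>) (at z)"
        using zde by (intro tendsto_intros) auto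
      then have "\<forall>\<^sub>F w in at z. inverse \<bar>1 - cmod w\<bar> < inverse \<bar>1 - cmod z\<bar> + 1"
        by (rule order_tendstoD(2)) simp
      moreover have "\<forall>\<^sub>F w in at z. w \<in> disc \<union> ext_disc" by (rule eventually_at_in_open'[OF open_de zde])
      ultimately have "\<forall>\<^sub>F w in at z. \<forall>x. norm (F w x) \<le> (inverse \<bar>1 - cmod z\<bar> + 1) * norm x"
      proof eventually_elim
        case (elim w)
        show ?case
          using order_trans[OF R_bound[OF elim(2)] mult_right_mono[OF less_imp_le[OF elim(1)] norm_ge_zero]] by blast
      qed
      then show ?thesis by blast
    qed
    show "(\<lambda>z. cinner (F z x) y) holomorphic_on ?\<Omega>" for x y
    proof (rule holomorphic_on_across_circle[OF open\<Omega>])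
      show "(\<lambda>z. cinner (F z x) y) holomorphic_on (?\<Omega> - sphere 0 1)"
        using open_arc_subset_circle[OF \<Delta>] by (intro holomorphic_on_subset[OF hol]) auto
      have "isCont (\<lambda>z. cinner (F z x) y) z" if "z \<in> ?\<Omega>" for z
      proof (cases "z \<in> \<Delta>")
        case True
        show ?thesis
          unfolding isCont_def
          by (intro cinner.tendsto tendsto_const op_tendsto_pointwise[OF F_lim[OF True]]) simp
      next
        case False
        then have "z \<in> disc \<union> ext_disc" using that by blast
        with holomorphic_on_imp_continuous_on[OF hol, of x y] show ?thesis
          by (simp add: continuous_on_eq_continuous_at[OF open_de])
      qed
      then show "continuous_on ?\<Omega> (\<lambda>z. cinner (F z x) y)"
        by (simp add: continuous_at_imp_continuous_on)
    qed
  qed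
  with FR show ?thesis by blast
qed

end

theorem theorem3p2:
  fixes D :: "'a::separable_chilbert set" and V :: "'a \<Rightarrow> 'a"
    and J :: "'a \<Rightarrow> 'b::separable_chilbert" and U :: "'b \<Rightarrow> 'b"
    and R C :: "complex \<Rightarrow> 'a \<Rightarrow> 'a"
    and z0 :: complex and \<Delta> :: "complex set"
  assumes "closed_isometric D V"
    and "z0 \<in> disc - {0}"
    and "is_generalized_resolvent D V J U R"
    and "inin_corresponds D V z0 R C"
    and "open_arc \<Delta>"
  shows "(\<exists>F. op_analytic_on UNIV (disc \<union> ext_disc \<union> \<Delta>) F \<and>
            (\<forall>z \<in> disc \<union> ext_disc. F z = R z))
     \<longleftrightarrow>
         (\<exists>G. (\<forall>z\<in>disc. \<forall>x \<in> N_space D V z0. G z x = C z x) \<and>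
            op_continuous_on (N_space D V z0) (disc \<union> \<Delta>) G \<and>
            (\<forall>w\<in>\<Delta>. isometric_on (N_space D V z0) (G w) \<and>
                   G w ` N_space D V z0 = N_space D V (1 / cnj z0)) \<and>
            (\<forall>w\<in>\<Delta>. bij (\<lambda>x. x - w *\<^sub>C V_ext D V z0 (G w) x)))"
proof
  assume "\<exists>F. op_analytic_on UNIV (disc \<union> ext_disc \<union> \<Delta>) F \<and> (\<forall>z\<in>disc \<union> ext_disc. F z = R z)"
  then obtain F where "op_analytic_on UNIV (disc \<union> ext_disc \<union> \<Delta>) F" "\<And>z. z \<in> disc \<union> ext_disc \<Longrightarrow> F z = R z"
    by blast
  from parameter_extension[OF assms this]
  show "\<exists>G. (\<forall>z\<in>disc. \<forall>x \<in> N_space D V z0. G z x = C z x) \<and>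
      op_continuous_on (N_space D V z0) (disc \<union> \<Delta>) G \<and>
      (\<forall>w\<in>\<Delta>. isometric_on (N_space D V z0) (G w) \<and> G w ` N_space D V z0 = N_space D V (1 / cnj z0)) \<and>
      (\<forall>w\<in>\<Delta>. bij (\<lambda>x. x - w *\<^sub>C V_ext D V z0 (G w) x))" .
next
  assume "\<exists>G. (\<forall>z\<in>disc. \<forall>x \<in> N_space D V z0. G z x = C z x) \<and>
      op_continuous_on (N_space D V z0) (disc \<union> \<Delta>) G \<and>
      (\<forall>w\<in>\<Delta>. isometric_on (N_space D V z0) (G w) \<and> G w ` N_space D V z0 = N_space D V (1 / cnj z0)) \<and>
      (\<forall>w\<in>\<Delta>. bij (\<lambda>x. x - w *\<^sub>C V_ext D V z0 (G w) x))"
  then obtain G where G: "\<forall>z\<in>disc. \<forall>x \<in> N_space D V z0. G z x = C z x"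
      "op_continuous_on (N_space D V z0) (disc \<union> \<Delta>) G"
      "\<forall>w\<in>\<Delta>. isometric_on (N_space D V z0) (G w) \<and> G w ` N_space D V z0 = N_space D V (1 / cnj z0)"
      "\<forall>w\<in>\<Delta>. bij (\<lambda>x. x - w *\<^sub>C V_ext D V z0 (G w) x)"
    by (elim exE conjE) (rule that)
  show "\<exists>F. op_analytic_on UNIV (disc \<union> ext_disc \<union> \<Delta>) F \<and> (\<forall>z\<in>disc \<union> ext_disc. F z = R z)"
    by (rule resolvent_continuation[OF assms _ G(2)]) (use G(1,3,4) in simp_all)
qed

end
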